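(* Let $N\ge1$, $1\le m\le N$, $A\in\mathbb R^{N\times N}$, $B\in\mathbb R^{N\times m}$. Assume that $\sigma(A)\subset\mathbb R$ and that the pair $(A,B)$ satisfies the Kalman rank condition, with Kalman index $K$. Then, for every $T>0$, there exists $C_T>0$ such that every terminal datum $q_T\in\mathcal Y_{K,J}^-$ and the corresponding solution $q$ of the adjoint system satisfy $$\|q_T\|_{\mathcal Y_{K,J}^-}^2\le C_T\int_0^T\int_{\mathbb R}|B^\top q(t,x)|^2\,dx\,dt .$$
   Context: Fourier convention: $\widehat f(\xi)=\int_{\mathbb R}f(x)e^{-ix\xi}\,dx$. Kalman rank condition with Kalman index $K$: $K\ge0$ is the smallest integer such that $\operatorname{rank}(B,AB,\dots,A^KB)=N$. Kalman layers: $\mathcal K_k=\operatorname{Ran}(B,AB,\dots,A^kB)\subset\mathbb R^N$, $\mathcal K_{-1}=\{0\}$, $\mathcal V_k=\mathcal K_k\cap\mathcal K_{k-1}^\perp$ for $k=0,\dots,K$ (Euclidean orthogonality); $\Pi_k$ is the orthogonal projector onto $\mathcal V_k$, extended complex-linearly to $\mathbb C^N$. Jordan data: fix a real Jordan decomposition $A^\top=SJS^{-1}$ and set $\widetilde B^\top:=B^\top S$. For $\lambda\in\sigma(A)$ let $\mathcal E_\lambda\subset\mathbb C^N$ be the generalized eigenspace of $J$, $N_\lambda:=(J-\lambda I)|_{\mathcal E_\lambda}$, $m_\lambda$ the nilpotency index of $N_\lambda$ (smallest integer with $N_\lambda^{m_\lambda}=0$), and $\widetilde B_\lambda^\top:=\widetilde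 B^\top|_{\mathcal E_\lambda}$. For $u\in\mathbb C^N$ with component $u_\lambda$ in $\mathcal E_\lambda$ (decomposition $\mathbb C^N=\bigoplus_\lambda\mathcal E_\lambda$) put $a_{\lambda,j}(u):=\frac1{j!}\widetilde B_\lambda^\top N_\lambda^ju_\lambda$, $0\le j\le m_\lambda-1$, and for $z\in\mathbb C^N$ $$\|z\|_{\mathcal J,\xi}^2:=\sum_{\lambda\in\sigma(A)}\sum_{j=0}^{m_\lambda-1}|\xi|^{2j}\,\|a_{\lambda,j}(S^{-1}z)\|_{\mathbb C^m}^2 .$$ Thresholds $0<\xi_0<\xi_1$ are fixed, with $\xi_0$ sufficiently small and $\xi_1$ sufficiently large; i.e. statements are for all choices $\xi_0\le\xi_0^*$, $\xi_1\ge\xi_1^*$ for some $\xi_0^*,\xi_1^*>0$ depending on $A,B,T$ (different admissible choices give equivalent norms). The Jordan-adapted space $\mathcal Y_{K,J}^-$ is the Hilbert space (completion of smooth, Schwartz data; identified on the Fourier side with measurable $\widehat q_T:\mathbb R\to\mathbb C^N$ of finite norm) with norm $$\|q_T\|_{\mathcal Y_{K,J}^-}^2:=\int_{|\xi|\le\xi_0}\sum_{k=0}^K|\xi|^{2k}|\Pi_k\widehat q_T(\xi)|^2d\xi+\int_{\xi_0<|\xi|<\xi_1}|\widehat q_T(\xi)|^2d\xi+\int_{|\xi|\ge\xi_1}\|\widehat q_T(\xi)\|_{\mathcal J,\xi}^2d\xi .$$ Adjoint system: $q_t+A^\top q_x=0$ in $(0,T)\times\mathbb R$, $q(T,\cdot)=q_T$,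 with $\widehat q(t,\xi)=e^{i\xi(T-t)A^\top}\widehat q_T(\xi)$; for general $q_T\in\mathcal Y_{K,J}^-$, $B^\top q\in L^2((0,T)\times\mathbb R;\mathbb C^m)$ is defined by continuous extension from smooth data. *)

theory Defs
  imports "Jordan_Normal_Form.Jordan_Normal_Form" "HOL-Analysis.Analysis"
begin

hide_const (open) Matrix.mat Matrix.vec Matrix.row Matrix.col Matrix.rows Matrix.cols
no_notation vec_index (infixl "$" 100)
no_notation scalar_prod (infix "\<bullet>" 70)

section \<open>Matrices\<close>

primrec matpow :: "'a::comm_ring_1^'n^'n \<Rightarrow> nat \<Rightarrow> 'a^'n^'n" where
  "matpow M 0 = mat 1"
| "matpow M (Suc k) = M ** matpow M k"

definition cmat :: "real^'n^'m \<Rightarrow> complex^'n^'m" where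
  "cmat M = (\<chi> i j. complex_of_real (M $ i $ j))"

definition mexp :: "complex^'n^'n \<Rightarrow> complex^'n^'n" where
  "mexp M = (\<Sum>k. (1 / fact k) *\<^sub>R matpow M k)"

definition matrix_spectrum :: "complex^'n^'n \<Rightarrow> complex set" where
  "matrix_spectrum M = {\<mu>. \<exists>v. v \<noteq> 0 \<and> M *v v = \<mu> *s v}"

text \<open>Index types carry no order, so being a Jordan matrix is understood with respect to some
  enumeration \<open>e\<close> of the index type.\<close>

definition is_jordan :: "real^'n^'n \<Rightarrow> bool" where
  "is_jordan J \<longleftrightarrow> (\<exists>n_as (e :: 'n \<Rightarrow> nat).
     0 \<notin> fst ` set n_as \<and> sum_list (map fst n_as) = CARD('n) \<and>
     bij_betw e UNIV {..<CARD('n)} \<and>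
     (\<forall>i j. J $ i $ j = jordan_matrix n_as $$ (e i, e j)))"

definition jordan_decomposition :: "real^'n^'n \<Rightarrow> real^'n^'n \<Rightarrow> real^'n^'n \<Rightarrow> bool" where
  "jordan_decomposition M S J \<longleftrightarrow> is_jordan J \<and> invertible S \<and> M = S ** J ** matrix_inv S"


section \<open>Kalman layers\<close>

text \<open>Indices are shifted by one to include \<open>\<K>\<^sub>-\<^sub>1 = {0}\<close>:
  \<open>kalman_space A B (Suc k)\<close> is the range of the block matrix \<open>(B, AB, \<dots>, A\<^sup>kB)\<close>, i.e. the span
  of its columns, and its dimension is the rank of that matrix.\<close>

definition kalman_space :: "real^'n^'n \<Rightarrow> real^'m^'n \<Rightarrow> nat \<Rightarrow> (real^'n) set" where
  "kalman_space A B k = span (\<Union>j<k. columns (matpow A j ** B))"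

definition kalman_full :: "real^'n^'n \<Rightarrow> real^'m^'n \<Rightarrow> nat \<Rightarrow> bool" where
  "kalman_full A B k \<longleftrightarrow> dim (kalman_space A B (Suc k)) = CARD('n)"

definition kalman_index :: "real^'n^'n \<Rightarrow> real^'m^'n \<Rightarrow> nat \<Rightarrow> bool" where
  "kalman_index A B K \<longleftrightarrow> kalman_full A B K \<and> (\<forall>k<K. \<not> kalman_full A B k)"

definition kalman_layer :: "real^'n^'n \<Rightarrow> real^'m^'n \<Rightarrow> nat \<Rightarrow> (real^'n) set" where
  "kalman_layer A B k = kalman_space A B (Suc k) \<inter> (kalman_space A B k)\<^sup>\<bottom>"

definition orth_proj :: "(real^'n) set \<Rightarrow> real^'n \<Rightarrow> real^'n" where
  "orth_proj V x = (THE y. y \<in> V \<and> x - y \<in> V\<^sup>\<bottom>)"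

definition layer_proj :: "real^'n^'n \<Rightarrow> real^'m^'n \<Rightarrow> nat \<Rightarrow> complex^'n \<Rightarrow> complex^'n" where
  "layer_proj A B k z =
     (\<chi> i. Complex (orth_proj (kalman_layer A B k) (\<chi> l. Re (z $ l)) $ i)
                   (orth_proj (kalman_layer A B k) (\<chi> l. Im (z $ l)) $ i))"


section \<open>Jordan data\<close>

definition nil_map :: "real^'n^'n \<Rightarrow> complex \<Rightarrow> complex^'n^'n" where
  "nil_map J \<mu> = cmat J - mat \<mu>"

definition gen_eigenspace :: "real^'n^'n \<Rightarrow> complex \<Rightarrow> (complex^'n) set" where
  "gen_eigenspace J \<mu> = {u. \<exists>k. matpow (nil_map J \<mu>) k *v u = 0}"

definition nil_index :: "real^'n^'n \<Rightarrow> complex \<Rightarrow> nat" where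
  "nil_index J \<mu> = (LEAST k. \<forall>u \<in> gen_eigenspace J \<mu>. matpow (nil_map J \<mu>) k *v u = 0)"

text \<open>The component \<open>u\<^sub>\<mu>\<close> of \<open>u\<close> in the direct sum of the generalized eigenspaces; the middle
  clause only pins down the values of the family \<open>w\<close> off the spectrum.\<close>

definition eig_component :: "real^'n^'n \<Rightarrow> complex \<Rightarrow> complex^'n \<Rightarrow> complex^'n" where
  "eig_component J \<mu> u =
     (THE w. (\<forall>\<nu> \<in> matrix_spectrum (cmat J). w \<nu> \<in> gen_eigenspace J \<nu>) \<and>
             (\<forall>\<nu>. \<nu> \<notin> matrix_spectrum (cmat J) \<longrightarrow> w \<nu> = 0) \<and>
             (\<Sum>\<nu> \<in> matrix_spectrum (cmat J). w \<nu>) = u) \<mu>"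

definition jordan_coeff ::
  "real^'m^'n \<Rightarrow> real^'n^'n \<Rightarrow> real^'n^'n \<Rightarrow> complex \<Rightarrow> nat \<Rightarrow> complex^'n \<Rightarrow> complex^'m" where
  "jordan_coeff B S J \<mu> j u =
     (1 / fact j) *\<^sub>R (cmat (transpose B ** S) *v
        (matpow (nil_map J \<mu>) j *v eig_component J \<mu> u))"

definition jordan_normsq ::
  "real^'n^'n \<Rightarrow> real^'m^'n \<Rightarrow> real^'n^'n \<Rightarrow> real^'n^'n \<Rightarrow> real \<Rightarrow> complex^'n \<Rightarrow> real" where
  "jordan_normsq A B S J \<xi> z =
     (\<Sum>\<mu> \<in> matrix_spectrum (cmat A). \<Sum>j < nil_index J \<mu>.
        \<bar>\<xi>\<bar> ^ (2 * j) * (norm (jordan_coeff B S J \<mu> j (cmat (matrix_inv S) *v z)))\<^sup>2)"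


section \<open>The Jordan-adapted space\<close>

text \<open>Its elements are represented by their Fourier transforms \<open>h\<close>.\<close>

definition Y_normsq ::
  "real^'n^'n \<Rightarrow> real^'m^'n \<Rightarrow> nat \<Rightarrow> real^'n^'n \<Rightarrow> real^'n^'n \<Rightarrow> real \<Rightarrow> real
     \<Rightarrow> (real \<Rightarrow> complex^'n) \<Rightarrow> ennreal" where
  "Y_normsq A B K S J \<xi>0 \<xi>1 h =
     (\<integral>\<^sup>+\<xi>\<in>{\<xi>. \<bar>\<xi>\<bar> \<le> \<xi>0}. ennreal (\<Sum>k\<le>K. \<bar>\<xi>\<bar> ^ (2 * k) * (norm (layer_proj A B k (h \<xi>)))\<^sup>2) \<partial>lborel)
   + (\<integral>\<^sup>+\<xi>\<in>{\<xi>. \<xi>0 < \<bar>\<xi>\<bar> \<and> \<bar>\<xi>\<bar> < \<xi>1}. ennreal ((norm (h \<xi>))\<^sup>2) \<partial>lborel)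
   + (\<integral>\<^sup>+\<xi>\<in>{\<xi>. \<bar>\<xi>\<bar> \<ge> \<xi>1}. ennreal (jordan_normsq A B S J \<xi> (h \<xi>)) \<partial>lborel)"

definition Y_space ::
  "real^'n^'n \<Rightarrow> real^'m^'n \<Rightarrow> nat \<Rightarrow> real^'n^'n \<Rightarrow> real^'n^'n \<Rightarrow> real \<Rightarrow> real
     \<Rightarrow> (real \<Rightarrow> complex^'n) set" where
  "Y_space A B K S J \<xi>0 \<xi>1 = {h \<in> borel_measurable borel. Y_normsq A B K S J \<xi>0 \<xi>1 h < \<infinity>}"


section \<open>The adjoint system and its observation\<close>

definition fourier :: "(real \<Rightarrow> complex^'n) \<Rightarrow> real \<Rightarrow> complex^'n" where
  "fourier f \<xi> = (\<integral>x. exp (- \<i> * complex_of_real (x * \<xi>)) *s f x \<partial>lborel)"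


definition schwartz :: "(real \<Rightarrow> complex^'n) \<Rightarrow> bool" where
  "schwartz f \<longleftrightarrow> (\<exists>D :: nat \<Rightarrow> real \<Rightarrow> complex^'n. D 0 = f \<and>
     (\<forall>k x. (D k has_vector_derivative D (Suc k) x) (at x)) \<and>
     (\<forall>j k. bounded (range (\<lambda>x. x ^ j *\<^sub>R D k x))))"

definition adjoint_solution ::
  "real^'n^'n \<Rightarrow> real \<Rightarrow> (real \<Rightarrow> complex^'n) \<Rightarrow> (real \<Rightarrow> real \<Rightarrow> complex^'n) \<Rightarrow> bool" where
  "adjoint_solution A T f q \<longleftrightarrow>
     q T = f \<and>
     continuous_on ({0..T} \<times> UNIV) (\<lambda>(t, x). q t x) \<and>
     (\<forall>t\<in>{0..T}. schwartz (q t)) \<and>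
     (\<exists>qt qx. \<forall>t\<in>{0<..<T}. \<forall>x.
        ((\<lambda>s. q s x) has_vector_derivative qt t x) (at t) \<and>
        (q t has_vector_derivative qx t x) (at x) \<and>
        qt t x + cmat (transpose A) *v qx t x = 0) \<and>
     (\<forall>t\<in>{0..T}. \<forall>\<xi>. fourier (q t) \<xi> =
        mexp (mat (\<i> * complex_of_real (\<xi> * (T - t))) ** cmat (transpose A)) *v fourier f \<xi>)"

definition L2_normsq :: "real \<Rightarrow> (real \<times> real \<Rightarrow> complex^'m) \<Rightarrow> ennreal" where
  "L2_normsq T g = (\<integral>\<^sup>+t\<in>{0<..<T}. (\<integral>\<^sup>+x. ennreal ((norm (g (t, x)))\<^sup>2) \<partial>lborel) \<partial>lborel)"

text \<open>\<open>g\<close> represents \<open>B\<^sup>\<top>q\<close> for the datum with Fourier transform \<open>h\<close>: the continuous extension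
  of the observation map, i.e. the \<open>L\<^sup>2((0,T) \<times> \<real>)\<close>-limit of the observations of Schwartz data
  converging to the given datum in the Jordan-adapted space.\<close>

definition adjoint_observation ::
  "real^'n^'n \<Rightarrow> real^'m^'n \<Rightarrow> nat \<Rightarrow> real^'n^'n \<Rightarrow> real^'n^'n \<Rightarrow> real \<Rightarrow> real \<Rightarrow> real
     \<Rightarrow> (real \<Rightarrow> complex^'n) \<Rightarrow> (real \<times> real \<Rightarrow> complex^'m) \<Rightarrow> bool" where
  "adjoint_observation A B K S J \<xi>0 \<xi>1 T h g \<longleftrightarrow>
     g \<in> borel_measurable borel \<and> L2_normsq T g < \<infinity> \<and>
     (\<exists>f q. (\<forall>n. schwartz (f n) \<and> adjoint_solution A T (f n) (q n)) \<and>
        (\<lambda>n. Y_normsq A B K S J \<xi>0 \<xi>1 (\<lambda>\<xi>. fourier (f n) \<xi> - h \<xi>)) \<longlonglongrightarrow> 0 \<and>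
        (\<lambda>n::nat. L2_normsq T (\<lambda>(t, x). cmat (transpose B) *v q n t x - g (t, x))) \<longlonglongrightarrow> 0)"

end

theory Submission
  imports Defs "HOL-Probability.Characteristic_Functions" "HOL-Probability.Sinc_Integral"
begin

text \<open>On the Fourier side the adjoint system decouples: at frequency \<open>\<xi>\<close> the observation at time
\<open>T - s\<close> is \<open>B\<^sup>\<top> exp (i \<xi> s A\<^sup>\<top>) z\<close> with \<open>z\<close> the value of the transformed datum.  The squared norm of the
Jordan-adapted space is the integral over \<open>\<xi>\<close> of a quadratic form \<open>Y_density\<close> in \<open>z\<close>.  The heart of
the matter is therefore the inequality \<open>frequency_observability\<close> between this form and the energy of the observation on \<open>[0, T]\<close>, with a constant independent of \<open>\<xi>\<close>
and \<open>z\<close>.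

\<^bold>\<open>Bounded frequencies.\<close>  For small \<open>\<xi>\<close> the observation is, up to \<open>O(\<bar>\<xi>\<bar>\<^sup>K\<^sup>+\<^sup>1 \<bar>z\<bar>)\<close>, a polynomial in time
with coefficients \<open>(i \<xi>)\<^sup>j B\<^sup>\<top> (A\<^sup>\<top>)\<^sup>j z / j!\<close>, \<open>j \<le> K\<close>.  The coefficients of a polynomial are controlled by its
\<open>L\<^sup>2\<close> norm, and the Kalman condition says that the vectors \<open>B\<^sup>\<top> (A\<^sup>\<top>)\<^sup>j z\<close> determine \<open>z\<close>, so the remainder
can be absorbed.  Since the observation depends on \<open>\<xi> s\<close> only, shortening the time interval turns any
bounded range of frequencies into a range of small ones (\<open>bounded_frequency_estimate\<close>).
Finally \<open>\<Pi>\<^sub>k z\<close> only sees \<open>B\<^sup>\<top> (A\<^sup>\<top>)\<^sup>j z\<close> with \<open>j \<le> k\<close>, because the layer lies in the span of the columns of \<open>A\<^sup>j B\<close> with \<open>j \<le> k\<close> (\<open>layer_proj_bound\<close>).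

\<^bold>\<open>High frequencies.\<close>  In Jordan coordinates the observation is a sum over the real eigenvalues \<open>\<nu>\<close> of
\<open>exp (i \<xi> \<nu> s)\<close> times the polynomial with coefficients \<open>(i \<xi>)\<^sup>j a\<^sub>\<nu>\<^sub>,\<^sub>j\<close>.  Different eigenvalues oscillate relative
to each other with frequency proportional to \<open>\<xi>\<close>, so for large \<open>\<bar>\<xi>\<bar>\<close> the cross terms are negligible and
each polynomial controls its own coefficients
(\<open>exponential_polynomial_coeffs_le_integral\<close>, \<open>high_frequency_estimate\<close>).

On a range of frequencies bounded and bounded away from zero all the quadratic forms involved
are dominated by \<open>\<bar>z\<bar>\<^sup>2\<close>, which the bounded-frequency estimate controls.  Hence the two regimes
overlap, and both thresholds can be taken to be \<open>1\<close>.

To return to physical space one integrates in \<open>\<xi>\<close> and bounds the \<open>L\<^sup>2\<close> norm of the Fourier transform of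
\<open>B\<^sup>\<top> q (t, \<cdot>)\<close> by Plancherel's inequality (\<open>plancherel_le\<close>, \<open>observed_energy_le_observation\<close>).
Since both sides are squares of seminorms, the estimate for Schwartz data passes to the limit that defines the observation of a
general datum.\<close>

section \<open>Coercivity of exponential polynomials\<close>

lemma norm_add_sq_le: "(norm (a + b :: 'a::real_normed_vector))\<^sup>2 \<le> 2 * (norm a)\<^sup>2 + 2 * (norm b)\<^sup>2"
proof -
  have "(norm (a + b))\<^sup>2 \<le> (norm a + norm b)\<^sup>2"
    by (intro power_mono norm_triangle_ineq) auto
  also have "\<dots> \<le> 2 * (norm a)\<^sup>2 + 2 * (norm b)\<^sup>2"
    using sum_squares_bound[of "norm a" "norm b"] by (simp add: power2_sum)
  finally show ?thesis .
qed

lemma norm_diff_sq_le: "(norm (a - b :: 'a::real_normed_vector))\<^sup>2 \<le> 2 * (norm a)\<^sup>2 + 2 * (norm b)\<^sup>2"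
  using norm_add_sq_le[of a "- b"] by simp

lemma norm_sum_sq_le:
  fixes f :: "'b \<Rightarrow> 'a::real_normed_vector"
  shows "(norm (\<Sum>i\<in>I. f i))\<^sup>2 \<le> real (card I) * (\<Sum>i\<in>I. (norm (f i))\<^sup>2)"
proof -
  have "(norm (\<Sum>i\<in>I. f i))\<^sup>2 \<le> (\<Sum>i\<in>I. norm (f i))\<^sup>2"
    by (intro power_mono norm_sum) auto
  also have "\<dots> \<le> real (card I) * (\<Sum>i\<in>I. (norm (f i))\<^sup>2)"
    using sum_squared_le_sum_of_squares[of "\<lambda>i. norm (f i)" I] by (simp add: mult.commute)
  finally show ?thesis .
qed

text \<open>Induction on the degree.  The difference \<open>P s - 2\<^sup>d P (s / 2)\<close> has no term of degree \<open>d\<close>, its other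
coefficients are those of \<open>P\<close> up to factors of modulus at least \<open>1\<close>, and its \<open>L\<^sup>2\<close> norm is controlled by
that of \<open>P\<close>.  So the induction hypothesis bounds the lower coefficients, and the top one follows by
subtraction.\<close>

lemma polynomial_coeffs_le_integral:
  assumes "T > 0"
  shows "\<exists>C>0. \<forall>y :: nat \<Rightarrow> 'a::real_normed_vector.
    (\<Sum>j\<le>d. (norm (y j))\<^sup>2) \<le> C * integral {0..T} (\<lambda>s. (norm (\<Sum>j\<le>d. s ^ j *\<^sub>R y j))\<^sup>2)"
proof (induction d)
  case 0
  show ?case
    by (rule exI[of _ "1 / T"]) (use assms in auto)
next
  case (Suc d)
  then obtain C where C: "C > 0"
    and IH: "\<And>y :: nat \<Rightarrow> 'a. (\<Sum>j\<le>d. (norm (y j))\<^sup>2)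
      \<le> C * integral {0..T} (\<lambda>s. (norm (\<Sum>j\<le>d. s ^ j *\<^sub>R y j))\<^sup>2)" by blast
  define n where "n = 2 * Suc d"
  \<comment> \<open>\<open>E\<close> bounds the energy of \<open>P s - 2\<^sup>d\<^sup>+\<^sup>1 P (s / 2)\<close> by that of \<open>P\<close>; \<open>W\<close> is the energy of \<open>s\<^sup>d\<^sup>+\<^sup>1\<close>.\<close>
  define E :: real where "E = 2 + 4 * (2 ^ Suc d)\<^sup>2"
  define W where "W = T ^ Suc n / Suc n"
  define D :: real where "D = (2 + 2 * T * (real (Suc d) * ((1 + T) ^ d)\<^sup>2) * (C * E)) / W"
  have W: "W > 0" unfolding W_def using assms by (intro divide_pos_pos zero_less_power) auto
  have E: "E > 0" by (simp add: E_def add_pos_nonneg)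
  have D: "D > 0" unfolding D_def using assms C E W
    by (intro divide_pos_pos add_pos_nonneg mult_nonneg_nonneg) auto
  show ?case
  proof (intro exI[of _ "C * E + D"] conjI allI)
    show "C * E + D > 0" using C E D by (simp add: add_pos_pos)
    fix y :: "nat \<Rightarrow> 'a"
    define P where "P s = (\<Sum>j\<le>Suc d. s ^ j *\<^sub>R y j)" for s
    define R where "R s = (\<Sum>j\<le>d. s ^ j *\<^sub>R y j)" for s
    define I where "I = integral {0..T} (\<lambda>s. (norm (P s))\<^sup>2)"
    have contP: "continuous_on X P" and contR: "continuous_on X R" for X
      unfolding P_def R_def by (intro continuous_intros)+
    have contP2: "continuous_on X (\<lambda>s. P (s / 2))" for X
      unfolding P_def by (intro continuous_intros) simp
    have Q: "P s - 2 ^ Suc d *\<^sub>R P (s / 2) = (\<Sum>j\<le>d. s ^ j *\<^sub>R ((1 - 2 ^ Suc d / 2 ^ j) *\<^sub>R y j))" for s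
      by (simp add: P_def scaleR_sum_right sum_subtractf power_divide scaleR_left_diff_distrib
          scaleR_right_diff_distrib scaleR_right_distrib mult_ac)
    have half: "integral {0..T} (\<lambda>s. (norm (P (s / 2)))\<^sup>2) \<le> 2 * I"
    proof -
      have eq: "(\<lambda>x::real. x / (1 / 2)) ` {0..T / 2} = {0..T}"
        by (auto simp: image_iff intro!: bexI[of _ "_ / 2"])
      have "integral {0..T} (\<lambda>s. (norm (P (s / 2)))\<^sup>2) = 2 * integral {0..T / 2} (\<lambda>s. (norm (P s))\<^sup>2)"
        using integral_stretch_real[of "1 / 2" 0 "T / 2" "\<lambda>s. (norm (P s))\<^sup>2"] unfolding eq by simp
      also have "integral {0..T / 2} (\<lambda>s. (norm (P s))\<^sup>2) \<le> I"
        unfolding I_def using assms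
        by (intro integral_subset_le integrable_continuous_real continuous_intros contP) auto
      finally show ?thesis by simp
    qed
    have I: "I \<ge> 0" unfolding I_def by (intro Henstock_Kurzweil_Integration.integral_nonneg
        integrable_continuous_real continuous_intros contP) auto
    have "(\<Sum>j\<le>d. (norm (y j))\<^sup>2) \<le> (\<Sum>j\<le>d. (norm ((1 - 2 ^ Suc d / 2 ^ j) *\<^sub>R y j))\<^sup>2)"
    proof (rule sum_mono)
      fix j assume "j \<in> {..d}"
      then have "(2::real) ^ Suc j \<le> 2 ^ Suc d" by (intro power_increasing) auto
      then have "(2::real) \<le> 2 ^ Suc d / 2 ^ j" by (simp add: field_simps)
      then have "1 \<le> \<bar>1 - (2::real) ^ Suc d / 2 ^ j\<bar>" by linarith
      then have "1 * norm (y j) \<le> norm ((1 - 2 ^ Suc d / 2 ^ j) *\<^sub>R y j)"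
        unfolding norm_scaleR by (rule mult_right_mono) simp
      then show "(norm (y j))\<^sup>2 \<le> (norm ((1 - 2 ^ Suc d / 2 ^ j) *\<^sub>R y j))\<^sup>2"
        by (intro power_mono) auto
    qed
    also have "\<dots> \<le> C * integral {0..T} (\<lambda>s. (norm (P s - 2 ^ Suc d *\<^sub>R P (s / 2)))\<^sup>2)"
      unfolding Q by (rule IH)
    also have "integral {0..T} (\<lambda>s. (norm (P s - 2 ^ Suc d *\<^sub>R P (s / 2)))\<^sup>2) \<le>
        integral {0..T} (\<lambda>s. 2 * (norm (P s))\<^sup>2 + 2 * (2 ^ Suc d)\<^sup>2 * (norm (P (s / 2)))\<^sup>2)"
    proof (intro integral_le integrable_continuous_real continuous_intros contP contP2)
      fix s
      show "(norm (P s - 2 ^ Suc d *\<^sub>R P (s / 2)))\<^sup>2 \<le>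
          2 * (norm (P s))\<^sup>2 + 2 * (2 ^ Suc d)\<^sup>2 * (norm (P (s / 2)))\<^sup>2"
        using norm_diff_sq_le[of "P s" "2 ^ Suc d *\<^sub>R P (s / 2)"] by (simp add: power_mult_distrib)
    qed
    also have "\<dots> = 2 * I + 2 * (2 ^ Suc d)\<^sup>2 * integral {0..T} (\<lambda>s. (norm (P (s / 2)))\<^sup>2)"
      unfolding I_def
      by (subst Henstock_Kurzweil_Integration.integral_add)
        (auto intro!: integrable_continuous_real continuous_intros contP contP2)
    also have "\<dots> \<le> E * I"
    proof -
      have "2 * (2 ^ Suc d)\<^sup>2 * integral {0..T} (\<lambda>s. (norm (P (s / 2)))\<^sup>2) \<le> 2 * (2 ^ Suc d)\<^sup>2 * (2 * I)"
        by (rule mult_left_mono[OF half]) simp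
      then show ?thesis unfolding E_def by (simp add: algebra_simps)
    qed
    finally have low: "(\<Sum>j\<le>d. (norm (y j))\<^sup>2) \<le> C * E * I" using C by simp
    have "T ^ Suc n / Suc n * (norm (y (Suc d)))\<^sup>2
        = integral {0..T} (\<lambda>s. (norm (s ^ Suc d *\<^sub>R y (Suc d)))\<^sup>2)"
    proof -
      have "((\<lambda>s. s ^ n * (norm (y (Suc d)))\<^sup>2) has_integral
          (T ^ Suc n / Suc n * (norm (y (Suc d)))\<^sup>2 - 0 ^ Suc n / Suc n * (norm (y (Suc d)))\<^sup>2)) {0..T}"
        using assms
        by (intro fundamental_theorem_of_calculus)
          (auto intro!: derivative_eq_intros simp: has_real_derivative_iff_has_vector_derivative[symmetric]
            simp del: power_Suc of_nat_Suc)
      then have "integral {0..T} (\<lambda>s. s ^ n * (norm (y (Suc d)))\<^sup>2) = T ^ Suc n / Suc n * (norm (y (Suc d)))\<^sup>2"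
        by (auto dest!: integral_unique)
      moreover have "(norm (s ^ Suc d *\<^sub>R y (Suc d)))\<^sup>2 = s ^ n * (norm (y (Suc d)))\<^sup>2" for s
        by (simp add: n_def power_mult_distrib power_mult power2_eq_square power_add)
      ultimately show ?thesis by simp
    qed
    also have "\<dots> \<le> integral {0..T} (\<lambda>s. 2 * (norm (P s))\<^sup>2 + 2 * (real (Suc d) * ((1 + T) ^ d)\<^sup>2 * (C * E * I)))"
    proof (intro integral_le integrable_continuous_real continuous_intros contP)
      fix s assume s: "s \<in> {0..T}"
      have "(norm (R s))\<^sup>2 \<le> real (Suc d) * (\<Sum>j\<le>d. (norm (s ^ j *\<^sub>R y j))\<^sup>2)"
        unfolding R_def using norm_sum_sq_le[of "\<lambda>j. s ^ j *\<^sub>R y j" "{..d}"] by simp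
      also have "(\<Sum>j\<le>d. (norm (s ^ j *\<^sub>R y j))\<^sup>2) \<le> (\<Sum>j\<le>d. ((1 + T) ^ d)\<^sup>2 * (norm (y j))\<^sup>2)"
      proof (rule sum_mono)
        fix j assume j: "j \<in> {..d}"
        have "s ^ j \<le> (1 + T) ^ j" using s by (intro power_mono) auto
        also have "\<dots> \<le> (1 + T) ^ d" using j assms by (intro power_increasing) auto
        finally have "norm (s ^ j *\<^sub>R y j) \<le> (1 + T) ^ d * norm (y j)"
          using s by (auto intro!: mult_right_mono)
        then have "(norm (s ^ j *\<^sub>R y j))\<^sup>2 \<le> ((1 + T) ^ d * norm (y j))\<^sup>2" by (intro power_mono) auto
        then show "(norm (s ^ j *\<^sub>R y j))\<^sup>2 \<le> ((1 + T) ^ d)\<^sup>2 * (norm (y j))\<^sup>2"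
          by (simp only: power_mult_distrib)
      qed
      also have "\<dots> \<le> ((1 + T) ^ d)\<^sup>2 * (C * E * I)"
        unfolding sum_distrib_left[symmetric] by (intro mult_left_mono low) auto
      finally have "(norm (R s))\<^sup>2 \<le> real (Suc d) * ((1 + T) ^ d)\<^sup>2 * (C * E * I)"
        by (simp add: mult.assoc)
      moreover have "s ^ Suc d *\<^sub>R y (Suc d) = P s - R s" unfolding P_def R_def by simp
      ultimately show "(norm (s ^ Suc d *\<^sub>R y (Suc d)))\<^sup>2 \<le>
          2 * (norm (P s))\<^sup>2 + 2 * (real (Suc d) * ((1 + T) ^ d)\<^sup>2 * (C * E * I))"
        using norm_diff_sq_le[of "P s" "R s"] by simp
    qed
    also have "\<dots> = (2 + 2 * T * (real (Suc d) * ((1 + T) ^ d)\<^sup>2) * (C * E)) * I"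
      unfolding I_def
      by (subst Henstock_Kurzweil_Integration.integral_add)
        (use assms in \<open>auto intro!: integrable_continuous_real continuous_intros contP simp: algebra_simps\<close>)
    also have "\<dots> = W * (D * I)"
      unfolding D_def using W by simp
    finally have "(norm (y (Suc d)))\<^sup>2 \<le> D * I"
      unfolding W_def[symmetric] using W by simp
    with low show "(\<Sum>j\<le>Suc d. (norm (y j))\<^sup>2) \<le> (C * E + D) *
        integral {0..T} (\<lambda>s. (norm (\<Sum>j\<le>Suc d. s ^ j *\<^sub>R y j))\<^sup>2)"
      unfolding I_def P_def by (simp add: algebra_simps)
  qed
qed

text \<open>One integration by parts gains the factor \<open>1 / \<bar>\<omega>\<bar>\<close>.\<close>

lemma oscillatory_integral_bound:
  assumes "T > 0"
  shows "\<exists>C\<ge>0. \<forall>\<omega>. \<omega> \<noteq> 0 \<longrightarrow>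
    norm (integral {0..T} (\<lambda>s. of_real (s ^ n) * cis (\<omega> * s))) \<le> C / \<bar>\<omega>\<bar>"
proof (intro exI[of _ "T ^ n + 0 ^ n + real n * T ^ (n - 1) * T"] conjI allI impI)
  show "0 \<le> T ^ n + 0 ^ n + real n * T ^ (n - 1) * T" using assms by simp
  fix \<omega> :: real assume w: "\<omega> \<noteq> 0"
  \<comment> \<open>\<open>F\<close> is the boundary term and \<open>r\<close> the remaining integrand of the integration by parts.\<close>
  define F where "F s = of_real (s ^ n) * cis (\<omega> * s) / (\<i> * of_real \<omega>)" for s
  define r where "r s = of_real (real n * s ^ (n - 1)) * cis (\<omega> * s) / (\<i> * of_real \<omega>)" for s
  have der: "(F has_vector_derivative (of_real (s ^ n) * cis (\<omega> * s) + r s)) (at s within X)" for s X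
  proof -
    define G where "G z = z ^ n * exp (\<i> * of_real \<omega> * z) / (\<i> * of_real \<omega>)" for z :: complex
    have "(G has_field_derivative (of_real s ^ n * exp (\<i> * of_real \<omega> * of_real s)
        + of_nat n * of_real s ^ (n - 1) * exp (\<i> * of_real \<omega> * of_real s) / (\<i> * of_real \<omega>))) (at (of_real s))"
      unfolding G_def using w by (auto intro!: derivative_eq_intros simp: divide_simps)
    from has_vector_derivative_real_field[OF this] show ?thesis
      unfolding G_def F_def r_def cis_conv_exp by (simp add: mult_ac)
  qed
  have parts: "((\<lambda>s. of_real (s ^ n) * cis (\<omega> * s) + r s) has_integral F T - F 0) {0..T}"
    using assms by (intro fundamental_theorem_of_calculus der) auto
  have cr: "continuous_on {0..T} r" unfolding r_def using w by (intro continuous_intros) auto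
  then have "(r has_integral integral {0..T} r) {0..T}"
    by (intro integrable_integral integrable_continuous_real)
  from has_integral_diff[OF parts this] have "((\<lambda>s. of_real (s ^ n) * cis (\<omega> * s)) has_integral (F T - F 0 - integral {0..T} r)) {0..T}"
    by simp
  then have "norm (integral {0..T} (\<lambda>s. of_real (s ^ n) * cis (\<omega> * s)))
      \<le> norm (F T) + norm (F 0) + norm (integral {0..T} r)"
    using norm_triangle_ineq4[of "F T - F 0" "integral {0..T} r"] norm_triangle_ineq4[of "F T" "F 0"]
    by (simp add: integral_unique)
  also have "norm (integral {0..T} r) \<le> (real n * T ^ (n - 1) / \<bar>\<omega>\<bar>) * (T - 0)"
  proof (rule integral_bound[OF _ cr])
    fix s assume "s \<in> {0..T}"
    then show "norm (r s) \<le> real n * T ^ (n - 1) / \<bar>\<omega>\<bar>"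
      by (auto simp: r_def norm_mult norm_divide norm_power intro!: divide_right_mono mult_left_mono power_mono)
  qed (use assms in simp)
  also have "norm (F T) = T ^ n / \<bar>\<omega>\<bar>" using assms by (simp add: F_def norm_mult norm_divide norm_power)
  also have "norm (F 0) = 0 ^ n / \<bar>\<omega>\<bar>" by (simp add: F_def norm_mult norm_divide norm_power)
  finally show "norm (integral {0..T} (\<lambda>s. of_real (s ^ n) * cis (\<omega> * s)))
      \<le> (T ^ n + 0 ^ n + real n * T ^ (n - 1) * T) / \<bar>\<omega>\<bar>"
    by (simp add: add_divide_distrib)
qed

text \<open>Expanding the square, the diagonal terms give the \<open>L\<^sup>2\<close> norms of the individual polynomials, while a
cross term between \<open>\<nu> \<noteq> \<mu>\<close> is an oscillatory integral with frequency \<open>\<xi> (\<nu> - \<mu>)\<close>, hence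
\<open>O(1 / \<bar>\<xi>\<bar>)\<close> times the sum of the squared coefficients.  For large \<open>\<bar>\<xi>\<bar>\<close> the cross terms are absorbed.\<close>

lemma exponential_polynomial_coeffs_le_integral:
  fixes \<Lambda> :: "real set"
  assumes \<Lambda>: "finite \<Lambda>" and T: "T > 0"
  shows "\<exists>C>0. \<exists>M>0. \<forall>\<xi> (b :: real \<Rightarrow> nat \<Rightarrow> complex). M \<le> \<bar>\<xi>\<bar> \<longrightarrow>
    (\<Sum>\<nu>\<in>\<Lambda>. \<Sum>j\<le>d. (norm (b \<nu> j))\<^sup>2) \<le> C * integral {0..T}
      (\<lambda>s. (norm (\<Sum>\<nu>\<in>\<Lambda>. cis (\<xi> * \<nu> * s) * (\<Sum>j\<le>d. s ^ j *\<^sub>R b \<nu> j)))\<^sup>2)"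
proof -
  obtain C0 where C0: "C0 > 0" and poly: "\<And>y :: nat \<Rightarrow> complex. (\<Sum>j\<le>d. (norm (y j))\<^sup>2)
      \<le> C0 * integral {0..T} (\<lambda>s. (norm (\<Sum>j\<le>d. s ^ j *\<^sub>R y j))\<^sup>2)"
    using polynomial_coeffs_le_integral[OF T, of d] by blast
  obtain c :: "nat \<Rightarrow> real" where c0: "\<And>n. c n \<ge> 0" and c: "\<And>n \<omega>. \<omega> \<noteq> 0 \<Longrightarrow>
      norm (integral {0..T} (\<lambda>s. of_real (s ^ n) * cis (\<omega> * s))) \<le> c n / \<bar>\<omega>\<bar>"
    using oscillatory_integral_bound[OF T] by metis
  \<comment> \<open>A common constant for all cross terms; diagonal summands contribute \<open>1 / 0 = 0\<close>.\<close>
  define \<kappa> where "\<kappa> = (\<Sum>n\<le>2 * d. c n) * (\<Sum>\<nu>\<in>\<Lambda>. \<Sum>\<mu>\<in>\<Lambda>. 1 / \<bar>\<nu> - \<mu>\<bar>)"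
  have \<kappa>: "\<kappa> \<ge> 0" unfolding \<kappa>_def using c0 by (intro mult_nonneg_nonneg sum_nonneg) auto
  have osc: "norm (integral {0..T} (\<lambda>s. of_real (s ^ (j + l)) * cis (\<xi> * (\<nu> - \<mu>) * s))) \<le> \<kappa> / \<bar>\<xi>\<bar>"
    if "\<nu> \<in> \<Lambda>" "\<mu> \<in> \<Lambda>" "\<nu> \<noteq> \<mu>" "j \<le> d" "l \<le> d" "\<xi> \<noteq> 0" for \<nu> \<mu> \<xi> j l
  proof -
    have "norm (integral {0..T} (\<lambda>s. of_real (s ^ (j + l)) * cis (\<xi> * (\<nu> - \<mu>) * s)))
        \<le> c (j + l) / \<bar>\<xi> * (\<nu> - \<mu>)\<bar>" using that by (intro c) auto
    also have "\<dots> = c (j + l) * (1 / \<bar>\<nu> - \<mu>\<bar>) / \<bar>\<xi>\<bar>" by (simp add: abs_mult)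
    also have "\<dots> \<le> \<kappa> / \<bar>\<xi>\<bar>" unfolding \<kappa>_def
    proof (intro divide_right_mono mult_mono)
      show "c (j + l) \<le> (\<Sum>n\<le>2 * d. c n)" using that c0 by (intro member_le_sum) auto
      have "1 / \<bar>\<nu> - \<mu>\<bar> \<le> (\<Sum>\<mu>\<in>\<Lambda>. 1 / \<bar>\<nu> - \<mu>\<bar>)"
        by (rule member_le_sum[of \<mu> \<Lambda> "\<lambda>\<mu>. 1 / \<bar>\<nu> - \<mu>\<bar>"]) (use that \<Lambda> in auto)
      also have "\<dots> \<le> (\<Sum>\<nu>\<in>\<Lambda>. \<Sum>\<mu>\<in>\<Lambda>. 1 / \<bar>\<nu> - \<mu>\<bar>)"
        by (rule member_le_sum[of \<nu> \<Lambda> "\<lambda>\<nu>. \<Sum>\<mu>\<in>\<Lambda>. 1 / \<bar>\<nu> - \<mu>\<bar>"]) (use that \<Lambda> in \<open>auto intro: sum_nonneg\<close>)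
      finally show "1 / \<bar>\<nu> - \<mu>\<bar> \<le> (\<Sum>\<nu>\<in>\<Lambda>. \<Sum>\<mu>\<in>\<Lambda>. 1 / \<bar>\<nu> - \<mu>\<bar>)" .
    qed (use c0 in \<open>auto intro!: sum_nonneg\<close>)
    finally show ?thesis .
  qed
  define G where "G = real (card \<Lambda>) * real (Suc d)"
  have G: "G \<ge> 0" by (simp add: G_def)
  show ?thesis
  proof (rule exI[of _ "2 * C0"], intro conjI, use C0 in simp,
      rule exI[of _ "2 * C0 * \<kappa> * G + 1"], intro conjI allI impI)
    show "0 < 2 * C0 * \<kappa> * G + 1" using C0 \<kappa> G by (intro add_nonneg_pos) auto
    fix \<xi> and b :: "real \<Rightarrow> nat \<Rightarrow> complex"
    assume \<xi>: "2 * C0 * \<kappa> * G + 1 \<le> \<bar>\<xi>\<bar>"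
    then have \<xi>0: "\<xi> \<noteq> 0" using \<open>0 < 2 * C0 * \<kappa> * G + 1\<close> by auto
    define P where "P \<nu> s = (\<Sum>j\<le>d. s ^ j *\<^sub>R b \<nu> j)" for \<nu> s
    define f where "f \<nu> s = cis (\<xi> * \<nu> * s) * P \<nu> s" for \<nu> s
    define \<beta> where "\<beta> \<nu> = (\<Sum>j\<le>d. norm (b \<nu> j))" for \<nu>
    define S where "S = (\<Sum>\<nu>\<in>\<Lambda>. \<Sum>j\<le>d. (norm (b \<nu> j))\<^sup>2)"
    define I where "I = integral {0..T} (\<lambda>s. (norm (\<Sum>\<nu>\<in>\<Lambda>. f \<nu> s))\<^sup>2)"
    have contP[continuous_intros]: "continuous_on X (P \<nu>)" for X \<nu>
      unfolding P_def by (intro continuous_intros)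
    have contf[continuous_intros]: "continuous_on X (f \<nu>)" for X \<nu>
      unfolding f_def by (intro continuous_intros)
    have \<beta>: "\<beta> \<nu> \<ge> 0" for \<nu> unfolding \<beta>_def by (intro sum_nonneg) auto
    have S: "S \<ge> 0" unfolding S_def by (intro sum_nonneg) auto
    have expand: "(norm (\<Sum>\<nu>\<in>\<Lambda>. f \<nu> s))\<^sup>2 = (\<Sum>\<nu>\<in>\<Lambda>. (norm (P \<nu> s))\<^sup>2)
        + (\<Sum>\<nu>\<in>\<Lambda>. \<Sum>\<mu>\<in>\<Lambda> - {\<nu>}. Re (f \<nu> s * cnj (f \<mu> s)))" for s
    proof -
      have sq: "(norm z)\<^sup>2 = Re (z * cnj z)" for z
        by (simp flip: complex_norm_square)
      have "(norm (\<Sum>\<nu>\<in>\<Lambda>. f \<nu> s))\<^sup>2 = (\<Sum>\<nu>\<in>\<Lambda>. \<Sum>\<mu>\<in>\<Lambda>. Re (f \<nu> s * cnj (f \<mu> s)))"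
        unfolding sq cnj_sum sum_product Re_sum ..
      also have "\<dots> = (\<Sum>\<nu>\<in>\<Lambda>. (norm (P \<nu> s))\<^sup>2 + (\<Sum>\<mu>\<in>\<Lambda> - {\<nu>}. Re (f \<nu> s * cnj (f \<mu> s))))"
      proof (intro sum.cong refl)
        fix \<nu> assume "\<nu> \<in> \<Lambda>"
        moreover have "Re (f \<nu> s * cnj (f \<nu> s)) = (norm (P \<nu> s))\<^sup>2"
          unfolding sq[symmetric] by (simp add: f_def norm_mult)
        ultimately show "(\<Sum>\<mu>\<in>\<Lambda>. Re (f \<nu> s * cnj (f \<mu> s))) =
            (norm (P \<nu> s))\<^sup>2 + (\<Sum>\<mu>\<in>\<Lambda> - {\<nu>}. Re (f \<nu> s * cnj (f \<mu> s)))"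
          using sum.remove[OF \<Lambda>, of \<nu> "\<lambda>\<mu>. Re (f \<nu> s * cnj (f \<mu> s))"] by simp
      qed
      finally show ?thesis by (simp add: sum.distrib)
    qed
    have cross: "- (\<kappa> / \<bar>\<xi>\<bar> * (\<beta> \<nu> * \<beta> \<mu>)) \<le> integral {0..T} (\<lambda>s. Re (f \<nu> s * cnj (f \<mu> s)))"
      if "\<nu> \<in> \<Lambda>" "\<mu> \<in> \<Lambda> - {\<nu>}" for \<nu> \<mu>
    proof -
      define h where "h s = f \<nu> s * cnj (f \<mu> s)" for s
      have h: "h s = (\<Sum>j\<le>d. \<Sum>l\<le>d. (b \<nu> j * cnj (b \<mu> l)) *
          (of_real (s ^ (j + l)) * cis (\<xi> * (\<nu> - \<mu>) * s)))" for s
      proof -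
        have "h s = cis (\<xi> * (\<nu> - \<mu>) * s) * (P \<nu> s * cnj (P \<mu> s))"
        proof -
          have "cis (\<xi> * \<nu> * s) * cnj (cis (\<xi> * \<mu> * s)) = cis (\<xi> * (\<nu> - \<mu>) * s)"
            by (simp add: cis_cnj cis_mult algebra_simps)
          then show ?thesis unfolding h_def f_def by (metis complex_cnj_mult mult.assoc mult.left_commute)
        qed
        also have "P \<nu> s * cnj (P \<mu> s) = (\<Sum>j\<le>d. \<Sum>l\<le>d. (s ^ j *\<^sub>R b \<nu> j) * cnj (s ^ l *\<^sub>R b \<mu> l))"
          unfolding P_def cnj_sum sum_product ..
        finally show ?thesis unfolding sum_distrib_left
          by (auto intro!: sum.cong simp: scaleR_conv_of_real power_add)
      qed
      have conth: "continuous_on {0..T} h" unfolding h_def by (intro continuous_intros)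
      have "norm (integral {0..T} h) = norm (\<Sum>j\<le>d. \<Sum>l\<le>d. (b \<nu> j * cnj (b \<mu> l)) *
          integral {0..T} (\<lambda>s. of_real (s ^ (j + l)) * cis (\<xi> * (\<nu> - \<mu>) * s)))"
        unfolding h
        by (simp add: Henstock_Kurzweil_Integration.integral_sum integrable_continuous_real continuous_intros)
      also have "\<dots> \<le> (\<Sum>j\<le>d. \<Sum>l\<le>d. norm (b \<nu> j) * norm (b \<mu> l) * (\<kappa> / \<bar>\<xi>\<bar>))"
      proof (intro sum_norm_le)
        fix j l assume jl: "j \<in> {..d}" "l \<in> {..d}"
        show "norm ((b \<nu> j * cnj (b \<mu> l)) *
            integral {0..T} (\<lambda>s. of_real (s ^ (j + l)) * cis (\<xi> * (\<nu> - \<mu>) * s)))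
          \<le> norm (b \<nu> j) * norm (b \<mu> l) * (\<kappa> / \<bar>\<xi>\<bar>)"
          unfolding norm_mult complex_mod_cnj using that jl \<xi>0 by (intro mult_left_mono osc) auto
      qed
      also have "\<dots> = \<kappa> / \<bar>\<xi>\<bar> * (\<beta> \<nu> * \<beta> \<mu>)"
        unfolding \<beta>_def sum_product by (simp add: sum_distrib_left mult_ac)
      finally have "\<bar>Re (integral {0..T} h)\<bar> \<le> \<kappa> / \<bar>\<xi>\<bar> * (\<beta> \<nu> * \<beta> \<mu>)"
        using abs_Re_le_cmod order_trans by blast
      moreover have "integral {0..T} (\<lambda>s. Re (h s)) = Re (integral {0..T} h)"
        using integral_linear[OF integrable_continuous_real[OF conth] bounded_linear_Re] by (simp add: o_def)
      ultimately show ?thesis unfolding h_def by simp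
    qed
    have "S \<le> (\<Sum>\<nu>\<in>\<Lambda>. C0 * integral {0..T} (\<lambda>s. (norm (P \<nu> s))\<^sup>2))"
      unfolding S_def P_def by (intro sum_mono poly)
    also have "\<dots> = C0 * (\<Sum>\<nu>\<in>\<Lambda>. integral {0..T} (\<lambda>s. (norm (P \<nu> s))\<^sup>2))"
      by (simp add: sum_distrib_left)
    also have "\<dots> \<le> C0 * (I + \<kappa> / \<bar>\<xi>\<bar> * (G * S))"
    proof (rule mult_left_mono)
      have "I = (\<Sum>\<nu>\<in>\<Lambda>. integral {0..T} (\<lambda>s. (norm (P \<nu> s))\<^sup>2))
          + (\<Sum>\<nu>\<in>\<Lambda>. \<Sum>\<mu>\<in>\<Lambda> - {\<nu>}. integral {0..T} (\<lambda>s. Re (f \<nu> s * cnj (f \<mu> s))))"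
        unfolding I_def expand using \<Lambda>
        by (simp add: Henstock_Kurzweil_Integration.integral_sum Henstock_Kurzweil_Integration.integral_add
            integrable_continuous_real continuous_intros)
      moreover have "- (\<kappa> / \<bar>\<xi>\<bar> * (G * S)) \<le>
          (\<Sum>\<nu>\<in>\<Lambda>. \<Sum>\<mu>\<in>\<Lambda> - {\<nu>}. integral {0..T} (\<lambda>s. Re (f \<nu> s * cnj (f \<mu> s))))"
      proof -
        have "(\<Sum>\<nu>\<in>\<Lambda>. \<beta> \<nu>)\<^sup>2 \<le> real (card \<Lambda>) * (\<Sum>\<nu>\<in>\<Lambda>. (\<beta> \<nu>)\<^sup>2)"
          using norm_sum_sq_le[of \<beta> \<Lambda>] by simp
        also have "(\<Sum>\<nu>\<in>\<Lambda>. (\<beta> \<nu>)\<^sup>2) \<le> (\<Sum>\<nu>\<in>\<Lambda>. real (Suc d) * (\<Sum>j\<le>d. (norm (b \<nu> j))\<^sup>2))"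
          unfolding \<beta>_def using norm_sum_sq_le[of "\<lambda>j. norm (b _ j)" "{..d}"]
          by (intro sum_mono) simp
        finally have "(\<Sum>\<nu>\<in>\<Lambda>. \<beta> \<nu>)\<^sup>2 \<le> G * S"
          unfolding G_def S_def sum_distrib_left[symmetric] by (simp add: mult_left_mono mult.assoc)
        then have "- (\<kappa> / \<bar>\<xi>\<bar> * (G * S)) \<le> - (\<kappa> / \<bar>\<xi>\<bar> * (\<Sum>\<nu>\<in>\<Lambda>. \<beta> \<nu>)\<^sup>2)"
          using \<kappa> by (intro le_imp_neg_le mult_left_mono) auto
        also have "\<dots> = (\<Sum>\<nu>\<in>\<Lambda>. \<Sum>\<mu>\<in>\<Lambda>. - (\<kappa> / \<bar>\<xi>\<bar> * (\<beta> \<nu> * \<beta> \<mu>)))"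
          unfolding power2_eq_square sum_product by (simp add: sum_distrib_left sum_negf)
        also have "\<dots> \<le> (\<Sum>\<nu>\<in>\<Lambda>. \<Sum>\<mu>\<in>\<Lambda> - {\<nu>}. - (\<kappa> / \<bar>\<xi>\<bar> * (\<beta> \<nu> * \<beta> \<mu>)))"
          unfolding sum_negf using \<kappa> \<beta> \<Lambda>
          by (intro le_imp_neg_le sum_mono sum_mono2) auto
        also have "\<dots> \<le> (\<Sum>\<nu>\<in>\<Lambda>. \<Sum>\<mu>\<in>\<Lambda> - {\<nu>}. integral {0..T} (\<lambda>s. Re (f \<nu> s * cnj (f \<mu> s))))"
          by (intro sum_mono cross)
        finally show ?thesis .
      qed
      ultimately show "(\<Sum>\<nu>\<in>\<Lambda>. integral {0..T} (\<lambda>s. (norm (P \<nu> s))\<^sup>2)) \<le> I + \<kappa> / \<bar>\<xi>\<bar> * (G * S)"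
        by linarith
    qed (use C0 in simp)
    also have "\<dots> = C0 * I + C0 * \<kappa> * G / \<bar>\<xi>\<bar> * S" by (simp add: algebra_simps)
    \<comment> \<open>The lower bound on \<open>\<bar>\<xi>\<bar>\<close> is chosen so that the cross terms take at most half of \<open>S\<close>.\<close>
    also have "C0 * \<kappa> * G / \<bar>\<xi>\<bar> * S \<le> 1 / 2 * S"
      using \<xi> \<xi>0 S by (intro mult_right_mono) (auto simp: pos_divide_le_eq)
    finally show "(\<Sum>\<nu>\<in>\<Lambda>. \<Sum>j\<le>d. (norm (b \<nu> j))\<^sup>2) \<le> 2 * C0 * integral {0..T}
        (\<lambda>s. (norm (\<Sum>\<nu>\<in>\<Lambda>. cis (\<xi> * \<nu> * s) * (\<Sum>j\<le>d. s ^ j *\<^sub>R b \<nu> j)))\<^sup>2)"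
      unfolding S_def[symmetric] I_def f_def P_def by simp
  qed
qed

section \<open>The Plancherel inequality\<close>

lemma nn_integral_exp_neg_square:
  assumes "c > 0"
  shows "(\<integral>\<^sup>+u. ennreal (exp (- ((c * (x - u))\<^sup>2) / 2)) \<partial>lborel) = ennreal (sqrt (2 * pi) / c)"
proof -
  have "(\<integral>\<^sup>+u. ennreal (exp (- ((c * (x - u))\<^sup>2) / 2)) \<partial>lborel)
      = (\<integral>\<^sup>+u. ennreal (sqrt (2 * pi) / c) * ennreal (normal_density x (1 / c) u) \<partial>lborel)"
    using assms by (intro nn_integral_cong, subst ennreal_mult[symmetric])
      (auto simp: normal_density_def real_sqrt_mult real_sqrt_divide power_divide power_mult_distrib mult_ac power2_commute)
  also have "\<dots> = ennreal (sqrt (2 * pi) / c) * (\<integral>\<^sup>+u. ennreal (normal_density x (1 / c) u) \<partial>lborel)"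
    by (rule nn_integral_cmult) simp
  also have "(\<integral>\<^sup>+u. ennreal (normal_density x (1 / c) u) \<partial>lborel) = 1"
    using prob_space.emeasure_space_1[OF prob_space_normal_density[of "1 / c" x]] assms
    by (simp add: emeasure_density)
  finally show ?thesis by simp
qed

text \<open>For a non-integrable \<open>f\<close> the left-hand side is \<open>0\<close> by convention.\<close>

lemma norm_integral_le_nn_integral:
  fixes f :: "'a \<Rightarrow> 'b::{banach, second_countable_topology}"
  shows "ennreal (norm (\<integral>x. f x \<partial>M)) \<le> (\<integral>\<^sup>+x. ennreal (norm (f x)) \<partial>M)"
  by (cases "integrable M f") (auto simp: integral_norm_bound_ennreal not_integrable_integral_eq)

text \<open>Averaging \<open>\<bar>H\<bar>\<^sup>2\<close> against a Gaussian and exchanging the integrals turns the phases into the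
characteristic function of the normal distribution, i.e. into the kernel \<open>exp (- (c (x - y))\<^sup>2 / 2)\<close>
integrated against \<open>\<phi> x\<close> and the conjugate of \<open>\<phi> y\<close>.  Schur's test, that is
\<open>2 \<bar>\<phi> x\<bar> \<bar>\<phi> y\<bar> \<le> \<bar>\<phi> x\<bar>\<^sup>2 + \<bar>\<phi> y\<bar>\<^sup>2\<close>, bounds the result by the mass of the kernel times \<open>\<integral>\<bar>\<phi>\<bar>\<^sup>2\<close>.\<close>

lemma gaussian_fourier_energy_le:
  fixes \<phi> :: "real \<Rightarrow> complex"
  assumes int: "integrable lborel \<phi>" and c: "c > 0"
  defines "H \<equiv> \<lambda>\<zeta>. \<integral>x. exp (- \<i> * complex_of_real (x * (c * \<zeta>))) * \<phi> x \<partial>lborel"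
  shows "(\<integral>\<^sup>+\<zeta>. ennreal ((norm (H \<zeta>))\<^sup>2) \<partial>std_normal_distribution)
    \<le> ennreal (sqrt (2 * pi) / c) * (\<integral>\<^sup>+x. ennreal ((norm (\<phi> x))\<^sup>2) \<partial>lborel)"
proof -
  define N where "N = std_normal_distribution"
  interpret N: real_distribution N unfolding N_def by (rule real_dist_normal_dist)
  have [measurable_cong]: "sets N = sets borel" by (rule N.events_eq_borel)
  have [measurable]: "cnj \<in> borel_measurable borel"
    by (intro borel_measurable_continuous_onI continuous_intros)
  interpret P: pair_sigma_finite N lborel ..
  have [measurable]: "\<phi> \<in> borel_measurable borel"
    using borel_measurable_integrable[OF int] by simp
  define e where "e \<zeta> x = exp (- \<i> * complex_of_real (x * (c * \<zeta>)))" for \<zeta> x :: real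
  have norm_e: "norm (e \<zeta> x) = 1" for \<zeta> x
    unfolding e_def by simp
  have [measurable]: "(\<lambda>(\<zeta>, x). e \<zeta> x) \<in> borel_measurable (borel \<Otimes>\<^sub>M borel)"
    unfolding e_def by measurable
  have [measurable]: "H \<in> borel_measurable borel" unfolding H_def by measurable
  define I where "I = (\<integral>x. norm (\<phi> x) \<partial>lborel)"
  have H_le: "norm (H \<zeta>) \<le> I" for \<zeta>
    unfolding H_def I_def
    by (rule order_trans[OF integral_norm_bound]) (simp add: norm_mult)
  have int_e: "integrable lborel (\<lambda>x. e \<zeta> x * \<phi> x)" for \<zeta>
    by (rule Bochner_Integration.integrable_bound[OF int]) (auto simp: norm_mult norm_e)
  have gauss: "(\<integral>\<zeta>. e \<zeta> x * cnj (e \<zeta> y) \<partial>N) = of_real (exp (- ((c * (x - y))\<^sup>2) / 2))" for x y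
  proof -
    have "(\<integral>\<zeta>. e \<zeta> x * cnj (e \<zeta> y) \<partial>N) = char N (c * (y - x))"
      unfolding char_def e_def
      by (intro Bochner_Integration.integral_cong)
        (auto simp: exp_cnj exp_add[symmetric] algebra_simps )
    then show ?thesis unfolding N_def char_std_normal_distribution
      by (simp add: power2_commute power_mult_distrib)
  qed
  define g where "g x y = exp (- ((c * (x - y))\<^sup>2) / 2)" for x y :: real
  have g_sym: "g x y = g y x" for x y by (simp add: g_def power2_commute power_mult_distrib)
  have [measurable]: "(\<lambda>(x, y). g x y) \<in> borel_measurable (borel \<Otimes>\<^sub>M borel)"
    unfolding g_def by measurable
  have prod_int: "integrable (N \<Otimes>\<^sub>M lborel) (\<lambda>(\<zeta>, x). h \<zeta> x * \<psi> x)"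
    if [measurable]: "(\<lambda>(\<zeta>, x). h \<zeta> x) \<in> borel_measurable (N \<Otimes>\<^sub>M lborel)" and "integrable lborel \<psi>"
      and h: "\<And>\<zeta> x. norm (h \<zeta> x) \<le> b" for h :: "real \<Rightarrow> real \<Rightarrow> complex" and \<psi> :: "real \<Rightarrow> complex" and b
  proof -
    have [measurable]: "\<psi> \<in> borel_measurable lborel" using that by auto
    have b0: "b \<ge> 0" using h[of 0 0] norm_ge_zero order_trans by blast
    have 1: "integrable (N \<Otimes>\<^sub>M lborel) (\<lambda>(\<zeta>, x). \<psi> x)"
      by (rule P.Fubini_integrable) (use that in auto)
    then have "integrable (N \<Otimes>\<^sub>M lborel) (\<lambda>p. b * norm (case_prod (\<lambda>\<zeta> x. \<psi> x) p))"
      by (intro integrable_mult_right integrable_norm)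
    then show ?thesis
    proof (rule Bochner_Integration.integrable_bound)
      show "AE p in N \<Otimes>\<^sub>M lborel. norm (case p of (\<zeta>, x) \<Rightarrow> h \<zeta> x * \<psi> x)
          \<le> norm (b * norm (case p of (\<zeta>, x) \<Rightarrow> \<psi> x))"
        using b0 by (intro AE_I2) (auto simp: norm_mult split_beta intro!: mult_right_mono h)
    qed measurable
  qed
  have cnj_H: "cnj (H \<zeta>) = (\<integral>y. cnj (e \<zeta> y) * cnj (\<phi> y) \<partial>lborel)" for \<zeta>
    unfolding H_def e_def[symmetric] by (subst Bochner_Integration.integral_cnj[symmetric]) (simp only: complex_cnj_mult)
  have inner: "(\<integral>\<zeta>. e \<zeta> x * cnj (H \<zeta>) \<partial>N) = (\<integral>y. cnj (\<phi> y) * of_real (g x y) \<partial>lborel)" for x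
  proof -
    have "(\<integral>\<zeta>. e \<zeta> x * cnj (H \<zeta>) \<partial>N) = (\<integral>\<zeta>. (\<integral>y. (e \<zeta> x * cnj (e \<zeta> y)) * cnj (\<phi> y) \<partial>lborel) \<partial>N)"
      unfolding cnj_H by (simp add: mult.assoc)
    also have "\<dots> = (\<integral>y. (\<integral>\<zeta>. (e \<zeta> x * cnj (e \<zeta> y)) * cnj (\<phi> y) \<partial>N) \<partial>lborel)"
    proof (rule P.Fubini_integral[symmetric], rule prod_int)
      show "norm (e \<zeta> x * cnj (e \<zeta> y)) \<le> 1" for \<zeta> y by (simp add: norm_mult norm_e)
    qed (use int in \<open>simp_all, measurable\<close>)
    also have "\<dots> = (\<integral>y. cnj (\<phi> y) * of_real (g x y) \<partial>lborel)"
      by (simp add: gauss g_def mult.commute)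
    finally show ?thesis .
  qed
  have "complex_of_real (\<integral>\<zeta>. (norm (H \<zeta>))\<^sup>2 \<partial>N) = (\<integral>\<zeta>. H \<zeta> * cnj (H \<zeta>) \<partial>N)"
    unfolding integral_complex_of_real[symmetric] complex_norm_square ..
  also have "\<dots> = (\<integral>\<zeta>. (\<integral>x. (e \<zeta> x * cnj (H \<zeta>)) * \<phi> x \<partial>lborel) \<partial>N)"
  proof (rule Bochner_Integration.integral_cong[OF refl])
    fix \<zeta>
    have "H \<zeta> * cnj (H \<zeta>) = (\<integral>x. cnj (H \<zeta>) * (e \<zeta> x * \<phi> x) \<partial>lborel)"
      unfolding integral_mult_right_zero by (simp add: H_def e_def mult.commute)
    then show "H \<zeta> * cnj (H \<zeta>) = (\<integral>x. (e \<zeta> x * cnj (H \<zeta>)) * \<phi> x \<partial>lborel)"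
      by (simp add: mult_ac)
  qed
  also have "\<dots> = (\<integral>x. (\<integral>\<zeta>. (e \<zeta> x * cnj (H \<zeta>)) * \<phi> x \<partial>N) \<partial>lborel)"
  proof (rule P.Fubini_integral[symmetric], rule prod_int)
    show "norm (e \<zeta> x * cnj (H \<zeta>)) \<le> I" for \<zeta> x by (simp add: norm_mult norm_e H_le)
  qed (use int in \<open>simp_all, measurable\<close>)
  also have "\<dots> = (\<integral>x. (\<integral>y. cnj (\<phi> y) * of_real (g x y) \<partial>lborel) * \<phi> x \<partial>lborel)"
    by (simp add: inner)
  finally have eq: "complex_of_real (\<integral>\<zeta>. (norm (H \<zeta>))\<^sup>2 \<partial>N)
      = (\<integral>x. (\<integral>y. cnj (\<phi> y) * of_real (g x y) \<partial>lborel) * \<phi> x \<partial>lborel)" .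
  have intH: "integrable N (\<lambda>\<zeta>. (norm (H \<zeta>))\<^sup>2)"
    by (rule N.integrable_const_bound[of _ "I\<^sup>2"]) (auto simp: H_le power_mono)
  have g_nn: "(\<integral>\<^sup>+y. ennreal (g x y) \<partial>lborel) = ennreal (sqrt (2 * pi) / c)" for x
    unfolding g_def by (rule nn_integral_exp_neg_square[OF c])
  define S where "S = (\<integral>\<^sup>+x. ennreal ((norm (\<phi> x))\<^sup>2) \<partial>lborel)"
  have half: "(\<integral>\<^sup>+x. (\<integral>\<^sup>+y. ennreal ((norm (\<phi> x))\<^sup>2) * ennreal (g x y) \<partial>lborel) \<partial>lborel) = S * ennreal (sqrt (2 * pi) / c)"
    by (simp add: nn_integral_cmult nn_integral_multc g_nn S_def)
  have half': "(\<integral>\<^sup>+x. (\<integral>\<^sup>+y. ennreal ((norm (\<phi> y))\<^sup>2) * ennreal (g x y) \<partial>lborel) \<partial>lborel) = S * ennreal (sqrt (2 * pi) / c)"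
    unfolding half[symmetric]
    by (subst lborel_pair.Fubini'[symmetric], simp, intro nn_integral_cong, subst g_sym, rule refl)
  have "(\<integral>\<^sup>+\<zeta>. ennreal ((norm (H \<zeta>))\<^sup>2) \<partial>N) = ennreal (\<integral>\<zeta>. (norm (H \<zeta>))\<^sup>2 \<partial>N)"
    by (rule nn_integral_eq_integral[OF intH]) auto
  also have "\<dots> = ennreal (norm (complex_of_real (\<integral>\<zeta>. (norm (H \<zeta>))\<^sup>2 \<partial>N)))"
    by simp
  also have "\<dots>
      \<le> (\<integral>\<^sup>+x. ennreal (norm ((\<integral>y. cnj (\<phi> y) * of_real (g x y) \<partial>lborel) * \<phi> x)) \<partial>lborel)"
    unfolding eq by (rule norm_integral_le_nn_integral)
  also have "\<dots> \<le> (\<integral>\<^sup>+x. (\<integral>\<^sup>+y. ennreal (norm (\<phi> x) * norm (\<phi> y) * g x y) \<partial>lborel) \<partial>lborel)"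
  proof (intro nn_integral_mono)
    fix x
    have "ennreal (norm ((\<integral>y. cnj (\<phi> y) * of_real (g x y) \<partial>lborel) * \<phi> x))
        = ennreal (norm (\<phi> x)) * ennreal (norm (\<integral>y. cnj (\<phi> y) * of_real (g x y) \<partial>lborel))"
      by (simp add: norm_mult ennreal_mult[symmetric] mult.commute)
    also have "\<dots> \<le> ennreal (norm (\<phi> x)) * (\<integral>\<^sup>+y. ennreal (norm (cnj (\<phi> y) * of_real (g x y))) \<partial>lborel)"
      by (intro mult_left_mono norm_integral_le_nn_integral) simp
    also have "\<dots> = (\<integral>\<^sup>+y. ennreal (norm (\<phi> x) * norm (\<phi> y) * g x y) \<partial>lborel)"
      by (subst nn_integral_cmult[symmetric])
        (auto simp: norm_mult ennreal_mult[symmetric] mult.assoc g_def)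
    finally show "ennreal (norm ((\<integral>y. cnj (\<phi> y) * of_real (g x y) \<partial>lborel) * \<phi> x)) \<le> \<dots>" .
  qed
  also have "\<dots> \<le> (\<integral>\<^sup>+x. (\<integral>\<^sup>+y. ennreal (1 / 2) * (ennreal ((norm (\<phi> x))\<^sup>2) * ennreal (g x y) + ennreal ((norm (\<phi> y))\<^sup>2) * ennreal (g x y)) \<partial>lborel) \<partial>lborel)"
  proof (intro nn_integral_mono)
    fix x y
    have "norm (\<phi> x) * norm (\<phi> y) * g x y \<le> (1 / 2 * ((norm (\<phi> x))\<^sup>2 + (norm (\<phi> y))\<^sup>2)) * g x y"
      using sum_squares_bound[of "norm (\<phi> x)" "norm (\<phi> y)"]
      by (intro mult_right_mono) (auto simp: g_def)
    then have "ennreal (norm (\<phi> x) * norm (\<phi> y) * g x y)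
      \<le> ennreal ((1 / 2 * ((norm (\<phi> x))\<^sup>2 + (norm (\<phi> y))\<^sup>2)) * g x y)" by (rule ennreal_leI)
    also have "\<dots> = ennreal (1 / 2) * (ennreal ((norm (\<phi> x))\<^sup>2) * ennreal (g x y) + ennreal ((norm (\<phi> y))\<^sup>2) * ennreal (g x y))"
      unfolding g_def
      by (subst ennreal_mult, simp, simp, subst ennreal_mult, simp, simp, subst ennreal_plus, simp, simp)
        (simp only: mult.assoc distrib_right)
    finally show "ennreal (norm (\<phi> x) * norm (\<phi> y) * g x y) \<le> \<dots>" .
  qed
  also have "\<dots> = ennreal (1 / 2) * (S * ennreal (sqrt (2 * pi) / c) + S * ennreal (sqrt (2 * pi) / c))"
    by (simp add: nn_integral_cmult nn_integral_add nn_integral_multc g_nn half' S_def[symmetric])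
  also have "\<dots> = ennreal (sqrt (2 * pi) / c) * S"
  proof -
    have "ennreal (1 / 2) * 2 = 1"
      using ennreal_mult[of "1 / 2" 2] by simp
    then show ?thesis
      unfolding mult_2[symmetric] mult.assoc[symmetric] by (simp add: mult.commute)
  qed
  finally show ?thesis unfolding N_def S_def .
qed


text \<open>Weighting \<open>\<bar>F\<bar>\<^sup>2\<close> by ever wider Gaussians gives the bound \<open>2\<pi> \<integral>\<bar>\<phi>\<bar>\<^sup>2\<close> for each width, by rescaling the
previous lemma; Fatou's lemma then removes the weight.\<close>

lemma plancherel_le:
  fixes \<phi> :: "real \<Rightarrow> complex"
  assumes int: "integrable lborel \<phi>"
  shows "(\<integral>\<^sup>+\<xi>. ennreal ((norm (\<integral>x. exp (- \<i> * complex_of_real (x * \<xi>)) * \<phi> x \<partial>lborel))\<^sup>2) \<partial>lborel)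
    \<le> ennreal (2 * pi) * (\<integral>\<^sup>+x. ennreal ((norm (\<phi> x))\<^sup>2) \<partial>lborel)"
proof -
  define F where "F \<xi> = (\<integral>x. exp (- \<i> * complex_of_real (x * \<xi>)) * \<phi> x \<partial>lborel)" for \<xi>
  define S where "S = (\<integral>\<^sup>+x. ennreal ((norm (\<phi> x))\<^sup>2) \<partial>lborel)"
  have [measurable]: "\<phi> \<in> borel_measurable borel"
    using borel_measurable_integrable[OF int] by simp
  have [measurable]: "F \<in> borel_measurable borel" unfolding F_def by measurable
  define w where "w n \<xi> = exp (- (\<xi> / real (Suc n))\<^sup>2 / 2)" for n \<xi>
  have le: "(\<integral>\<^sup>+\<xi>. ennreal ((norm (F \<xi>))\<^sup>2 * w n \<xi>) \<partial>lborel) \<le> ennreal (2 * pi) * S" for n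
  proof -
    let ?c = "real (Suc n)"
    have "(\<integral>\<^sup>+\<xi>. ennreal ((norm (F \<xi>))\<^sup>2 * w n \<xi>) \<partial>lborel)
        = ennreal ?c * (\<integral>\<^sup>+\<zeta>. ennreal ((norm (F (?c * \<zeta>)))\<^sup>2 * w n (?c * \<zeta>)) \<partial>lborel)"
      unfolding w_def by (subst nn_integral_real_affine[of _ ?c 0]) auto
    also have "(\<integral>\<^sup>+\<zeta>. ennreal ((norm (F (?c * \<zeta>)))\<^sup>2 * w n (?c * \<zeta>)) \<partial>lborel)
        = (\<integral>\<^sup>+\<zeta>. ennreal (sqrt (2 * pi)) * (ennreal (std_normal_density \<zeta>) * ennreal ((norm (F (?c * \<zeta>)))\<^sup>2)) \<partial>lborel)"
    proof (intro nn_integral_cong)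
      fix \<zeta>
      have eq: "(norm (F (?c * \<zeta>)))\<^sup>2 * w n (?c * \<zeta>)
          = sqrt (2 * pi) * (std_normal_density \<zeta> * (norm (F (?c * \<zeta>)))\<^sup>2)"
        unfolding w_def std_normal_density_def by (simp del: of_nat_Suc)
      show "ennreal ((norm (F (?c * \<zeta>)))\<^sup>2 * w n (?c * \<zeta>))
          = ennreal (sqrt (2 * pi)) * (ennreal (std_normal_density \<zeta>) * ennreal ((norm (F (?c * \<zeta>)))\<^sup>2))"
        unfolding eq by (simp add: ennreal_mult normal_density_nonneg del: of_nat_Suc)
    qed
    also have "\<dots> = ennreal (sqrt (2 * pi)) * (\<integral>\<^sup>+\<zeta>. ennreal ((norm (F (?c * \<zeta>)))\<^sup>2) \<partial>std_normal_distribution)"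
      by (subst nn_integral_density) (auto intro!: nn_integral_cmult simp del: of_nat_Suc)
    also have "\<dots> \<le> ennreal (sqrt (2 * pi)) * (ennreal (sqrt (2 * pi) / ?c) * S)"
      unfolding F_def S_def by (intro mult_left_mono gaussian_fourier_energy_le int) auto
    also have "ennreal ?c * \<dots> = ennreal (?c * (sqrt (2 * pi) * (sqrt (2 * pi) / ?c))) * S"
      by (simp add: ennreal_mult mult.assoc del: of_nat_Suc times_divide_eq_right)
    also have "?c * (sqrt (2 * pi) * (sqrt (2 * pi) / ?c)) = 2 * pi" by simp
    finally show ?thesis by (simp add: mult_left_mono)
  qed
  have "(\<integral>\<^sup>+\<xi>. ennreal ((norm (F \<xi>))\<^sup>2) \<partial>lborel)
      = (\<integral>\<^sup>+\<xi>. liminf (\<lambda>n. ennreal ((norm (F \<xi>))\<^sup>2 * w n \<xi>)) \<partial>lborel)"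
  proof (intro nn_integral_cong)
    fix \<xi>
    have "(\<lambda>n. \<xi> / real (Suc n)) \<longlonglongrightarrow> 0"
      using tendsto_mult[OF tendsto_const[of \<xi>] LIMSEQ_inverse_real_of_nat] by (simp add: field_simps)
    then have "(\<lambda>n. w n \<xi>) \<longlonglongrightarrow> exp (- (0\<^sup>2) / 2)"
      unfolding w_def by (intro tendsto_intros) auto
    then have "(\<lambda>n. ennreal ((norm (F \<xi>))\<^sup>2 * w n \<xi>)) \<longlonglongrightarrow> ennreal ((norm (F \<xi>))\<^sup>2 * 1)"
      by (intro tendsto_ennrealI tendsto_mult tendsto_const) simp
    then show "ennreal ((norm (F \<xi>))\<^sup>2) = liminf (\<lambda>n. ennreal ((norm (F \<xi>))\<^sup>2 * w n \<xi>))"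
      by (simp add: lim_imp_Liminf)
  qed
  also have "\<dots> \<le> liminf (\<lambda>n. \<integral>\<^sup>+\<xi>. ennreal ((norm (F \<xi>))\<^sup>2 * w n \<xi>) \<partial>lborel)"
    by (intro nn_integral_liminf) (simp add: w_def)
  also have "\<dots> \<le> ennreal (2 * pi) * S"
    using le by (intro Liminf_le) (auto simp: eventually_sequentially)
  finally show ?thesis unfolding F_def S_def .
qed

section \<open>The propagator as a power series\<close>

lemma cmat_mult: "cmat (M ** N) = cmat M ** cmat N"
  by (simp add: cmat_def matrix_matrix_mult_def vec_eq_iff)

lemma cmat_mat_1: "cmat (mat 1) = mat 1"
  by (simp add: cmat_def mat_def vec_eq_iff)

lemma cmat_matpow: "cmat (matpow M k) = matpow (cmat M) k"
  by (induction k) (simp_all add: cmat_mult cmat_mat_1)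

lemma matpow_mult_commute: "matpow M k ** M = M ** matpow M k"
  by (induction k) (simp_all add: matrix_mul_assoc[symmetric])

lemma transpose_matpow: "transpose (matpow M k) = matpow (transpose M) k"
  by (induction k) (simp_all add: matrix_transpose_mul matpow_mult_commute)

lemma norm_vector_smult: "norm (c *s z) = norm c * norm z" for z :: "complex^'n"
  by (simp add: norm_vec_def L2_set_right_distrib norm_mult)

lemma scaleR_vec_eq: "r *\<^sub>R z = complex_of_real r *s z" for z :: "complex^'n"
  by (simp add: vec_eq_iff scaleR_conv_of_real[where 'a = complex])

lemma linear_cmatrix_mult: "linear ((*v) M)" for M :: "complex^'n^'m"
  by (rule linearI) (simp_all add: matrix_vector_right_distrib scaleR_vec_eq vector_scalar_commute)

lemma matpow_growth:
  fixes M :: "complex^'n^'n"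
  shows "\<exists>r>0. \<forall>k z. norm (matpow M k *v z) \<le> r ^ k * norm z"
proof -
  obtain r where r: "r > 0" "\<And>z. norm (M *v z) \<le> r * norm z"
    using linear_bounded_pos[OF linear_cmatrix_mult[of M]] by blast
  have "norm (matpow M k *v z) \<le> r ^ k * norm z" for k z
  proof (induction k)
    case (Suc k)
    have "norm (matpow M (Suc k) *v z) \<le> r * norm (matpow M k *v z)"
      using r(2)[of "matpow M k *v z"] by (simp add: matrix_vector_mul_assoc)
    also have "\<dots> \<le> r * (r ^ k * norm z)" using r by (intro mult_left_mono Suc.IH) auto
    finally show ?case by simp
  qed simp
  with r show ?thesis by blast
qed

lemma matrix_component: "M $ i $ j = (M *v axis j 1) $ i" for M :: "complex^'n^'m"
  by (simp add: matrix_vector_mult_def axis_def if_distrib cong: if_cong)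

text \<open>Used to deduce summability of the exponential series in the space of matrices from bounds on
the vectors \<open>M\<^sup>k v\<close>.\<close>

lemma norm_le_sum_components: "norm M \<le> (\<Sum>i\<in>UNIV. \<Sum>j\<in>UNIV. norm (M $ i $ j))"
  for M :: "complex^'n^'m"
  unfolding norm_vec_def
  by (rule order_trans[OF L2_set_le_sum]) (auto intro!: sum_mono L2_set_le_sum)

lemma mexp_mult_vec_sums:
  fixes M :: "complex^'n^'n"
  shows "(\<lambda>k. (1 / fact k) *\<^sub>R (matpow M k *v z)) sums (mexp M *v z)"
proof -
  obtain r where r: "r > 0" "\<And>k z. norm (matpow M k *v z) \<le> r ^ k * norm z"
    using matpow_growth by blast
  have "norm ((1 / fact k) *\<^sub>R matpow M k) \<le> real (CARD('n) * CARD('n)) * (inverse (fact k) * r ^ k)" for k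
  proof -
    have "norm (matpow M k $ i $ j) \<le> r ^ k" for i j
    proof -
      have "norm (matpow M k $ i $ j) \<le> norm (matpow M k *v axis j 1)"
        unfolding matrix_component[of _ i j] by (rule Finite_Cartesian_Product.norm_nth_le)
      also have "\<dots> \<le> r ^ k" using r(2)[of k "axis j 1"] by (simp add: norm_axis_1)
      finally show ?thesis .
    qed
    then have "(\<Sum>i\<in>UNIV. \<Sum>j\<in>UNIV. norm (matpow M k $ i $ j)) \<le> (\<Sum>i\<in>(UNIV::'n set). \<Sum>j\<in>(UNIV::'n set). r ^ k)"
      by (intro sum_mono)
    then have "norm (matpow M k) \<le> real (CARD('n) * CARD('n)) * r ^ k"
      using norm_le_sum_components[of "matpow M k"] by (simp add: mult.assoc)
    then have "inverse (fact k) * norm (matpow M k) \<le> inverse (fact k) * (real (CARD('n) * CARD('n)) * r ^ k)"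
      by (intro mult_left_mono) auto
    then show ?thesis by (simp add: field_simps)
  qed
  then have "summable (\<lambda>k. (1 / fact k) *\<^sub>R matpow M k)"
    by (intro summable_comparison_test'[OF summable_mult[OF summable_exp[of r]]]) auto
  then have sums: "(\<lambda>k. (1 / fact k) *\<^sub>R matpow M k) sums mexp M"
    unfolding mexp_def by (rule summable_sums)
  have lin: "linear (\<lambda>M :: complex^'n^'n. M *v z)"
    by (rule linearI) (simp_all add: vec_eq_iff matrix_vector_mult_def scaleR_sum_right
        distrib_right sum.distrib)
  have "(\<lambda>k. ((1 / fact k) *\<^sub>R matpow M k) *v z) sums (mexp M *v z)"
    using bounded_linear.sums[OF linear_linear[THEN iffD2, OF lin] sums] .
  then show ?thesis by (simp add: linear_cmul[OF lin])
qed

lemma matpow_smult_mult_vec: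
  "matpow (mat c ** M) k *v z = c ^ k *s (matpow M k *v z)" for M :: "complex^'n^'n"
proof (induction k)
  case (Suc k)
  have mat: "mat c *v w = c *s w" for w :: "complex^'n"
    by (simp add: vec_eq_iff matrix_vector_mult_def mat_def if_distrib if_distribR cong: if_cong)
  show ?case
    by (simp add: matrix_vector_mul_assoc[symmetric] Suc.IH vector_scalar_commute mat vector_smult_assoc)
qed (simp add: vec_eq_iff)

lemma propagator_sums:
  "(\<lambda>k. (c ^ k / fact k) *s (matpow M k *v z)) sums (mexp (mat c ** M) *v z)"
  using mexp_mult_vec_sums[of "mat c ** M" z]
  by (simp add: matpow_smult_mult_vec scaleR_vec_eq vector_smult_assoc divide_inverse mult.commute)

text \<open>The factor \<open>\<bar>c\<bar>\<^sup>K\<^sup>+\<^sup>1\<close> can be taken out of the tail of the exponential series because \<open>\<bar>c\<bar> \<le> 1\<close>.\<close>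

lemma propagator_taylor:
  fixes M :: "complex^'n^'n"
  shows "\<exists>R>0. \<forall>c z. norm c \<le> 1 \<longrightarrow>
    norm (mexp (mat c ** M) *v z - (\<Sum>k\<le>K. (c ^ k / fact k) *s (matpow M k *v z)))
      \<le> R * norm c ^ Suc K * norm z"
proof -
  obtain r where r: "r > 0" "\<And>k z. norm (matpow M k *v z) \<le> r ^ k * norm z"
    using matpow_growth by blast
  define a where "a k = inverse (fact (k + Suc K)) * r ^ (k + Suc K)" for k
  have "summable (\<lambda>k. inverse (fact k) * r ^ k)" by (rule summable_exp)
  then have a: "summable a" unfolding a_def by (rule summable_ignore_initial_segment)
  have "norm (mexp (mat c ** M) *v z - (\<Sum>k\<le>K. (c ^ k / fact k) *s (matpow M k *v z)))
      \<le> (suminf a + 1) * norm c ^ Suc K * norm z" if c: "norm c \<le> 1" for c z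
  proof -
    define f where "f k = (c ^ k / fact k) *s (matpow M k *v z)" for k
    have sums: "f sums (mexp (mat c ** M) *v z)" unfolding f_def by (rule propagator_sums)
    have "mexp (mat c ** M) *v z - (\<Sum>k\<le>K. f k) = (\<Sum>k. f (k + Suc K))"
      using suminf_minus_initial_segment[OF sums_summable[OF sums], of "Suc K"] sums_unique[OF sums]
      by (simp add: lessThan_Suc_atMost)
    also have "norm \<dots> \<le> (\<Sum>k. a k * (norm c ^ Suc K * norm z))"
    proof (rule norm_suminf_le)
      fix k
      have "norm (f (k + Suc K)) = norm c ^ (k + Suc K) / fact (k + Suc K) * norm (matpow M (k + Suc K) *v z)"
        unfolding f_def norm_vector_smult by (simp only: norm_divide norm_power norm_fact)
      also have "\<dots> \<le> norm c ^ Suc K / fact (k + Suc K) * (r ^ (k + Suc K) * norm z)"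
        using c by (intro mult_mono divide_right_mono power_decreasing r) auto
      finally show "norm (f (k + Suc K)) \<le> a k * (norm c ^ Suc K * norm z)"
        unfolding a_def by (simp only: divide_inverse mult_ac)
    qed (intro summable_mult2 a)
    also have "\<dots> = suminf a * (norm c ^ Suc K * norm z)" by (rule suminf_mult2[OF a, symmetric])
    also have "\<dots> \<le> (suminf a + 1) * (norm c ^ Suc K * norm z)" by (intro mult_right_mono) auto
    finally show ?thesis unfolding f_def by (simp only: mult.assoc)
  qed
  moreover have "suminf a + 1 > 0" using suminf_nonneg[OF a] r by (simp add: a_def add_nonneg_pos)
  ultimately show ?thesis by blast
qed

text \<open>Each component is an everywhere convergent power series in \<open>c\<close>.\<close>

lemma continuous_on_propagator: "continuous_on X (\<lambda>c. mexp (mat c ** M) *v z)"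
proof -
  have "isCont (\<lambda>c. (mexp (mat c ** M) *v z) $ i) c0" for i c0
  proof -
    have s: "(\<lambda>k. ((matpow M k *v z) $ i / fact k) * c ^ k) sums ((mexp (mat c ** M) *v z) $ i)" for c
      using bounded_linear.sums[OF bounded_linear_vec_nth[of i] propagator_sums[of c M z]]
      by (simp add: mult.commute)
    have "isCont (\<lambda>c. \<Sum>k. ((matpow M k *v z) $ i / fact k) * c ^ k) c0"
      using s by (intro isCont_powser_converges_everywhere) (auto intro: sums_summable)
    then show ?thesis using sums_unique[OF s] by simp
  qed
  then have "continuous_on X (\<lambda>c. \<chi> i. (mexp (mat c ** M) *v z) $ i)"
    by (intro continuous_on_vec_lambda continuous_at_imp_continuous_on ballI)
  then show ?thesis by simp
qed

text \<open>The observation of the Fourier mode \<open>z\<close>; it depends on frequency and elapsed time only through their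
product \<open>\<tau>\<close>.\<close>

definition observed :: "real^'n^'n \<Rightarrow> real^'m^'n \<Rightarrow> real \<Rightarrow> complex^'n \<Rightarrow> complex^'m" where
  "observed A B \<tau> z = cmat (transpose B) *v (mexp (mat (\<i> * complex_of_real \<tau>) ** cmat (transpose A)) *v z)"

text \<open>This is \<open>B\<^sup>\<top> (A\<^sup>\<top>)\<^sup>j z\<close>, written as the transpose of the \<open>j\<close>-th Kalman block so that its kernel is
visibly orthogonal to the columns of that block.\<close>

definition kalman_map :: "real^'n^'n \<Rightarrow> real^'m^'n \<Rightarrow> nat \<Rightarrow> complex^'n \<Rightarrow> complex^'m" where
  "kalman_map A B j z = cmat (transpose (matpow A j ** B)) *v z"

lemma linear_kalman_map: "linear (kalman_map A B j)"
  unfolding kalman_map_def by (rule linear_cmatrix_mult)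

lemma kalman_map_eq: "kalman_map A B j z = cmat (transpose B) *v (matpow (cmat (transpose A)) j *v z)"
  by (simp add: kalman_map_def matrix_transpose_mul cmat_mult transpose_matpow cmat_matpow matrix_vector_mul_assoc)

lemma continuous_on_observed: "continuous_on X (\<lambda>s. observed A B (\<xi> * s) z)"
  unfolding observed_def
  by (intro linear_continuous_on_compose[OF _ linear_cmatrix_mult]
      continuous_on_compose2[OF continuous_on_propagator[of UNIV]] continuous_intros) auto

definition observed_energy :: "real^'n^'n \<Rightarrow> real^'m^'n \<Rightarrow> real \<Rightarrow> real \<Rightarrow> complex^'n \<Rightarrow> real" where
  "observed_energy A B T \<xi> z = integral {0..T} (\<lambda>s. (norm (observed A B (\<xi> * s) z))\<^sup>2)"

section \<open>Kalman layers\<close>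

text \<open>On the orthogonal complement of the joint kernel of the \<open>F i\<close> the quadratic form on the right is
positive definite, so it is bounded below on the unit sphere by compactness; along the joint
kernel both sides are constant.\<close>

lemma kernel_dominates:
  fixes L :: "'a::euclidean_space \<Rightarrow> 'b::euclidean_space" and F :: "'i \<Rightarrow> 'a \<Rightarrow> 'c::euclidean_space"
  assumes L: "linear L" and F: "\<And>i. i \<in> I \<Longrightarrow> linear (F i)" and I: "finite I"
    and ker: "\<And>x. (\<And>i. i \<in> I \<Longrightarrow> F i x = 0) \<Longrightarrow> L x = 0"
  shows "\<exists>C>0. \<forall>x. (norm (L x))\<^sup>2 \<le> C * (\<Sum>i\<in>I. (norm (F i x))\<^sup>2)"
proof -
  define U where "U = {x. \<forall>i\<in>I. F i x = 0}"
  define q where "q x = (\<Sum>i\<in>I. (norm (F i x))\<^sup>2)" for x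
  have contL: "continuous_on X L" for X by (rule linear_continuous_on[OF linear_linear[THEN iffD2, OF L]])
  have contF: "i \<in> I \<Longrightarrow> continuous_on X (F i)" for i X
    by (rule linear_continuous_on[OF linear_linear[THEN iffD2, OF F]])
  have contq: "continuous_on X q" for X unfolding q_def by (intro continuous_intros contF)
  have U: "subspace U" unfolding U_def subspace_def
    using F by (auto simp: linear_0 linear_add linear_cmul)
  define K where "K = sphere 0 1 \<inter> U\<^sup>\<bottom>"
  have K: "compact K" unfolding K_def
    by (intro compact_Int_closed compact_sphere closed_subspace subspace_orthogonal_comp)
  obtain M where M: "M > 0" "\<And>x. norm (L x) \<le> M * norm x"
    using linear_bounded_pos[OF L] by blast
  have "\<exists>c>0. \<forall>x\<in>K. c \<le> q x"
  proof (cases "K = {}")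
    case False
    then obtain x0 where x0: "x0 \<in> K" "\<And>x. x \<in> K \<Longrightarrow> q x0 \<le> q x"
      using continuous_attains_inf[OF K _ contq] by blast
    have "q x0 \<noteq> 0"
    proof
      assume "q x0 = 0"
      then have "x0 \<in> U" unfolding q_def U_def using I by (auto simp: sum_nonneg_eq_0_iff)
      then have "orthogonal x0 x0" using x0 unfolding K_def orthogonal_comp_def by blast
      with x0 show False by (auto simp: K_def orthogonal_def)
    qed
    moreover have "q x0 \<ge> 0" unfolding q_def by (intro sum_nonneg) auto
    ultimately show ?thesis using x0 by (intro exI[of _ "q x0"]) auto
  qed (auto intro: exI[of _ 1])
  then obtain c where c: "c > 0" "\<And>x. x \<in> K \<Longrightarrow> c \<le> q x" by blast
  show ?thesis
  proof (intro exI[of _ "M\<^sup>2 / c"] conjI allI)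
    show "0 < M\<^sup>2 / c" using M c by simp
    fix x
    obtain u v where u: "u \<in> span U" and v: "\<And>w. w \<in> span U \<Longrightarrow> orthogonal v w" and x: "x = u + v"
      using orthogonal_subspace_decomp_exists[of U x] by metis
    have uU: "u \<in> U" using u U by (metis span_eq_iff)
    have v': "v \<in> U\<^sup>\<bottom>" unfolding orthogonal_comp_def
      using v by (auto simp: orthogonal_commute span_base)
    have "q x = q v" unfolding q_def x
      by (intro sum.cong) (use uU F in \<open>auto simp: U_def linear_add\<close>)
    moreover have "L x = L v" unfolding x using ker[of u] uU L by (auto simp: U_def linear_add)
    moreover have "c * (norm v)\<^sup>2 \<le> q v"
    proof (cases "v = 0")
      case True
      then show ?thesis unfolding q_def by (simp add: sum_nonneg)
    next
      case False
      have "v /\<^sub>R norm v \<in> K" unfolding K_def using False v' subspace_orthogonal_comp[of U]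
        by (auto simp: subspace_def)
      then have "c \<le> q (v /\<^sub>R norm v)" by (rule c)
      also have "\<dots> = q v / (norm v)\<^sup>2" unfolding q_def sum_divide_distrib
        by (intro sum.cong) (use F False in \<open>auto simp: linear_cmul power_mult_distrib divide_simps\<close>)
      finally show ?thesis using False by (simp add: field_simps)
    qed
    moreover have "(norm (L v))\<^sup>2 \<le> M\<^sup>2 * (norm v)\<^sup>2"
      using power_mono[OF M(2)[of v], of 2] by (simp add: power_mult_distrib)
    moreover have "M\<^sup>2 * (norm v)\<^sup>2 = M\<^sup>2 / c * (c * (norm v)\<^sup>2)" using c by simp
    moreover have "M\<^sup>2 / c * (c * (norm v)\<^sup>2) \<le> M\<^sup>2 / c * q v"
      if "c * (norm v)\<^sup>2 \<le> q v" using that c by (intro mult_left_mono) auto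
    ultimately show "(norm (L x))\<^sup>2 \<le> M\<^sup>2 / c * (\<Sum>i\<in>I. (norm (F i x))\<^sup>2)"
      unfolding q_def[symmetric] by simp
  qed
qed

lemma orth_proj_eqI:
  assumes V: "subspace V" and y: "y \<in> V" "x - y \<in> V\<^sup>\<bottom>"
  shows "orth_proj V x = y"
  unfolding orth_proj_def
proof (rule the_equality)
  fix y' assume y': "y' \<in> V \<and> x - y' \<in> V\<^sup>\<bottom>"
  have "(x - y) - (x - y') \<in> V\<^sup>\<bottom>"
    by (rule subspace_diff[OF subspace_orthogonal_comp]) (use y y' in auto)
  then have "y' - y \<in> V\<^sup>\<bottom>" by simp
  moreover have "y' - y \<in> V" using y y' V by (intro subspace_diff) auto
  ultimately have "orthogonal (y' - y) (y' - y)" by (auto simp: orthogonal_comp_def)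
  then show "y' = y" by (simp add: orthogonal_def)
qed (use y in auto)

lemma orth_proj_props:
  assumes V: "subspace V"
  shows "orth_proj V x \<in> V" "x - orth_proj V x \<in> V\<^sup>\<bottom>"
proof -
  obtain y z where y: "y \<in> span V" and z: "\<And>w. w \<in> span V \<Longrightarrow> orthogonal z w" and x: "x = y + z"
    using orthogonal_subspace_decomp_exists[of V x] by metis
  have "y \<in> V" using y V by (metis span_eq_iff)
  moreover have "x - y \<in> V\<^sup>\<bottom>" using z x by (auto simp: orthogonal_comp_def orthogonal_commute span_base)
  ultimately have "orth_proj V x = y" by (rule orth_proj_eqI[OF V])
  with \<open>y \<in> V\<close> \<open>x - y \<in> V\<^sup>\<bottom>\<close> show "orth_proj V x \<in> V" "x - orth_proj V x \<in> V\<^sup>\<bottom>" by auto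
qed

lemma linear_orth_proj:
  fixes V :: "(real^'n) set"
  assumes V: "subspace V"
  shows "linear (orth_proj V)"
proof (rule linearI)
  fix x y :: "real^'n" and r :: real
  have "(x - orth_proj V x) + (y - orth_proj V y) \<in> V\<^sup>\<bottom>"
    by (intro subspace_add subspace_orthogonal_comp orth_proj_props V)
  then show "orth_proj V (x + y) = orth_proj V x + orth_proj V y"
    by (intro orth_proj_eqI subspace_add orth_proj_props V) (simp add: algebra_simps)
  have "r *\<^sub>R (x - orth_proj V x) \<in> V\<^sup>\<bottom>"
    by (intro subspace_scale subspace_orthogonal_comp orth_proj_props V)
  then show "orth_proj V (r *\<^sub>R x) = r *\<^sub>R orth_proj V x"
    by (intro orth_proj_eqI subspace_scale orth_proj_props V) (simp add: algebra_simps)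
qed

lemma subspace_kalman_layer: "subspace (kalman_layer A B k)"
  unfolding kalman_layer_def kalman_space_def
  by (intro subspace_inter subspace_span subspace_orthogonal_comp)

definition re_vec :: "complex^'n \<Rightarrow> real^'n" where "re_vec z = (\<chi> l. Re (z $ l))"
definition im_vec :: "complex^'n \<Rightarrow> real^'n" where "im_vec z = (\<chi> l. Im (z $ l))"

lemma linear_re_vec: "linear re_vec" and linear_im_vec: "linear im_vec"
  by (rule linearI; simp add: re_vec_def im_vec_def vec_eq_iff)+

lemma re_vec_cmat: "re_vec (cmat M *v z) = M *v re_vec z"
  and im_vec_cmat: "im_vec (cmat M *v z) = M *v im_vec z"
  by (simp_all add: re_vec_def im_vec_def cmat_def matrix_vector_mult_def vec_eq_iff)

lemma linear_layer_proj: "linear (layer_proj A B k)"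
proof -
  have P: "linear (orth_proj (kalman_layer A B k))" by (rule linear_orth_proj[OF subspace_kalman_layer])
  show ?thesis
    unfolding layer_proj_def re_vec_def[symmetric] im_vec_def[symmetric]
    by (rule linearI) (simp_all add: vec_eq_iff complex_eq_iff linear_add[OF linear_re_vec]
      linear_add[OF linear_im_vec] linear_add[OF P] linear_cmul[OF linear_re_vec]
      linear_cmul[OF linear_im_vec] linear_cmul[OF P])
qed

text \<open>Links the column spans that define the Kalman spaces with the kernels of the transposed blocks.\<close>

lemma orthogonal_columns_iff:
  "(\<forall>c\<in>columns M. orthogonal c x) \<longleftrightarrow> transpose M *v x = 0" for M :: "real^'m^'n"
proof -
  have "columns M = range (\<lambda>i. column i M)" by (auto simp: columns_def)
  moreover have "orthogonal (column i M) x \<longleftrightarrow> (transpose M *v x) $ i = 0" for i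
    by (simp add: column_def orthogonal_def inner_vec_def matrix_vector_mult_def transpose_def)
  ultimately show ?thesis by (simp add: vec_eq_iff)
qed

lemma kalman_map_eq_0_orthogonal:
  assumes "\<And>j. j < k \<Longrightarrow> kalman_map A B j z = 0" and y: "y \<in> kalman_space A B k"
  shows "orthogonal y (re_vec z)" "orthogonal y (im_vec z)"
proof -
  have ker: "transpose (matpow A j ** B) *v re_vec z = 0 \<and> transpose (matpow A j ** B) *v im_vec z = 0" if "j < k" for j
    using assms(1)[OF that]
    by (simp flip: re_vec_cmat im_vec_cmat
        add: kalman_map_def linear_0[OF linear_re_vec] linear_0[OF linear_im_vec])
  have "orthogonal (re_vec z) c \<and> orthogonal (im_vec z) c"
    if "c \<in> (\<Union>j<k. columns (matpow A j ** B))" for c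
  proof -
    from that obtain j where "j < k" "c \<in> columns (matpow A j ** B)" by blast
    then show ?thesis using ker[of j] unfolding orthogonal_columns_iff[symmetric]
      by (simp add: orthogonal_commute)
  qed
  then have "orthogonal (re_vec z) y" "orthogonal (im_vec z) y"
    using y unfolding kalman_space_def by (blast intro: orthogonal_to_span)+
  then show "orthogonal y (re_vec z)" "orthogonal y (im_vec z)"
    by (simp_all add: orthogonal_commute)
qed

text \<open>If \<open>B\<^sup>\<top> (A\<^sup>\<top>)\<^sup>j z = 0\<close> for all \<open>j \<le> k\<close>, then \<open>z\<close> is orthogonal to \<open>\<K>\<^sub>k\<close>, which contains the layer.\<close>

lemma layer_proj_bound:
  "\<exists>C>0. \<forall>z. (norm (layer_proj A B k z))\<^sup>2 \<le> C * (\<Sum>j\<le>k. (norm (kalman_map A B j z))\<^sup>2)"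
proof (rule kernel_dominates)
  fix z assume ker: "\<And>j. j \<in> {..k} \<Longrightarrow> kalman_map A B j z = 0"
  have zero: "orth_proj (kalman_layer A B k) x = 0" if "\<And>y. y \<in> kalman_space A B (Suc k) \<Longrightarrow> orthogonal y x" for x
    using that by (intro orth_proj_eqI subspace_kalman_layer subspace_0)
      (auto simp: orthogonal_comp_def kalman_layer_def)
  have "orth_proj (kalman_layer A B k) (re_vec z) = 0" "orth_proj (kalman_layer A B k) (im_vec z) = 0"
    using ker by (auto intro!: zero kalman_map_eq_0_orthogonal[of "Suc k" A B z])
  then show "layer_proj A B k z = 0"
    unfolding layer_proj_def re_vec_def[symmetric] im_vec_def[symmetric] by (simp add: vec_eq_iff complex_eq_iff)
qed (simp_all add: linear_layer_proj linear_kalman_map)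

text \<open>The dual form of the rank condition: a vector annihilated by all transposed blocks is orthogonal
to the whole space.\<close>

lemma kalman_observability:
  fixes A :: "real^'n^'n"
  assumes "kalman_full A B K"
  shows "\<exists>C>0. \<forall>z. (norm z)\<^sup>2 \<le> C * (\<Sum>j\<le>K. (norm (kalman_map A B j z))\<^sup>2)"
proof (rule kernel_dominates)
  fix z assume ker: "\<And>j. j \<in> {..K} \<Longrightarrow> kalman_map A B j z = 0"
  have "kalman_space A B (Suc K) = UNIV"
    using assms dim_eq_full[of "\<Union>j<Suc K. columns (matpow A j ** B)"]
    by (simp add: kalman_full_def kalman_space_def dim_span)
  then have "orthogonal (re_vec z) (re_vec z)" "orthogonal (im_vec z) (im_vec z)"
    using kalman_map_eq_0_orthogonal[of "Suc K" A B z] ker by auto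
  then have "re_vec z = 0" "im_vec z = 0" by (auto simp: orthogonal_def)
  then show "z = 0" by (simp add: re_vec_def im_vec_def vec_eq_iff complex_eq_iff)
qed (auto intro: linearI linear_kalman_map)

section \<open>Bounded frequencies\<close>

text \<open>Taylor's formula compares the observation on \<open>[0, 1]\<close> with a polynomial in time whose coefficients
are multiples of the left-hand terms.  The squared error is \<open>O(\<bar>\<eta>\<bar>\<^sup>2\<^sup>K\<^sup>+\<^sup>2 \<bar>z\<bar>\<^sup>2)\<close>, and by the
observability hypothesis \<open>\<bar>\<eta>\<bar>\<^sup>2\<^sup>K \<bar>z\<bar>\<^sup>2\<close> is dominated by the left-hand side, so that a further factor
\<open>\<bar>\<eta>\<bar>\<^sup>2\<close> is left to absorb it.\<close>

lemma small_frequency_estimate: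
  fixes A :: "real^'n^'n" and B :: "real^'m^'n"
  assumes obs: "\<And>z. (norm z)\<^sup>2 \<le> C0 * (\<Sum>j\<le>K. (norm (kalman_map A B j z))\<^sup>2)" and C0: "C0 > 0"
  shows "\<exists>\<epsilon>>0. \<exists>C>0. \<forall>\<eta> z. \<bar>\<eta>\<bar> \<le> \<epsilon> \<longrightarrow>
    (\<Sum>j\<le>K. (\<bar>\<eta>\<bar> ^ j * norm (kalman_map A B j z))\<^sup>2) \<le> C * observed_energy A B 1 \<eta> z"
proof -
  define L where "L = kalman_map A B"
  have one_pos: "(1::real) > 0" by simp
  obtain C1 where C1: "C1 > 0" and poly: "\<And>y :: nat \<Rightarrow> complex^'m. (\<Sum>j\<le>K. (norm (y j))\<^sup>2)
      \<le> C1 * integral {0..1} (\<lambda>s. (norm (\<Sum>j\<le>K. s ^ j *\<^sub>R y j))\<^sup>2)"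
    using polynomial_coeffs_le_integral[OF one_pos, of K] by blast
  obtain R0 where R0: "R0 > 0" and taylor: "\<And>c z. norm c \<le> 1 \<Longrightarrow>
    norm (mexp (mat c ** cmat (transpose A)) *v z - (\<Sum>k\<le>K. (c ^ k / fact k) *s (matpow (cmat (transpose A)) k *v z)))
      \<le> R0 * norm c ^ Suc K * norm z"
    using propagator_taylor[where K = K and M = "cmat (transpose A)"] by blast
  obtain \<beta> where \<beta>: "\<beta> > 0" "\<And>z. norm (cmat (transpose B) *v z) \<le> \<beta> * norm z"
    using linear_bounded_pos[OF linear_cmatrix_mult[of "cmat (transpose B)"]] by blast
  define R where "R = \<beta> * R0"
  have R: "R > 0" unfolding R_def using \<beta> R0 by simp
  define D where "D = 2 * (fact K)\<^sup>2 * C1"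
  have D: "D > 0" unfolding D_def using C1 by simp
  \<comment> \<open>Chosen so that the Taylor error takes at most half of the sum to be estimated.\<close>
  define \<epsilon> where "\<epsilon> = min 1 (1 / sqrt (2 * D * R\<^sup>2 * C0))"
  have \<epsilon>: "\<epsilon> > 0" "\<epsilon> \<le> 1" unfolding \<epsilon>_def using D R C0 by auto
  have \<epsilon>2: "D * R\<^sup>2 * C0 * \<epsilon>\<^sup>2 \<le> 1 / 2"
  proof -
    have "\<epsilon>\<^sup>2 \<le> (1 / sqrt (2 * D * R\<^sup>2 * C0))\<^sup>2" using \<epsilon> by (intro power_mono) (auto simp: \<epsilon>_def)
    also have "\<dots> = 1 / (2 * (D * R\<^sup>2 * C0))" using D R C0 by (simp add: power_divide mult.assoc)
    finally show ?thesis using D R C0 by (simp add: field_simps)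
  qed
  have "(\<Sum>j\<le>K. (\<bar>\<eta>\<bar> ^ j * norm (L j z))\<^sup>2) \<le> 2 * D * observed_energy A B 1 \<eta> z" if \<eta>: "\<bar>\<eta>\<bar> \<le> \<epsilon>" for \<eta> z
  proof -
    define y where "y j = ((\<i> * of_real \<eta>) ^ j / fact j) *s L j z" for j
    define S where "S = (\<Sum>j\<le>K. (\<bar>\<eta>\<bar> ^ j * norm (L j z))\<^sup>2)"
    have \<eta>1: "\<bar>\<eta>\<bar> \<le> 1" using \<eta> \<epsilon> by linarith
    have rem: "norm (observed A B (\<eta> * s) z - (\<Sum>j\<le>K. s ^ j *\<^sub>R y j)) \<le> R * \<bar>\<eta>\<bar> ^ Suc K * norm z"
      if s: "s \<in> {0..1}" for s
    proof -
      define c where "c = \<i> * complex_of_real (\<eta> * s)"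
      have "\<bar>\<eta>\<bar> * s \<le> \<bar>\<eta>\<bar> * 1" using s by (intro mult_left_mono) auto
      then have nc: "norm c \<le> \<bar>\<eta>\<bar>" using s by (simp add: c_def norm_mult abs_mult)
      have "s ^ j *\<^sub>R y j = cmat (transpose B) *v ((c ^ j / fact j) *s (matpow (cmat (transpose A)) j *v z))" for j
        by (simp add: y_def L_def kalman_map_eq vector_scalar_commute scaleR_vec_eq
            vector_smult_assoc c_def power_mult_distrib mult_ac)
      then have "observed A B (\<eta> * s) z - (\<Sum>j\<le>K. s ^ j *\<^sub>R y j) = cmat (transpose B) *v
          (mexp (mat c ** cmat (transpose A)) *v z - (\<Sum>k\<le>K. (c ^ k / fact k) *s (matpow (cmat (transpose A)) k *v z)))"
        unfolding observed_def c_def[symmetric]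
        by (simp add: linear_diff[OF linear_cmatrix_mult] linear_sum[OF linear_cmatrix_mult])
      also have "norm \<dots> \<le> \<beta> * (R0 * norm c ^ Suc K * norm z)"
        using nc \<eta>1 \<beta> by (intro order_trans[OF \<beta>(2)] mult_left_mono taylor) auto
      also have "\<dots> \<le> \<beta> * (R0 * \<bar>\<eta>\<bar> ^ Suc K * norm z)"
        using nc \<beta> R0 by (intro mult_left_mono mult_right_mono power_mono) auto
      finally show ?thesis by (simp add: R_def mult.assoc)
    qed
    define e where "e = R\<^sup>2 * (\<bar>\<eta>\<bar> ^ Suc K * norm z)\<^sup>2"
    have "S \<le> (fact K)\<^sup>2 * (\<Sum>j\<le>K. (norm (y j))\<^sup>2)"
      unfolding S_def sum_distrib_left
    proof (rule sum_mono)
      fix j assume "j \<in> {..K}"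
      then have "(fact j :: real) \<le> fact K" by (intro fact_mono) auto
      have "norm (y j) = \<bar>\<eta>\<bar> ^ j / fact j * norm (L j z)"
        unfolding y_def norm_vector_smult by (simp add: norm_divide norm_power norm_mult)
      then have "\<bar>\<eta>\<bar> ^ j * norm (L j z) = fact j * norm (y j)" by simp
      also have "\<dots> \<le> fact K * norm (y j)" using \<open>fact j \<le> fact K\<close> by (intro mult_right_mono) auto
      finally show "(\<bar>\<eta>\<bar> ^ j * norm (L j z))\<^sup>2 \<le> (fact K)\<^sup>2 * (norm (y j))\<^sup>2"
        by (subst power_mult_distrib[symmetric]) (intro power_mono, auto)
    qed
    also have "\<dots> \<le> (fact K)\<^sup>2 * (C1 * integral {0..1} (\<lambda>s. (norm (\<Sum>j\<le>K. s ^ j *\<^sub>R y j))\<^sup>2))"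
      by (intro mult_left_mono poly) auto
    also have "\<dots> \<le> (fact K)\<^sup>2 * (C1 * integral {0..1} (\<lambda>s. 2 * (norm (observed A B (\<eta> * s) z))\<^sup>2 + 2 * e))"
    proof (intro mult_left_mono integral_le integrable_continuous_real continuous_intros continuous_on_observed)
      fix s :: real assume s: "s \<in> {0..1}"
      have "(norm (observed A B (\<eta> * s) z - (\<Sum>j\<le>K. s ^ j *\<^sub>R y j)))\<^sup>2 \<le> (R * \<bar>\<eta>\<bar> ^ Suc K * norm z)\<^sup>2"
        by (intro power_mono rem s) auto
      also have "\<dots> = e" unfolding e_def by (simp only: power_mult_distrib mult.assoc)
      finally show "(norm (\<Sum>j\<le>K. s ^ j *\<^sub>R y j))\<^sup>2 \<le> 2 * (norm (observed A B (\<eta> * s) z))\<^sup>2 + 2 * e"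
        using norm_diff_sq_le[of "observed A B (\<eta> * s) z" "observed A B (\<eta> * s) z - (\<Sum>j\<le>K. s ^ j *\<^sub>R y j)"]
        by simp
    qed (use C1 in auto)
    also have "integral {0..1} (\<lambda>s. 2 * (norm (observed A B (\<eta> * s) z))\<^sup>2 + 2 * e) = 2 * observed_energy A B 1 \<eta> z + 2 * e"
      unfolding observed_energy_def
      by (subst Henstock_Kurzweil_Integration.integral_add)
        (auto intro!: integrable_continuous_real continuous_intros continuous_on_observed)
    finally have "S \<le> D * observed_energy A B 1 \<eta> z + D * e" unfolding D_def by (simp add: algebra_simps)
    moreover have "D * e \<le> 1 / 2 * S"
    proof -
      have "(\<bar>\<eta>\<bar> ^ K * norm z)\<^sup>2 = (\<bar>\<eta>\<bar> ^ K)\<^sup>2 * (norm z)\<^sup>2" by (simp add: power_mult_distrib)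
      also have "\<dots> \<le> (\<bar>\<eta>\<bar> ^ K)\<^sup>2 * (C0 * (\<Sum>j\<le>K. (norm (L j z))\<^sup>2))"
        unfolding L_def by (intro mult_left_mono obs) auto
      also have "\<dots> = C0 * (\<Sum>j\<le>K. (\<bar>\<eta>\<bar> ^ K * norm (L j z))\<^sup>2)"
        by (simp add: power_mult_distrib sum_distrib_left mult_ac)
      also have "\<dots> \<le> C0 * S" unfolding S_def using C0 \<eta>1
        by (intro mult_left_mono sum_mono power_mono mult_right_mono power_decreasing) auto
      finally have 1: "(\<bar>\<eta>\<bar> ^ K * norm z)\<^sup>2 \<le> C0 * S" .
      have \<eta>2: "\<eta>\<^sup>2 \<le> \<epsilon>\<^sup>2"
        using power_mono[OF \<eta>, of 2] by simp
      have "D * e = D * R\<^sup>2 * \<eta>\<^sup>2 * (\<bar>\<eta>\<bar> ^ K * norm z)\<^sup>2"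
        unfolding e_def by (simp add: power_mult_distrib)
      also have "\<dots> \<le> D * R\<^sup>2 * \<epsilon>\<^sup>2 * (C0 * S)"
        using D C0 \<eta>2 by (intro mult_mono 1 order_refl) (auto simp: S_def sum_nonneg)
      also have "\<dots> = D * R\<^sup>2 * C0 * \<epsilon>\<^sup>2 * S" by simp
      also have "\<dots> \<le> 1 / 2 * S" by (intro mult_right_mono \<epsilon>2) (simp add: S_def sum_nonneg)
      finally show ?thesis .
    qed
    ultimately have "S \<le> 2 * D * observed_energy A B 1 \<eta> z" by linarith
    then show ?thesis unfolding S_def .
  qed
  then show ?thesis using \<epsilon> D unfolding L_def by (intro exI[of _ \<epsilon>] exI[of _ "2 * D"] conjI) auto
qed

text \<open>A shorter observation time is equivalent to a smaller frequency.\<close>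

lemma observed_energy_scale:
  assumes "\<theta> > 0" "\<theta> \<le> T"
  shows "\<theta> * observed_energy A B 1 (\<theta> * \<xi>) z \<le> observed_energy A B T \<xi> z"
proof -
  have eq: "(\<lambda>x::real. x / \<theta>) ` {0..\<theta>} = {0..1}"
    using assms by (auto simp: image_iff field_simps intro!: bexI[of _ "_ * \<theta>"])
  have "\<theta> * observed_energy A B 1 (\<theta> * \<xi>) z = integral {0..\<theta>} (\<lambda>s. (norm (observed A B (\<xi> * s) z))\<^sup>2)"
    using integral_stretch_real[of \<theta> 0 \<theta> "\<lambda>s. (norm (observed A B (\<xi> * s) z))\<^sup>2"] assms
    unfolding eq observed_energy_def by (simp add: mult_ac)
  also have "\<dots> \<le> observed_energy A B T \<xi> z" unfolding observed_energy_def using assms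
    by (intro integral_subset_le integrable_continuous_real continuous_intros continuous_on_observed) auto
  finally show ?thesis .
qed

text \<open>Observing only on \<open>[0, \<theta>]\<close> with \<open>\<theta> R \<le> \<epsilon>\<close> replaces \<open>\<xi>\<close> by \<open>\<theta> \<xi>\<close>, to which the estimate for small
frequencies applies.\<close>

lemma bounded_frequency_estimate:
  fixes A :: "real^'n^'n" and B :: "real^'m^'n"
  assumes obs: "\<And>z. (norm z)\<^sup>2 \<le> C0 * (\<Sum>j\<le>K. (norm (kalman_map A B j z))\<^sup>2)" and C0: "C0 > 0"
    and T: "T > 0" and R: "R > 0"
  shows "\<exists>C>0. \<forall>\<xi> z. \<bar>\<xi>\<bar> \<le> R \<longrightarrow>
    (\<Sum>j\<le>K. (\<bar>\<xi>\<bar> ^ j * norm (kalman_map A B j z))\<^sup>2) \<le> C * observed_energy A B T \<xi> z"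
proof -
  obtain \<epsilon> C where \<epsilon>: "\<epsilon> > 0" and C: "C > 0" and small: "\<And>\<eta> z. \<bar>\<eta>\<bar> \<le> \<epsilon> \<Longrightarrow>
    (\<Sum>j\<le>K. (\<bar>\<eta>\<bar> ^ j * norm (kalman_map A B j z))\<^sup>2) \<le> C * observed_energy A B 1 \<eta> z"
    using small_frequency_estimate[OF obs C0] by blast
  define \<theta> where "\<theta> = min (min T 1) (\<epsilon> / R)"
  have \<theta>: "\<theta> > 0" "\<theta> \<le> T" "\<theta> \<le> 1" "\<theta> \<le> \<epsilon> / R" unfolding \<theta>_def using T R \<epsilon> by auto
  have "(\<Sum>j\<le>K. (\<bar>\<xi>\<bar> ^ j * norm (kalman_map A B j z))\<^sup>2) \<le> C / (\<theta> * (\<theta> ^ K)\<^sup>2) * observed_energy A B T \<xi> z"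
    if \<xi>: "\<bar>\<xi>\<bar> \<le> R" for \<xi> z
  proof -
    have "(\<theta> ^ K)\<^sup>2 * (\<Sum>j\<le>K. (\<bar>\<xi>\<bar> ^ j * norm (kalman_map A B j z))\<^sup>2)
        \<le> (\<Sum>j\<le>K. (\<bar>\<theta> * \<xi>\<bar> ^ j * norm (kalman_map A B j z))\<^sup>2)"
      unfolding sum_distrib_left
    proof (rule sum_mono)
      fix j assume "j \<in> {..K}"
      then have "\<theta> ^ K * (\<bar>\<xi>\<bar> ^ j * norm (kalman_map A B j z)) \<le> \<theta> ^ j * (\<bar>\<xi>\<bar> ^ j * norm (kalman_map A B j z))"
        using \<theta> by (intro mult_right_mono power_decreasing) auto
      also have "\<dots> = \<bar>\<theta> * \<xi>\<bar> ^ j * norm (kalman_map A B j z)"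
        using \<theta> by (simp add: abs_mult power_mult_distrib)
      finally show "(\<theta> ^ K)\<^sup>2 * (\<bar>\<xi>\<bar> ^ j * norm (kalman_map A B j z))\<^sup>2
          \<le> (\<bar>\<theta> * \<xi>\<bar> ^ j * norm (kalman_map A B j z))\<^sup>2"
        using \<theta> by (subst power_mult_distrib[symmetric]) (intro power_mono, auto)
    qed
    also have "\<dots> \<le> C * observed_energy A B 1 (\<theta> * \<xi>) z"
    proof (rule small)
      have "\<bar>\<theta> * \<xi>\<bar> \<le> \<epsilon> / R * R" unfolding abs_mult using \<theta> \<xi> R by (intro mult_mono) auto
      then show "\<bar>\<theta> * \<xi>\<bar> \<le> \<epsilon>" using R by simp
    qed
    also have "\<dots> \<le> C * (observed_energy A B T \<xi> z / \<theta>)"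
      using observed_energy_scale[OF \<theta>(1,2), of A B \<xi> z] C \<theta> by (intro mult_left_mono) (auto simp: field_simps)
    finally show ?thesis using \<theta> by (simp add: field_simps)
  qed
  moreover have "C / (\<theta> * (\<theta> ^ K)\<^sup>2) > 0" using C \<theta> by simp
  ultimately show ?thesis by blast
qed

section \<open>Jordan structure and high frequencies\<close>

text \<open>Two indices linked by a nonzero entry belong to the same Jordan block.\<close>

lemma jordan_matrix_diag_eq:
  assumes "i < sum_list (map fst n_as)" "j < sum_list (map fst n_as)" "jordan_matrix n_as $$ (i, j) \<noteq> 0"
  shows "jordan_matrix n_as $$ (i, i) = jordan_matrix n_as $$ (j, j)"
  using assms
proof (induction n_as arbitrary: i j)
  case (Cons na n_as)
  obtain n a where na: "na = (n, a)" by (cases na)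
  show ?case
    using Cons.prems Cons.IH[of "i - n" "j - n"] unfolding na jordan_matrix_Cons
    by (auto split: if_splits)
qed simp

text \<open>What is used of a Jordan matrix: along some enumeration of the indices it is upper triangular, and it
couples only indices with the same diagonal entry.\<close>

locale triangular_blocks =
  fixes J :: "real^'n^'n" and e :: "'n \<Rightarrow> nat"
  assumes inj_e: "inj e"
    and upper: "J $ i $ j \<noteq> 0 \<Longrightarrow> e i \<le> e j"
    and diag_eq: "J $ i $ j \<noteq> 0 \<Longrightarrow> J $ i $ i = J $ j $ j"

lemma is_jordan_triangular_blocks:
  fixes J :: "real^'n^'n"
  assumes "is_jordan J"
  shows "\<exists>e. triangular_blocks J e"
proof -
  from assms obtain n_as and e :: "'n \<Rightarrow> nat" where size: "sum_list (map fst n_as) = CARD('n)"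
    and bij: "bij_betw e UNIV {..<CARD('n)}" and J: "\<And>i j. J $ i $ j = jordan_matrix n_as $$ (e i, e j)"
    unfolding is_jordan_def by blast
  have lt: "e i < sum_list (map fst n_as)" for i using bij size by (auto simp: bij_betw_def)
  have "triangular_blocks J e"
  proof
    show "inj e" using bij by (simp add: bij_betw_def)
    show "e i \<le> e j" if "J $ i $ j \<noteq> 0" for i j
      using that jordan_matrix_upper_triangular[OF lt, of "e j" i] unfolding J by (meson not_le)
    show "J $ i $ i = J $ j $ j" if "J $ i $ j \<noteq> 0" for i j
      using that jordan_matrix_diag_eq[OF lt lt] unfolding J by blast
  qed
  then show ?thesis by blast
qed

text \<open>The coordinate projection onto the indices with diagonal entry \<open>\<mu>\<close>.  It turns out to be the
projection onto the generalized eigenspace of \<open>\<mu>\<close>.\<close>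

definition diag_part :: "real^'n^'n \<Rightarrow> complex \<Rightarrow> complex^'n \<Rightarrow> complex^'n" where
  "diag_part J \<mu> u = (\<chi> i. if complex_of_real (J $ i $ i) = \<mu> then u $ i else 0)"

lemma linear_diag_part: "linear (diag_part J \<mu>)"
  by (rule linearI) (auto simp: diag_part_def vec_eq_iff)

lemma diag_part_idem: "diag_part J \<mu> (diag_part J \<mu> u) = diag_part J \<mu> u"
  by (simp add: diag_part_def vec_eq_iff)

lemma diag_part_fixed_iff: "diag_part J \<mu> u = u \<longleftrightarrow> (\<forall>i. u $ i \<noteq> 0 \<longrightarrow> complex_of_real (J $ i $ i) = \<mu>)"
  by (auto simp: diag_part_def vec_eq_iff)

lemma nil_map_mult: "nil_map J \<mu> *v u = cmat J *v u - \<mu> *s u"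
proof -
  have "mat \<mu> *v u = \<mu> *s u"
    by (simp add: vec_eq_iff matrix_vector_mult_def mat_def if_distrib if_distribR cong: if_cong)
  then show ?thesis by (simp add: nil_map_def matrix_vector_mult_diff_rdistrib)
qed

lemma nil_map_nth:
  "(nil_map J \<mu> *v u) $ i = (\<Sum>j\<in>UNIV. complex_of_real (J $ i $ j) * u $ j) - \<mu> * u $ i"
  by (simp add: nil_map_mult) (simp add: matrix_vector_mult_def cmat_def)

context triangular_blocks
begin

lemma nil_map_diag_part: "nil_map J \<mu> *v diag_part J \<nu> u = diag_part J \<nu> (nil_map J \<mu> *v u)"
proof (subst vec_eq_iff, rule allI)
  fix i
  have "(\<Sum>j\<in>UNIV. complex_of_real (J $ i $ j) * diag_part J \<nu> u $ j)
      = (\<Sum>j\<in>UNIV. if complex_of_real (J $ i $ i) = \<nu> then complex_of_real (J $ i $ j) * u $ j else 0)"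
  proof (intro sum.cong refl)
    fix j
    show "complex_of_real (J $ i $ j) * diag_part J \<nu> u $ j
        = (if complex_of_real (J $ i $ i) = \<nu> then complex_of_real (J $ i $ j) * u $ j else 0)"
      using diag_eq[of i j] by (cases "J $ i $ j = 0") (auto simp: diag_part_def)
  qed
  then show "(nil_map J \<mu> *v diag_part J \<nu> u) $ i = diag_part J \<nu> (nil_map J \<mu> *v u) $ i"
    unfolding nil_map_nth by (simp add: diag_part_def nil_map_nth)
qed

lemma matpow_nil_map_diag_part:
  "matpow (nil_map J \<mu>) k *v diag_part J \<nu> u = diag_part J \<nu> (matpow (nil_map J \<mu>) k *v u)"
  by (induction k) (simp_all add: nil_map_diag_part flip: matrix_vector_mul_assoc)

text \<open>Look at the last nonzero coordinate of \<open>u\<close>: by triangularity only the diagonal entry acts there.\<close>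

lemma kernel_meets_diagonal:
  assumes ker: "nil_map J \<mu> *v u = 0" and u: "u \<noteq> 0"
  shows "\<exists>i. u $ i \<noteq> 0 \<and> complex_of_real (J $ i $ i) = \<mu>"
proof -
  define X where "X = {i. u $ i \<noteq> 0}"
  have "X \<noteq> {}" "finite X" using u by (auto simp: X_def vec_eq_iff)
  then have "Max (e ` X) \<in> e ` X" by (intro Max_in) auto
  then obtain i where "i \<in> X" "e i = Max (e ` X)" by auto
  with \<open>finite X\<close> have i: "i \<in> X" "\<And>j. j \<in> X \<Longrightarrow> e j \<le> e i" by auto
  have "(\<Sum>j\<in>UNIV. complex_of_real (J $ i $ j) * u $ j) = complex_of_real (J $ i $ i) * u $ i"
  proof (subst sum.remove[of _ i])
    have "complex_of_real (J $ i $ j) * u $ j = 0" if "j \<noteq> i" for j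
      using that upper[of i j] i(2)[of j] inj_e by (auto simp: X_def inj_def) (metis le_antisym)
    then have "(\<Sum>j\<in>UNIV - {i}. complex_of_real (J $ i $ j) * u $ j) = 0" by (intro sum.neutral) auto
    then show "complex_of_real (J $ i $ i) * u $ i + (\<Sum>j\<in>UNIV - {i}. complex_of_real (J $ i $ j) * u $ j)
        = complex_of_real (J $ i $ i) * u $ i" by simp
  qed auto
  with ker have "complex_of_real (J $ i $ i) * u $ i - \<mu> * u $ i = 0"
    using nil_map_nth[of J \<mu> u i] by simp
  with i(1) show ?thesis by (auto simp: X_def simp flip: left_diff_distrib)
qed

lemma matpow_nil_map_inj:
  assumes "matpow (nil_map J \<mu>) k *v u = 0" "diag_part J \<nu> u = u" "\<nu> \<noteq> \<mu>"
  shows "u = 0"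
  using assms(1)
proof (induction k)
  case (Suc k)
  define w where "w = matpow (nil_map J \<mu>) k *v u"
  have w: "diag_part J \<nu> w = w" unfolding w_def matpow_nil_map_diag_part[symmetric] assms(2) ..
  have "nil_map J \<mu> *v w = 0" using Suc.prems by (simp add: w_def flip: matrix_vector_mul_assoc)
  then have "w = 0" using kernel_meets_diagonal[of \<mu> w] w assms(3) unfolding diag_part_fixed_iff by blast
  then show ?case unfolding w_def by (rule Suc.IH)
qed simp

definition depth :: nat where "depth = Max (range e)"

text \<open>On the coordinates with diagonal entry \<open>\<mu>\<close> the matrix \<open>J - \<mu>\<close> is strictly upper triangular, so every
application pushes the support strictly down the enumeration.\<close>

lemma nilpotent: "matpow (nil_map J \<mu>) (Suc depth) *v diag_part J \<mu> u = 0"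
proof -
  define w where "w k = matpow (nil_map J \<mu>) k *v diag_part J \<mu> u" for k
  have w: "diag_part J \<mu> (w k) = w k" for k
    unfolding w_def matpow_nil_map_diag_part[symmetric] diag_part_idem ..
  have rank: "e i + k \<le> depth" if "w k $ i \<noteq> 0" for i k
    using that
  proof (induction k arbitrary: i)
    case 0
    show ?case by (simp add: depth_def)
  next
    case (Suc k)
    have "w (Suc k) $ i = (\<Sum>j\<in>UNIV. complex_of_real (J $ i $ j) * w k $ j) - \<mu> * w k $ i"
      by (simp add: w_def nil_map_nth flip: matrix_vector_mul_assoc)
    also have "\<mu> * w k $ i = complex_of_real (J $ i $ i) * w k $ i"
      using w[of k] unfolding diag_part_fixed_iff by (cases "w k $ i = 0") auto
    also have "(\<Sum>j\<in>UNIV. complex_of_real (J $ i $ j) * w k $ j) - complex_of_real (J $ i $ i) * w k $ i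
        = (\<Sum>j\<in>UNIV - {i}. complex_of_real (J $ i $ j) * w k $ j)"
      by (subst sum.remove[of _ i]) auto
    finally have "(\<Sum>j\<in>UNIV - {i}. complex_of_real (J $ i $ j) * w k $ j) \<noteq> 0" using Suc.prems by simp
    then obtain j where "j \<in> UNIV - {i}" "complex_of_real (J $ i $ j) * w k $ j \<noteq> 0"
      by (rule sum.not_neutral_contains_not_neutral)
    then have "j \<noteq> i" "J $ i $ j \<noteq> 0" "w k $ j \<noteq> 0" by auto
    moreover from this have "e i < e j" using upper[of i j] inj_e by (metis injD le_neq_implies_less)
    ultimately show ?case using Suc.IH[of j] by simp
  qed
  have "w (Suc depth) = 0"
    using rank[of "Suc depth"] by (auto simp: vec_eq_iff)
  then show ?thesis by (simp add: w_def)
qed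

text \<open>For \<open>\<nu> \<noteq> \<mu>\<close> the matrix \<open>J - \<mu>\<close> is injective on the coordinates with diagonal entry \<open>\<nu>\<close>, so a vector
killed by a power of \<open>J - \<mu>\<close> has no such coordinates.\<close>

lemma gen_eigenspace_eq: "gen_eigenspace J \<mu> = {u. diag_part J \<mu> u = u}"
proof (intro equalityI subsetI)
  fix u assume "u \<in> gen_eigenspace J \<mu>"
  then obtain k where k: "matpow (nil_map J \<mu>) k *v u = 0" by (auto simp: gen_eigenspace_def)
  have "complex_of_real (J $ i $ i) = \<mu>" if "u $ i \<noteq> 0" for i
  proof (rule ccontr)
    assume ne: "complex_of_real (J $ i $ i) \<noteq> \<mu>"
    have "diag_part J (complex_of_real (J $ i $ i)) u = 0"
      by (rule matpow_nil_map_inj[where k = k, OF _ diag_part_idem ne])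
        (simp add: matpow_nil_map_diag_part k linear_0[OF linear_diag_part])
    then have "diag_part J (complex_of_real (J $ i $ i)) u $ i = 0" by simp
    with that show False by (simp add: diag_part_def)
  qed
  then show "u \<in> {u. diag_part J \<mu> u = u}" by (simp add: diag_part_fixed_iff)
next
  fix u assume "u \<in> {u. diag_part J \<mu> u = u}"
  then show "u \<in> gen_eigenspace J \<mu>" using nilpotent[of \<mu> u] 
    unfolding gen_eigenspace_def by (simp del: matpow.simps) blast
qed

text \<open>In the nontrivial inclusion an eigenvector is the last nonzero iterate of a unit vector under the
nilpotent map \<open>J - \<mu>\<close>.\<close>

lemma spectrum_eq: "matrix_spectrum (cmat J) = range (\<lambda>i. complex_of_real (J $ i $ i))"
proof (intro equalityI subsetI)
  fix \<mu> assume "\<mu> \<in> matrix_spectrum (cmat J)"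
  then obtain v where "v \<noteq> 0" "nil_map J \<mu> *v v = 0"
    by (auto simp: matrix_spectrum_def nil_map_mult)
  then show "\<mu> \<in> range (\<lambda>i. complex_of_real (J $ i $ i))" using kernel_meets_diagonal by blast
next
  fix \<mu> assume "\<mu> \<in> range (\<lambda>i. complex_of_real (J $ i $ i))"
  then obtain i where i: "\<mu> = complex_of_real (J $ i $ i)" by blast
  define u :: "complex^'n" where "u = axis i 1"
  have u: "u \<noteq> 0" "diag_part J \<mu> u = u"
    unfolding diag_part_fixed_iff by (auto simp: u_def i axis_def vec_eq_iff split: if_splits)
  define k where "k = (LEAST k. matpow (nil_map J \<mu>) k *v u = 0)"
  have k: "matpow (nil_map J \<mu>) k *v u = 0"
  proof -
    have "matpow (nil_map J \<mu>) (Suc depth) *v u = 0" using nilpotent[of \<mu> u] unfolding u(2) .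
    then show ?thesis unfolding k_def by (rule LeastI)
  qed
  then obtain l where l: "k = Suc l" using u by (cases k) auto
  define w where "w = matpow (nil_map J \<mu>) l *v u"
  have "w \<noteq> 0" unfolding w_def
    using not_less_Least[of l "\<lambda>k. matpow (nil_map J \<mu>) k *v u = 0"] l k_def by simp
  moreover have "nil_map J \<mu> *v w = 0" using k by (simp add: w_def l flip: matrix_vector_mul_assoc)
  ultimately show "\<mu> \<in> matrix_spectrum (cmat J)"
    by (auto simp: matrix_spectrum_def nil_map_mult)
qed

lemma finite_spectrum: "finite (matrix_spectrum (cmat J))"
  unfolding spectrum_eq by simp

lemma sum_diag_part: "(\<Sum>\<nu>\<in>matrix_spectrum (cmat J). diag_part J \<nu> u) = u"
proof (subst vec_eq_iff, rule allI)
  fix i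
  have "(\<Sum>\<nu>\<in>matrix_spectrum (cmat J). diag_part J \<nu> u) $ i
      = (\<Sum>\<nu>\<in>matrix_spectrum (cmat J). if \<nu> = complex_of_real (J $ i $ i) then u $ i else 0)"
    unfolding sum_component by (intro sum.cong) (auto simp: diag_part_def)
  also have "\<dots> = u $ i" by (simp add: finite_spectrum) (simp add: spectrum_eq)
  finally show "(\<Sum>\<nu>\<in>matrix_spectrum (cmat J). diag_part J \<nu> u) $ i = u $ i" .
qed

lemma eig_component_eq: "eig_component J \<mu> u = diag_part J \<mu> u"
proof -
  let ?P = "\<lambda>w. (\<forall>\<nu>\<in>matrix_spectrum (cmat J). w \<nu> \<in> gen_eigenspace J \<nu>) \<and>
     (\<forall>\<nu>. \<nu> \<notin> matrix_spectrum (cmat J) \<longrightarrow> w \<nu> = 0) \<and> (\<Sum>\<nu>\<in>matrix_spectrum (cmat J). w \<nu>) = u"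
  have "(THE w. ?P w) = (\<lambda>\<nu>. diag_part J \<nu> u)"
  proof (rule the_equality)
    show "?P (\<lambda>\<nu>. diag_part J \<nu> u)"
    proof (intro conjI ballI allI impI)
      fix \<nu> assume "\<nu> \<notin> matrix_spectrum (cmat J)"
      then have "complex_of_real (J $ i $ i) \<noteq> \<nu>" for i by (auto simp: spectrum_eq)
      then show "diag_part J \<nu> u = 0" by (simp add: diag_part_def vec_eq_iff)
    qed (simp_all add: sum_diag_part gen_eigenspace_eq diag_part_idem)
    fix w assume w: "?P w"
    have supp: "w \<nu> $ i = 0" if "complex_of_real (J $ i $ i) \<noteq> \<nu>" for \<nu> i
      using w that by (cases "\<nu> \<in> matrix_spectrum (cmat J)") (auto simp: gen_eigenspace_eq diag_part_fixed_iff)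
    have "w \<nu> $ i = u $ i" if "complex_of_real (J $ i $ i) = \<nu>" for \<nu> i
    proof -
      have "u = (\<Sum>\<nu>\<in>matrix_spectrum (cmat J). w \<nu>)" using w by simp
      then have "u $ i = (\<Sum>\<nu>\<in>matrix_spectrum (cmat J). w \<nu> $ i)" by (simp add: sum_component)
      also have "\<dots> = (\<Sum>\<nu>'\<in>matrix_spectrum (cmat J). if \<nu>' = \<nu> then w \<nu> $ i else 0)"
      proof (intro sum.cong refl)
        fix \<nu>' show "w \<nu>' $ i = (if \<nu>' = \<nu> then w \<nu> $ i else 0)"
          using supp[of i \<nu>'] that by auto
      qed
      also have "\<dots> = w \<nu> $ i" using that by (simp add: finite_spectrum) (auto simp: spectrum_eq)
      finally show ?thesis ..
    qed
    with supp show "w = (\<lambda>\<nu>. diag_part J \<nu> u)" by (auto simp: fun_eq_iff vec_eq_iff diag_part_def)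
  qed
  then show ?thesis by (simp add: eig_component_def)
qed

text \<open>Allows the sums over \<open>j\<close> below the nilpotency index, which varies with \<open>\<mu>\<close>, to be enlarged to the
common range \<open>j \<le> depth\<close>.\<close>

lemma nil_index_le: "nil_index J \<mu> \<le> Suc depth"
  unfolding nil_index_def
proof (rule Least_le, intro ballI)
  fix u assume "u \<in> gen_eigenspace J \<mu>"
  then show "matpow (nil_map J \<mu>) (Suc depth) *v u = 0"
    using nilpotent[of \<mu> u] by (simp add: gen_eigenspace_eq)
qed

end

lemma linear_vector_smult: "linear (\<lambda>a. a *s w)" for w :: "complex^'n"
  by (rule linearI) (simp_all add: vec_eq_iff distrib_right)

lemma binomial_exp_sums:
  fixes c \<mu> :: complex
  shows "(\<lambda>k. (c ^ k / fact k) * (of_nat (k choose j) * \<mu> ^ (k - j))) sums (c ^ j / fact j * exp (c * \<mu>))"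
proof -
  let ?f = "\<lambda>k. (c ^ k / fact k) * (of_nat (k choose j) * \<mu> ^ (k - j))"
  have "(\<lambda>k. (c * \<mu>) ^ k /\<^sub>R fact k) sums exp (c * \<mu>)" by (rule exp_converges)
  then have "(\<lambda>k. c ^ j / fact j * ((c * \<mu>) ^ k /\<^sub>R fact k)) sums (c ^ j / fact j * exp (c * \<mu>))"
    by (rule sums_mult)
  moreover have "c ^ j / fact j * ((c * \<mu>) ^ k /\<^sub>R fact k) = ?f (k + j)" for k
    by (simp add: binomial_fact[of j "k + j"] power_add power_mult_distrib scaleR_conv_of_real divide_simps)
  ultimately have "(\<lambda>k. ?f (k + j)) sums (c ^ j / fact j * exp (c * \<mu>))" by simp
  then have "?f sums (c ^ j / fact j * exp (c * \<mu>) + (\<Sum>i<j. ?f i))" by (rule sums_iff_shift[THEN iffD1])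
  moreover have "(\<Sum>i<j. ?f i) = 0" by (intro sum.neutral) (auto simp: binomial_eq_0)
  ultimately show ?thesis by simp
qed

text \<open>The binomial theorem for \<open>J = \<mu> + (J - \<mu>)\<close>, truncated by nilpotency.\<close>

lemma matpow_nilpotent_expand:
  assumes nil: "matpow (nil_map J \<mu>) (Suc d) *v v = 0"
  shows "matpow (cmat J) k *v v = (\<Sum>j\<le>d. (of_nat (k choose j) * \<mu> ^ (k - j)) *s (matpow (nil_map J \<mu>) j *v v))"
proof (induction k)
  case 0
  have "(\<Sum>j\<le>d. (of_nat (0 choose j) * \<mu> ^ (0 - j)) *s (matpow (nil_map J \<mu>) j *v v)) = (\<Sum>j\<le>d. if j = 0 then v else 0)"
    by (intro sum.cong) (auto simp: binomial_eq_0)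
  then show ?case by simp
next
  case (Suc k)
  define g where "g j k = of_nat (k choose j) * \<mu> ^ (k - j)" for j k
  define N where "N j = matpow (nil_map J \<mu>) j *v v" for j
  have NS: "nil_map J \<mu> *v N j = N (Suc j)" for j by (simp add: N_def matrix_vector_mul_assoc)
  have g: "g (Suc j) (Suc k) = \<mu> * g (Suc j) k + g j k" for j
  proof (cases "Suc j \<le> k")
    case True
    then have "k - j = Suc (k - Suc j)" by simp
    then show ?thesis by (simp add: g_def algebra_simps)
  qed (auto simp: g_def binomial_eq_0)
  have ext: "(\<Sum>j\<le>d. h j *s N j) = h 0 *s N 0 + (\<Sum>j\<le>d. h (Suc j) *s N (Suc j))" for h
    using nil sum.atMost_Suc_shift[of "\<lambda>j. h j *s N j" d] by (simp add: N_def)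
  have IH: "matpow (cmat J) k *v v = (\<Sum>j\<le>d. g j k *s N j)" using Suc.IH by (simp add: g_def N_def)
  have "matpow (cmat J) (Suc k) *v v = \<mu> *s (\<Sum>j\<le>d. g j k *s N j) + nil_map J \<mu> *v (\<Sum>j\<le>d. g j k *s N j)"
    by (simp add: nil_map_mult IH flip: matrix_vector_mul_assoc)
  also have "\<dots> = (\<Sum>j\<le>d. (\<mu> * g j k) *s N j) + (\<Sum>j\<le>d. g j k *s N (Suc j))"
    by (simp add: linear_sum[OF linear_cmatrix_mult] vector_scalar_commute NS vec.scale_sum_right
        vector_smult_assoc)
  also have "\<dots> = (\<mu> * g 0 k) *s N 0 + (\<Sum>j\<le>d. g (Suc j) (Suc k) *s N (Suc j))"
    unfolding ext[of "\<lambda>j. \<mu> * g j k"] g by (simp add: vector_sadd_rdistrib sum.distrib)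
  also have "\<dots> = (\<Sum>j\<le>d. g j (Suc k) *s N j)"
    unfolding ext[of "\<lambda>j. g j (Suc k)"] by (simp add: g_def)
  finally show ?case by (simp add: g_def N_def)
qed

lemma propagator_nilpotent:
  assumes nil: "matpow (nil_map J \<mu>) (Suc d) *v v = 0"
  shows "mexp (mat c ** cmat J) *v v = exp (c * \<mu>) *s (\<Sum>j\<le>d. (c ^ j / fact j) *s (matpow (nil_map J \<mu>) j *v v))"
proof -
  have "(\<lambda>k. \<Sum>j\<le>d. ((c ^ k / fact k) * (of_nat (k choose j) * \<mu> ^ (k - j))) *s (matpow (nil_map J \<mu>) j *v v))
      sums (\<Sum>j\<le>d. (c ^ j / fact j * exp (c * \<mu>)) *s (matpow (nil_map J \<mu>) j *v v))"
    by (intro sums_sum bounded_linear.sums[OF linear_linear[THEN iffD2, OF linear_vector_smult]] binomial_exp_sums)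
  moreover have "(\<Sum>j\<le>d. ((c ^ k / fact k) * (of_nat (k choose j) * \<mu> ^ (k - j))) *s (matpow (nil_map J \<mu>) j *v v))
      = (c ^ k / fact k) *s (matpow (cmat J) k *v v)" for k
    unfolding matpow_nilpotent_expand[OF nil] by (simp add: vec.scale_sum_right vector_smult_assoc)
  ultimately have "(\<lambda>k. (c ^ k / fact k) *s (matpow (cmat J) k *v v))
      sums (\<Sum>j\<le>d. (c ^ j / fact j * exp (c * \<mu>)) *s (matpow (nil_map J \<mu>) j *v v))" by simp
  from sums_unique2[OF propagator_sums this] show ?thesis
    by (simp add: vec.scale_sum_right vector_smult_assoc mult.commute)
qed

lemma propagator_similar:
  fixes M :: "complex^'n^'n"
  assumes M: "M = S ** J ** S'" and inv: "S' ** S = mat 1" "S ** S' = mat 1"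
  shows "mexp (mat c ** M) *v z = S *v (mexp (mat c ** J) *v (S' *v z))"
proof -
  have pow: "matpow M k *v z = S *v (matpow J k *v (S' *v z))" for k
  proof (induction k)
    case 0
    then show ?case using inv by (simp add: matrix_vector_mul_assoc)
  next
    case (Suc k)
    have "matpow M (Suc k) *v z = M *v (S *v (matpow J k *v (S' *v z)))"
      by (simp add: Suc.IH flip: matrix_vector_mul_assoc)
    also have "\<dots> = S *v (J *v ((S' ** S) *v (matpow J k *v (S' *v z))))"
      unfolding M by (simp add: matrix_vector_mul_assoc matrix_mul_assoc)
    finally show ?case unfolding inv by (simp flip: matrix_vector_mul_assoc)
  qed
  have "(\<lambda>k. S *v ((c ^ k / fact k) *s (matpow J k *v (S' *v z)))) sums (S *v (mexp (mat c ** J) *v (S' *v z)))"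
    by (intro bounded_linear.sums[OF linear_linear[THEN iffD2, OF linear_cmatrix_mult]] propagator_sums)
  then have "(\<lambda>k. (c ^ k / fact k) *s (matpow M k *v z)) sums (S *v (mexp (mat c ** J) *v (S' *v z)))"
    by (simp add: pow vector_scalar_commute)
  from sums_unique2[OF propagator_sums this] show ?thesis .
qed

lemma linear_jordan_coeff:
  assumes "is_jordan J"
  shows "linear (\<lambda>z. jordan_coeff B S J \<mu> j (M *v z))"
proof -
  obtain e where "triangular_blocks J e" using is_jordan_triangular_blocks[OF assms] by blast
  then interpret triangular_blocks J e .
  have lin: "linear (\<lambda>z. (1 / fact j) *\<^sub>R (cmat (transpose B ** S) *v
        (matpow (nil_map J \<mu>) j *v diag_part J \<mu> (M *v z))))"
    by (intro linear_compose_scale_right linear_compose[OF _ linear_cmatrix_mult, unfolded o_def]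
        linear_compose[OF _ linear_diag_part, unfolded o_def] linear_cmatrix_mult)
  show ?thesis unfolding jordan_coeff_def eig_component_eq by (rule lin)
qed

lemma norm_sq_vec: "(norm v)\<^sup>2 = (\<Sum>i\<in>UNIV. (norm (v $ i))\<^sup>2)" for v :: "complex^'m"
  by (simp add: norm_vec_def L2_set_def sum_nonneg)

text \<open>The Jordan norm with a single range of \<open>j\<close> for all eigenvalues, as it arises from the exponential
polynomial in \<open>observed_expand\<close>.\<close>

definition full_jordan_normsq ::
  "real^'m^'n \<Rightarrow> real^'n^'n \<Rightarrow> real^'n^'n \<Rightarrow> nat \<Rightarrow> real \<Rightarrow> complex^'n \<Rightarrow> real" where
  "full_jordan_normsq B S J d \<xi> z = (\<Sum>\<mu>\<in>matrix_spectrum (cmat J). \<Sum>j\<le>d.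
     (\<bar>\<xi>\<bar> ^ j * norm (jordan_coeff B S J \<mu> j (cmat (matrix_inv S) *v z)))\<^sup>2)"

context triangular_blocks
begin

text \<open>The left-hand side sums over the spectrum of \<open>A\<close>.  Eigenvalues outside the spectrum of \<open>J\<close> contribute
nothing, because the corresponding component of every vector vanishes.\<close>

lemma jordan_normsq_le_full: "jordan_normsq A B S J \<xi> z \<le> full_jordan_normsq B S J depth \<xi> z"
proof -
  define t where "t \<mu> j = (\<bar>\<xi>\<bar> ^ j * norm (jordan_coeff B S J \<mu> j (cmat (matrix_inv S) *v z)))\<^sup>2" for \<mu> j
  define s where "s \<mu> = (\<Sum>j<nil_index J \<mu>. t \<mu> j)" for \<mu>
  have t: "t \<mu> j \<ge> 0" for \<mu> j by (simp add: t_def)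
  have s: "s \<mu> \<ge> 0" for \<mu> unfolding s_def by (intro sum_nonneg t)
  have "s \<mu> = 0" if "\<mu> \<notin> matrix_spectrum (cmat J)" for \<mu>
  proof -
    have "diag_part J \<mu> u = 0" for u
      using that by (auto simp: spectrum_eq diag_part_def vec_eq_iff)
    then have "t \<mu> j = 0" for j
      by (simp add: t_def jordan_coeff_def eig_component_eq linear_0[OF linear_cmatrix_mult])
    then show ?thesis by (simp add: s_def)
  qed
  then have "sum s X \<le> sum s (matrix_spectrum (cmat J))" for X
  proof (cases "finite X")
    case True
    have "sum s X = sum s (X \<inter> matrix_spectrum (cmat J))"
      using \<open>\<And>\<mu>. \<mu> \<notin> matrix_spectrum (cmat J) \<Longrightarrow> s \<mu> = 0\<close> True by (intro sum.mono_neutral_right) auto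
    also have "\<dots> \<le> sum s (matrix_spectrum (cmat J))" by (intro sum_mono2 finite_spectrum s) auto
    finally show ?thesis .
  qed (simp add: s sum_nonneg)
  moreover have "jordan_normsq A B S J \<xi> z = sum s (matrix_spectrum (cmat A))"
    by (simp add: jordan_normsq_def s_def t_def power_mult_distrib power_mult power_even_eq flip: power_mult)
  ultimately have "jordan_normsq A B S J \<xi> z \<le> sum s (matrix_spectrum (cmat J))" by simp
  also have "\<dots> \<le> full_jordan_normsq B S J depth \<xi> z"
    unfolding full_jordan_normsq_def t_def[symmetric] s_def
  proof (intro sum_mono sum_mono2 t)
    show "{..<nil_index J \<mu>} \<subseteq> {..depth}" for \<mu> using nil_index_le[of \<mu>] by auto
  qed auto
  finally show ?thesis .
qed

text \<open>In Jordan coordinates the observation is an exponential polynomial in \<open>\<tau>\<close> whose coefficients are the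
Jordan coefficients of the datum.\<close>

lemma observed_expand:
  assumes S: "invertible S" and A: "transpose A = S ** J ** matrix_inv S"
  shows "observed A B \<tau> z = (\<Sum>\<mu>\<in>matrix_spectrum (cmat J). exp (\<i> * of_real \<tau> * \<mu>) *s
    (\<Sum>j\<le>depth. (\<i> * of_real \<tau>) ^ j *s jordan_coeff B S J \<mu> j (cmat (matrix_inv S) *v z)))"
proof -
  define u where "u = cmat (matrix_inv S) *v z"
  define c where "c = \<i> * complex_of_real \<tau>"
  have "S ** matrix_inv S = mat 1 \<and> matrix_inv S ** S = mat 1"
    using S unfolding invertible_def matrix_inv_def by (rule someI_ex)
  then have inv: "cmat (matrix_inv S) ** cmat S = mat 1" "cmat S ** cmat (matrix_inv S) = mat 1"
    by (simp_all add: cmat_mat_1 flip: cmat_mult)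
  have "mexp (mat c ** cmat (transpose A)) *v z = cmat S *v (mexp (mat c ** cmat J) *v u)"
    unfolding u_def by (rule propagator_similar[OF _ inv]) (simp add: A cmat_mult)
  also have "mexp (mat c ** cmat J) *v u
      = (\<Sum>\<mu>\<in>matrix_spectrum (cmat J). mexp (mat c ** cmat J) *v diag_part J \<mu> u)"
    by (subst sum_diag_part[of u, symmetric]) (simp only: linear_sum[OF linear_cmatrix_mult])
  also have "\<dots> = (\<Sum>\<mu>\<in>matrix_spectrum (cmat J). exp (c * \<mu>) *s
      (\<Sum>j\<le>depth. (c ^ j / fact j) *s (matpow (nil_map J \<mu>) j *v diag_part J \<mu> u)))"
    by (intro sum.cong refl propagator_nilpotent nilpotent)
  finally have "observed A B \<tau> z = cmat (transpose B) *v (cmat S *v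
      (\<Sum>\<mu>\<in>matrix_spectrum (cmat J). exp (c * \<mu>) *s
      (\<Sum>j\<le>depth. (c ^ j / fact j) *s (matpow (nil_map J \<mu>) j *v diag_part J \<mu> u))))"
    unfolding observed_def c_def by simp
  also have "\<dots> = (\<Sum>\<mu>\<in>matrix_spectrum (cmat J). exp (c * \<mu>) *s
      (\<Sum>j\<le>depth. (c ^ j / fact j) *s (cmat (transpose B ** S) *v (matpow (nil_map J \<mu>) j *v diag_part J \<mu> u))))"
    by (simp add: linear_sum[OF linear_cmatrix_mult] vector_scalar_commute matrix_vector_mul_assoc matrix_mul_assoc cmat_mult)
  also have "\<dots> = (\<Sum>\<mu>\<in>matrix_spectrum (cmat J). exp (c * \<mu>) *s
      (\<Sum>j\<le>depth. c ^ j *s jordan_coeff B S J \<mu> j u))"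
    unfolding jordan_coeff_def eig_component_eq
    by (simp add: scaleR_vec_eq vector_smult_assoc divide_inverse)
  finally show ?thesis unfolding c_def u_def .
qed

text \<open>The scalar estimate for exponential polynomials, applied to every component of the observation.
The eigenvalues are the diagonal entries of a real matrix, so the exponentials are purely
oscillatory.\<close>

lemma high_frequency_estimate:
  assumes S: "invertible S" and A: "transpose A = S ** J ** matrix_inv S" and T: "T > 0"
  shows "\<exists>C>0. \<exists>M>0. \<forall>\<xi> z. M \<le> \<bar>\<xi>\<bar> \<longrightarrow>
    full_jordan_normsq B S J depth \<xi> z \<le> C * observed_energy A B T \<xi> z"
proof -
  define \<Lambda> where "\<Lambda> = range (\<lambda>i. J $ i $ i)"
  have \<Lambda>: "finite \<Lambda>" by (simp add: \<Lambda>_def)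
  have spec: "(\<Sum>\<mu>\<in>matrix_spectrum (cmat J). f \<mu>) = (\<Sum>\<nu>\<in>\<Lambda>. f (complex_of_real \<nu>))" for f :: "complex \<Rightarrow> 'x::comm_monoid_add"
  proof -
    have "matrix_spectrum (cmat J) = complex_of_real ` \<Lambda>" by (auto simp: spectrum_eq \<Lambda>_def)
    then show ?thesis by (simp add: sum.reindex inj_on_def)
  qed
  obtain C M where C: "C > 0" and M: "M > 0" and est: "\<And>\<xi> (b :: real \<Rightarrow> nat \<Rightarrow> complex). M \<le> \<bar>\<xi>\<bar> \<Longrightarrow>
    (\<Sum>\<nu>\<in>\<Lambda>. \<Sum>j\<le>depth. (norm (b \<nu> j))\<^sup>2) \<le> C * integral {0..T}
      (\<lambda>s. (norm (\<Sum>\<nu>\<in>\<Lambda>. cis (\<xi> * \<nu> * s) * (\<Sum>j\<le>depth. s ^ j *\<^sub>R b \<nu> j)))\<^sup>2)"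
    using exponential_polynomial_coeffs_le_integral[OF \<Lambda> T, of depth] by blast
  have "full_jordan_normsq B S J depth \<xi> z \<le> C * observed_energy A B T \<xi> z" if \<xi>: "M \<le> \<bar>\<xi>\<bar>" for \<xi> z
  proof -
    define a where "a \<nu> j = jordan_coeff B S J (complex_of_real \<nu>) j (cmat (matrix_inv S) *v z)" for \<nu> j
    define b where "b i \<nu> j = (\<i> * complex_of_real \<xi>) ^ j * a \<nu> j $ i" for i \<nu> j
    define F where "F i s = (\<Sum>\<nu>\<in>\<Lambda>. cis (\<xi> * \<nu> * s) * (\<Sum>j\<le>depth. s ^ j *\<^sub>R b i \<nu> j))" for i s
    have F: "observed A B (\<xi> * s) z $ i = F i s" for s i
      unfolding observed_expand[OF S A] spec F_def a_def[symmetric]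
      by (simp add: sum_component cis_conv_exp b_def scaleR_conv_of_real power_mult_distrib mult_ac)
    have contF: "continuous_on X (F i)" for X i unfolding F_def by (intro continuous_intros)
    have "full_jordan_normsq B S J depth \<xi> z = (\<Sum>\<nu>\<in>\<Lambda>. \<Sum>j\<le>depth. (\<bar>\<xi>\<bar> ^ j * norm (a \<nu> j))\<^sup>2)"
      unfolding full_jordan_normsq_def spec a_def ..
    also have "\<dots> = (\<Sum>\<nu>\<in>\<Lambda>. \<Sum>j\<le>depth. \<Sum>i\<in>UNIV. (norm (b i \<nu> j))\<^sup>2)"
      by (simp add: power_mult_distrib norm_sq_vec[of "a _ _"] sum_distrib_left b_def norm_mult norm_power)
    also have "\<dots> = (\<Sum>i\<in>UNIV. \<Sum>\<nu>\<in>\<Lambda>. \<Sum>j\<le>depth. (norm (b i \<nu> j))\<^sup>2)"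
      by (simp add: sum.swap[of _ UNIV "{..depth}"] sum.swap[of _ UNIV \<Lambda>])
    also have "\<dots> \<le> (\<Sum>i\<in>UNIV. C * integral {0..T} (\<lambda>s. (norm (F i s))\<^sup>2))"
      unfolding F_def by (intro sum_mono est \<xi>)
    also have "\<dots> = C * integral {0..T} (\<lambda>s. \<Sum>i\<in>UNIV. (norm (F i s))\<^sup>2)"
      unfolding sum_distrib_left[symmetric]
      by (subst Henstock_Kurzweil_Integration.integral_sum)
        (auto intro!: integrable_continuous_real continuous_intros contF)
    also have "\<dots> = C * observed_energy A B T \<xi> z"
      unfolding observed_energy_def norm_sq_vec[of "observed A B _ z"] F ..
    finally show ?thesis .
  qed
  with C M show ?thesis by blast
qed

end

section \<open>Observability at a fixed frequency\<close>

text \<open>The integrand of the squared norm of the Jordan-adapted space at frequency \<open>\<xi>\<close>.\<close>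

definition Y_density ::
  "real^'n^'n \<Rightarrow> real^'m^'n \<Rightarrow> nat \<Rightarrow> real^'n^'n \<Rightarrow> real^'n^'n \<Rightarrow> real \<Rightarrow> real \<Rightarrow> real \<Rightarrow> complex^'n \<Rightarrow> real" where
  "Y_density A B K S J \<xi>0 \<xi>1 \<xi> z =
    (if \<bar>\<xi>\<bar> \<le> \<xi>0 then \<Sum>k\<le>K. \<bar>\<xi>\<bar> ^ (2 * k) * (norm (layer_proj A B k z))\<^sup>2
     else if \<bar>\<xi>\<bar> < \<xi>1 then (norm z)\<^sup>2 else jordan_normsq A B S J \<xi> z)"

text \<open>Let \<open>Q \<xi> z\<close> be the weighted sum of squares of the Kalman maps, which the energy controls for
\<open>\<bar>\<xi>\<bar> \<le> R\<close>.  It dominates the layer norm for \<open>\<bar>\<xi>\<bar> \<le> 1\<close> and \<open>\<bar>z\<bar>\<^sup>2\<close> for \<open>\<bar>\<xi>\<bar> \<ge> \<xi>0\<close>.  Taking \<open>R\<close> beyond the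
point where the high-frequency estimate starts, the Jordan norm on the remaining range
\<open>\<xi>1 \<le> \<bar>\<xi>\<bar> \<le> R\<close> is controlled through \<open>\<bar>z\<bar>\<^sup>2\<close>.\<close>

lemma frequency_observability:
  fixes A :: "real^'n^'n" and B :: "real^'m^'n"
  assumes full: "kalman_full A B K" and T: "T > 0"
    and dec: "jordan_decomposition (transpose A) S J"
    and \<xi>0: "0 < \<xi>0" "\<xi>0 \<le> 1" "\<xi>0 < \<xi>1"
  shows "\<exists>C>0. \<forall>\<xi> z. Y_density A B K S J \<xi>0 \<xi>1 \<xi> z \<le> C * observed_energy A B T \<xi> z"
proof -
  have S: "invertible S" and A: "transpose A = S ** J ** matrix_inv S" and J: "is_jordan J"
    using dec by (auto simp: jordan_decomposition_def)
  obtain e where "triangular_blocks J e" using is_jordan_triangular_blocks[OF J] by blast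
  then interpret triangular_blocks J e .
  obtain C0 where C0: "C0 > 0" and obs: "\<And>z. (norm z)\<^sup>2 \<le> C0 * (\<Sum>j\<le>K. (norm (kalman_map A B j z))\<^sup>2)"
    using kalman_observability[OF full] by blast
  obtain c where c: "\<And>k. c k > 0" and layer: "\<And>k z. (norm (layer_proj A B k z))\<^sup>2 \<le> c k * (\<Sum>j\<le>k. (norm (kalman_map A B j z))\<^sup>2)"
    using layer_proj_bound[of A B] by metis
  obtain Ch M where Ch: "Ch > 0" and M: "M > 0" and high: "\<And>\<xi> z. M \<le> \<bar>\<xi>\<bar> \<Longrightarrow>
    full_jordan_normsq B S J depth \<xi> z \<le> Ch * observed_energy A B T \<xi> z"
    using high_frequency_estimate[OF S A T] by blast
  define R where "R = max M (max \<xi>1 1)"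
  have R: "R > 0" "M \<le> R" "\<xi>1 \<le> R" "1 \<le> R" by (auto simp: R_def)
  define Q where "Q \<xi> z = (\<Sum>j\<le>K. (\<bar>\<xi>\<bar> ^ j * norm (kalman_map A B j z))\<^sup>2)" for \<xi> z
  obtain Cb where Cb: "Cb > 0" and low: "\<And>\<xi> z. \<bar>\<xi>\<bar> \<le> R \<Longrightarrow> Q \<xi> z \<le> Cb * observed_energy A B T \<xi> z"
    unfolding Q_def using bounded_frequency_estimate[OF obs C0 T R(1)] by blast
  have en: "observed_energy A B T \<xi> z \<ge> 0" for \<xi> z unfolding observed_energy_def
    by (intro Henstock_Kurzweil_Integration.integral_nonneg integrable_continuous_real continuous_intros
        continuous_on_observed) auto
  define C1 where "C1 = (\<Sum>k\<le>K. c k)"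
  have C1: "C1 \<ge> 0" unfolding C1_def using c by (intro sum_nonneg) (auto intro: less_imp_le)
  have lowQ: "(\<Sum>k\<le>K. \<bar>\<xi>\<bar> ^ (2 * k) * (norm (layer_proj A B k z))\<^sup>2) \<le> C1 * Q \<xi> z" if \<xi>: "\<bar>\<xi>\<bar> \<le> 1" for \<xi> z
    unfolding C1_def sum_distrib_right
  proof (rule sum_mono)
    fix k assume k: "k \<in> {..K}"
    have "\<bar>\<xi>\<bar> ^ (2 * k) * (norm (layer_proj A B k z))\<^sup>2 \<le> \<bar>\<xi>\<bar> ^ (2 * k) * (c k * (\<Sum>j\<le>k. (norm (kalman_map A B j z))\<^sup>2))"
      by (intro mult_left_mono layer) auto
    also have "\<dots> = c k * (\<Sum>j\<le>k. \<bar>\<xi>\<bar> ^ (2 * k) * (norm (kalman_map A B j z))\<^sup>2)"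
      by (simp add: sum_distrib_left mult_ac)
    also have "\<dots> \<le> c k * (\<Sum>j\<le>k. \<bar>\<xi>\<bar> ^ (2 * j) * (norm (kalman_map A B j z))\<^sup>2)"
      using \<xi> c[of k] by (intro mult_left_mono sum_mono mult_right_mono power_decreasing) auto
    also have "\<dots> \<le> c k * (\<Sum>j\<le>K. \<bar>\<xi>\<bar> ^ (2 * j) * (norm (kalman_map A B j z))\<^sup>2)"
      using c[of k] k by (intro mult_left_mono sum_mono2) auto
    also have "\<dots> = c k * Q \<xi> z"
      by (simp add: Q_def power_mult_distrib power_even_eq)
    finally show "\<bar>\<xi>\<bar> ^ (2 * k) * (norm (layer_proj A B k z))\<^sup>2 \<le> c k * Q \<xi> z" .
  qed
  define C2 where "C2 = C0 / (\<xi>0 ^ K)\<^sup>2"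
  have C2: "C2 > 0" unfolding C2_def using C0 \<xi>0 by simp
  have midQ: "(norm z)\<^sup>2 \<le> C2 * Q \<xi> z" if \<xi>: "\<xi>0 \<le> \<bar>\<xi>\<bar>" for \<xi> z
  proof -
    have "(\<xi>0 ^ K)\<^sup>2 * (\<Sum>j\<le>K. (norm (kalman_map A B j z))\<^sup>2) = (\<Sum>j\<le>K. (\<xi>0 ^ K * norm (kalman_map A B j z))\<^sup>2)"
      by (simp add: sum_distrib_left power_mult_distrib)
    also have "\<dots> \<le> Q \<xi> z" unfolding Q_def
    proof (intro sum_mono power_mono mult_right_mono)
      fix j assume "j \<in> {..K}"
      then have "\<xi>0 ^ K \<le> \<xi>0 ^ j" using \<xi>0 by (intro power_decreasing) auto
      also have "\<dots> \<le> \<bar>\<xi>\<bar> ^ j" using \<xi> \<xi>0 by (intro power_mono) auto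
      finally show "\<xi>0 ^ K \<le> \<bar>\<xi>\<bar> ^ j" .
    qed (use \<xi>0 in auto)
    finally have "(\<Sum>j\<le>K. (norm (kalman_map A B j z))\<^sup>2) \<le> Q \<xi> z / (\<xi>0 ^ K)\<^sup>2"
      using \<xi>0 by (simp add: field_simps)
    then have "C0 * (\<Sum>j\<le>K. (norm (kalman_map A B j z))\<^sup>2) \<le> C0 * (Q \<xi> z / (\<xi>0 ^ K)\<^sup>2)"
      using C0 by (intro mult_left_mono) auto
    with obs[of z] show ?thesis by (simp add: C2_def)
  qed
  obtain c' where c': "\<And>\<mu> j z. norm (jordan_coeff B S J \<mu> j (cmat (matrix_inv S) *v z)) \<le> c' \<mu> j * norm z"
    using linear_bounded[OF linear_jordan_coeff[OF J]] by metis
  define C3 where "C3 = (\<Sum>\<mu>\<in>matrix_spectrum (cmat J). \<Sum>j\<le>depth. (R ^ j * c' \<mu> j)\<^sup>2)"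
  have C3: "C3 \<ge> 0" unfolding C3_def by (intro sum_nonneg) auto
  have gap: "full_jordan_normsq B S J depth \<xi> z \<le> C3 * (norm z)\<^sup>2" if \<xi>: "\<bar>\<xi>\<bar> \<le> R" for \<xi> z
    unfolding full_jordan_normsq_def C3_def sum_distrib_right
  proof (intro sum_mono)
    fix \<mu> j
    have "\<bar>\<xi>\<bar> ^ j * norm (jordan_coeff B S J \<mu> j (cmat (matrix_inv S) *v z)) \<le> R ^ j * (c' \<mu> j * norm z)"
      using \<xi> R by (intro mult_mono power_mono c') auto
    then have "(\<bar>\<xi>\<bar> ^ j * norm (jordan_coeff B S J \<mu> j (cmat (matrix_inv S) *v z)))\<^sup>2 \<le> (R ^ j * (c' \<mu> j * norm z))\<^sup>2"
      by (intro power_mono) auto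
    then show "(\<bar>\<xi>\<bar> ^ j * norm (jordan_coeff B S J \<mu> j (cmat (matrix_inv S) *v z)))\<^sup>2 \<le> (R ^ j * c' \<mu> j)\<^sup>2 * (norm z)\<^sup>2"
      by (simp add: power_mult_distrib mult.assoc)
  qed
  define C where "C = C1 * Cb + C2 * Cb + Ch + C3 * (C2 * Cb)"
  have le: "C1 * Cb \<le> C" "C2 * Cb \<le> C" "Ch \<le> C" "C3 * (C2 * Cb) \<le> C"
    using C1 C2 C3 Cb Ch by (simp_all add: C_def)
  have mid: "(norm z)\<^sup>2 \<le> C2 * Cb * observed_energy A B T \<xi> z" if "\<xi>0 \<le> \<bar>\<xi>\<bar>" "\<bar>\<xi>\<bar> \<le> R" for \<xi> z
    using order_trans[OF midQ[OF that(1), of z] mult_left_mono[OF low[OF that(2)]]] C2 by (simp add: mult.assoc)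
  have up: "x \<le> C * observed_energy A B T \<xi> z" if "x \<le> c * observed_energy A B T \<xi> z" "c \<le> C" for x c \<xi> z
    using order_trans[OF that(1) mult_right_mono[OF that(2) en]] .
  have "Y_density A B K S J \<xi>0 \<xi>1 \<xi> z \<le> C * observed_energy A B T \<xi> z" for \<xi> z
  proof -
    consider "\<bar>\<xi>\<bar> \<le> \<xi>0" | "\<xi>0 < \<bar>\<xi>\<bar>" "\<bar>\<xi>\<bar> < \<xi>1" | "\<xi>1 \<le> \<bar>\<xi>\<bar>" "\<bar>\<xi>\<bar> \<le> R" | "\<xi>1 \<le> \<bar>\<xi>\<bar>" "R < \<bar>\<xi>\<bar>" by linarith
    then show ?thesis
    proof cases
      case 1
      have "Y_density A B K S J \<xi>0 \<xi>1 \<xi> z \<le> C1 * Q \<xi> z"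
        using lowQ[of \<xi> z] 1 \<xi>0 by (simp add: Y_density_def)
      also have "\<dots> \<le> C1 * (Cb * observed_energy A B T \<xi> z)" using 1 \<xi>0 R C1 by (intro mult_left_mono low) auto
      finally show ?thesis by (intro up[OF _ le(1)]) (simp add: mult.assoc)
    next
      case 2
      then show ?thesis using up[OF mid le(2), of \<xi> z] R by (simp add: Y_density_def)
    next
      case 3
      have "Y_density A B K S J \<xi>0 \<xi>1 \<xi> z \<le> full_jordan_normsq B S J depth \<xi> z"
        using jordan_normsq_le_full 3 \<xi>0 by (simp add: Y_density_def)
      also have "\<dots> \<le> C3 * (norm z)\<^sup>2" by (rule gap[OF 3(2)])
      also have "\<dots> \<le> C3 * (C2 * Cb * observed_energy A B T \<xi> z)" using 3 \<xi>0 C3 by (intro mult_left_mono mid) auto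
      finally show ?thesis by (intro up[OF _ le(4)]) (simp add: mult.assoc)
    next
      case 4
      have "Y_density A B K S J \<xi>0 \<xi>1 \<xi> z \<le> full_jordan_normsq B S J depth \<xi> z"
        using jordan_normsq_le_full 4 \<xi>0 by (simp add: Y_density_def)
      also have "\<dots> \<le> Ch * observed_energy A B T \<xi> z" using 4 R by (intro high) auto
      finally show ?thesis by (intro up[OF _ le(3)])
    qed
  qed
  moreover have "C > 0" using le(3) Ch by linarith
  ultimately show ?thesis by blast
qed

section \<open>The Jordan-adapted norm as a weighted integral\<close>

lemma borel_measurable_vec_nth[measurable (raw)]:
  fixes f :: "'a \<Rightarrow> complex^'n"
  assumes "f \<in> borel_measurable M"
  shows "(\<lambda>x. f x $ i) \<in> borel_measurable M"
  using assms by (rule borel_measurable_continuous_on[rotated]) (intro continuous_intros)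

lemma borel_measurable_linear:
  fixes L :: "'a::euclidean_space \<Rightarrow> 'b::euclidean_space"
  assumes "linear L" "f \<in> borel_measurable M"
  shows "(\<lambda>x. L (f x)) \<in> borel_measurable M"
  using assms(2)
  by (rule borel_measurable_continuous_on[OF linear_continuous_on[OF linear_linear[THEN iffD2, OF assms(1)]]])

lemma linear_weighted_sq_diff_le:
  assumes "linear L" "c \<ge> 0"
  shows "c * (norm (L z))\<^sup>2 \<le> 2 * (c * (norm (L w))\<^sup>2) + 2 * (c * (norm (L (w - z)))\<^sup>2)"
proof -
  have "L z = L w - L (w - z)" using assms(1) by (simp add: linear_diff)
  then have "(norm (L z))\<^sup>2 \<le> 2 * (norm (L w))\<^sup>2 + 2 * (norm (L (w - z)))\<^sup>2"
    using norm_diff_sq_le[of "L w" "L (w - z)"] by simp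
  from mult_left_mono[OF this assms(2)] show ?thesis by (simp add: algebra_simps)
qed

text \<open>Needed to replace a datum by its Schwartz approximations: at each frequency the density is a
weighted sum of squared norms of linear images of \<open>z\<close>.\<close>

lemma Y_density_diff_le:
  assumes J: "is_jordan J"
  shows "Y_density A B K S J \<xi>0 \<xi>1 \<xi> z \<le> 2 * Y_density A B K S J \<xi>0 \<xi>1 \<xi> w + 2 * Y_density A B K S J \<xi>0 \<xi>1 \<xi> (w - z)"
proof -
  have 1: "(\<Sum>k\<le>K. \<bar>\<xi>\<bar> ^ (2 * k) * (norm (layer_proj A B k z))\<^sup>2)
      \<le> 2 * (\<Sum>k\<le>K. \<bar>\<xi>\<bar> ^ (2 * k) * (norm (layer_proj A B k w))\<^sup>2)
        + 2 * (\<Sum>k\<le>K. \<bar>\<xi>\<bar> ^ (2 * k) * (norm (layer_proj A B k (w - z)))\<^sup>2)"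
    unfolding sum_distrib_left sum.distrib[symmetric]
    by (intro sum_mono linear_weighted_sq_diff_le linear_layer_proj) simp
  have 2: "(norm z)\<^sup>2 \<le> 2 * (norm w)\<^sup>2 + 2 * (norm (w - z))\<^sup>2"
    using norm_diff_sq_le[of w "w - z"] by simp
  have 3: "jordan_normsq A B S J \<xi> z \<le> 2 * jordan_normsq A B S J \<xi> w + 2 * jordan_normsq A B S J \<xi> (w - z)"
    unfolding jordan_normsq_def sum_distrib_left sum.distrib[symmetric]
    by (intro sum_mono linear_weighted_sq_diff_le linear_jordan_coeff J) simp
  show ?thesis unfolding Y_density_def using 1 2 3 by simp
qed

lemma Y_density_nonneg: "Y_density A B K S J \<xi>0 \<xi>1 \<xi> z \<ge> 0"
  unfolding Y_density_def jordan_normsq_def by (simp add: sum_nonneg)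

lemma borel_measurable_jordan_normsq:
  assumes J: "is_jordan J" and h: "h \<in> borel_measurable borel"
  shows "(\<lambda>\<xi>. jordan_normsq A B S J \<xi> (h \<xi>)) \<in> borel_measurable borel"
proof -
  have [measurable]: "(\<lambda>\<xi>. jordan_coeff B S J \<mu> j (cmat (matrix_inv S) *v h \<xi>)) \<in> borel_measurable borel" for \<mu> j
    by (rule borel_measurable_linear[OF linear_jordan_coeff[OF J] h])
  show ?thesis unfolding jordan_normsq_def by measurable
qed

lemma borel_measurable_layer_normsq:
  assumes h: "h \<in> borel_measurable borel"
  shows "(\<lambda>\<xi>. \<Sum>k\<le>K. \<bar>\<xi>\<bar> ^ (2 * k) * (norm (layer_proj A B k (h \<xi>)))\<^sup>2) \<in> borel_measurable borel"
proof -
  have [measurable]: "(\<lambda>\<xi>. layer_proj A B k (h \<xi>)) \<in> borel_measurable borel" for k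
    by (rule borel_measurable_linear[OF linear_layer_proj h])
  show ?thesis by measurable
qed

lemma borel_measurable_Y_density:
  assumes J: "is_jordan J" and h[measurable]: "h \<in> borel_measurable borel"
  shows "(\<lambda>\<xi>. Y_density A B K S J \<xi>0 \<xi>1 \<xi> (h \<xi>)) \<in> borel_measurable borel"
proof -
  note [measurable] = borel_measurable_jordan_normsq[OF J h] borel_measurable_layer_normsq[OF h]
  show ?thesis unfolding Y_density_def by measurable
qed

lemma Y_normsq_eq_integral_density:
  assumes J: "is_jordan J" and h[measurable]: "h \<in> borel_measurable borel" and "\<xi>0 < \<xi>1"
  shows "Y_normsq A B K S J \<xi>0 \<xi>1 h = (\<integral>\<^sup>+\<xi>. ennreal (Y_density A B K S J \<xi>0 \<xi>1 \<xi> (h \<xi>)) \<partial>lborel)"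
proof -
  define a where "a \<xi> = ennreal (\<Sum>k\<le>K. \<bar>\<xi>\<bar> ^ (2 * k) * (norm (layer_proj A B k (h \<xi>)))\<^sup>2)" for \<xi>
  define b where "b \<xi> = ennreal (jordan_normsq A B S J \<xi> (h \<xi>))" for \<xi>
  have [measurable]: "a \<in> borel_measurable borel" "b \<in> borel_measurable borel"
    unfolding a_def b_def
    by (rule measurable_compose[OF borel_measurable_layer_normsq[OF h] measurable_ennreal]
        measurable_compose[OF borel_measurable_jordan_normsq[OF J h] measurable_ennreal])+
  let ?l = "\<lambda>\<xi>. a \<xi> * indicator {\<xi>. \<bar>\<xi>\<bar> \<le> \<xi>0} \<xi>"
  let ?m = "\<lambda>\<xi>. ennreal ((norm (h \<xi>))\<^sup>2) * indicator {\<xi>. \<xi>0 < \<bar>\<xi>\<bar> \<and> \<bar>\<xi>\<bar> < \<xi>1} \<xi>"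
  let ?h = "\<lambda>\<xi>. b \<xi> * indicator {\<xi>. \<bar>\<xi>\<bar> \<ge> \<xi>1} \<xi>"
  have "Y_normsq A B K S J \<xi>0 \<xi>1 h = (\<integral>\<^sup>+\<xi>. ?l \<xi> \<partial>lborel) + (\<integral>\<^sup>+\<xi>. ?m \<xi> \<partial>lborel) + (\<integral>\<^sup>+\<xi>. ?h \<xi> \<partial>lborel)"
    by (simp add: Y_normsq_def a_def b_def)
  also have "\<dots> = (\<integral>\<^sup>+\<xi>. ?l \<xi> + ?m \<xi> + ?h \<xi> \<partial>lborel)"
    by (simp add: nn_integral_add)
  also have "\<dots> = (\<integral>\<^sup>+\<xi>. ennreal (Y_density A B K S J \<xi>0 \<xi>1 \<xi> (h \<xi>)) \<partial>lborel)"
    \<comment> \<open>The three regions are disjoint and cover the line because \<open>\<xi>0 < \<xi>1\<close>.\<close>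
    using assms(3) by (intro nn_integral_cong) (auto simp: Y_density_def indicator_def a_def b_def)
  finally show ?thesis .
qed

lemma Y_normsq_triangle:
  assumes J: "is_jordan J" and h: "h \<in> borel_measurable borel" and k: "k \<in> borel_measurable borel" and lt: "\<xi>0 < \<xi>1"
  shows "Y_normsq A B K S J \<xi>0 \<xi>1 h \<le> 2 * Y_normsq A B K S J \<xi>0 \<xi>1 k
    + 2 * Y_normsq A B K S J \<xi>0 \<xi>1 (\<lambda>\<xi>. k \<xi> - h \<xi>)"
proof -
  let ?w = "Y_density A B K S J \<xi>0 \<xi>1"
  have d: "(\<lambda>\<xi>. k \<xi> - h \<xi>) \<in> borel_measurable borel" using h k by measurable
  note [measurable] = borel_measurable_Y_density[OF J h] borel_measurable_Y_density[OF J k] borel_measurable_Y_density[OF J d]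
  have "(\<integral>\<^sup>+\<xi>. ennreal (?w \<xi> (h \<xi>)) \<partial>lborel)
      \<le> (\<integral>\<^sup>+\<xi>. 2 * ennreal (?w \<xi> (k \<xi>)) + 2 * ennreal (?w \<xi> (k \<xi> - h \<xi>)) \<partial>lborel)"
  proof (intro nn_integral_mono)
    fix \<xi>
    have "ennreal (?w \<xi> (h \<xi>)) \<le> ennreal (2 * ?w \<xi> (k \<xi>) + 2 * ?w \<xi> (k \<xi> - h \<xi>))"
      by (intro ennreal_leI Y_density_diff_le J)
    then show "ennreal (?w \<xi> (h \<xi>)) \<le> 2 * ennreal (?w \<xi> (k \<xi>)) + 2 * ennreal (?w \<xi> (k \<xi> - h \<xi>))"
      by (simp add: ennreal_mult Y_density_nonneg)
  qed
  also have "\<dots> = 2 * (\<integral>\<^sup>+\<xi>. ennreal (?w \<xi> (k \<xi>)) \<partial>lborel) + 2 * (\<integral>\<^sup>+\<xi>. ennreal (?w \<xi> (k \<xi> - h \<xi>)) \<partial>lborel)"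
    by (simp add: nn_integral_add nn_integral_cmult)
  finally show ?thesis by (simp add: Y_normsq_eq_integral_density J h k d lt)
qed

section \<open>From frequencies to the solution\<close>

text \<open>The observation is linear in the mode with coefficients continuous in \<open>\<xi> s\<close>; joint measurability
then reduces to that of the components of \<open>F\<close>.\<close>

lemma borel_measurable_observed:
  fixes F :: "real \<Rightarrow> complex^'n" and B :: "real^'m^'n"
  assumes [measurable]: "F \<in> borel_measurable borel"
  shows "(\<lambda>(s, \<xi>). (norm (observed A B (\<xi> * s) (F \<xi>)))\<^sup>2) \<in> borel_measurable (lborel \<Otimes>\<^sub>M lborel)"
proof -
  define P where "P i j \<tau> = observed A B \<tau> (axis j 1) $ i" for i j \<tau>
  have comp: "observed A B \<tau> z $ i = (\<Sum>j\<in>UNIV. P i j \<tau> * z $ j)" for \<tau> z i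
  proof -
    define E where "E = cmat (transpose B) ** mexp (mat (\<i> * complex_of_real \<tau>) ** cmat (transpose A))"
    have obs: "observed A B \<tau> z = E *v z" for z by (simp add: observed_def E_def matrix_vector_mul_assoc)
    have "P i j \<tau> = E $ i $ j" for j unfolding P_def obs by (rule matrix_component[symmetric])
    then show ?thesis unfolding obs by (simp add: matrix_vector_mult_def)
  qed
  have [measurable]: "P i j \<in> borel_measurable borel" for i j
    unfolding P_def using continuous_on_observed[of UNIV A B 1 "axis j 1"]
    by (intro borel_measurable_vec_nth borel_measurable_continuous_onI) simp
  show ?thesis unfolding norm_sq_vec comp by measurable
qed

lemma schwartz_continuous: "schwartz f \<Longrightarrow> continuous_on UNIV f"
  unfolding schwartz_def
  by (auto intro!: continuous_at_imp_continuous_on dest: has_vector_derivative_continuous)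

lemma schwartz_integrable:
  fixes f :: "real \<Rightarrow> complex^'n"
  assumes "schwartz f"
  shows "integrable lborel f"
proof -
  have meas: "f \<in> borel_measurable borel"
    by (rule borel_measurable_continuous_onI[OF schwartz_continuous[OF assms]])
  obtain D where D: "D 0 = f" "\<And>j k. bounded (range (\<lambda>x. x ^ j *\<^sub>R D k x))"
    using assms unfolding schwartz_def by (elim exE conjE, intro that) auto
  obtain a where a: "\<And>x. norm (f x) \<le> a" using D(2)[of 0 0] D(1) by (auto simp: bounded_iff)
  obtain b where b: "\<And>x. norm (x ^ 2 *\<^sub>R f x) \<le> b"
    using D(2)[of 2 0] D(1) unfolding bounded_iff by auto
  have "integrable lborel (\<lambda>x::real. (a + b) * inverse (1 + x\<^sup>2))"
    using integrable_inverse_1_plus_square by (simp add: set_integrable_def)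
  then show ?thesis
  proof (rule Bochner_Integration.integrable_bound)
    show "AE x in lborel. norm (f x) \<le> norm ((a + b) * inverse (1 + x\<^sup>2))"
    proof (rule AE_I2)
      fix x :: real
      have pos: "1 + x\<^sup>2 > 0" by (simp add: add_pos_nonneg)
      have "norm (f x) * (1 + x\<^sup>2) \<le> a + b" using a[of x] b[of x] by (simp add: algebra_simps)
      then have "norm (f x) \<le> (a + b) * inverse (1 + x\<^sup>2)" using pos by (simp add: field_simps)
      then show "norm (f x) \<le> norm ((a + b) * inverse (1 + x\<^sup>2))" by (simp only: real_norm_def)
    qed
  qed (use meas in simp)
qed

lemma integrable_phase:
  fixes f :: "real \<Rightarrow> complex^'n"
  assumes "integrable lborel f"
  shows "integrable lborel (\<lambda>x. exp (- \<i> * complex_of_real (x * \<xi>)) *s f x)"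
proof (rule Bochner_Integration.integrable_bound[OF assms])
  have [measurable]: "f \<in> borel_measurable borel" using borel_measurable_integrable[OF assms] by simp
  have "(\<lambda>x. \<chi> i. exp (- \<i> * complex_of_real (x * \<xi>)) * f x $ i) \<in> borel_measurable borel"
    by (subst borel_measurable_euclidean_space)
      (auto simp: Basis_vec_def inner_axis intro!: borel_measurable_inner borel_measurable_times)
  then show "(\<lambda>x. exp (- \<i> * complex_of_real (x * \<xi>)) *s f x) \<in> borel_measurable lborel"
    by (simp add: vector_scalar_mult_def)
qed (simp add: norm_vector_smult)

lemma borel_measurable_fourier:
  fixes f :: "real \<Rightarrow> complex^'n"
  assumes "schwartz f"
  shows "fourier f \<in> borel_measurable borel"
proof -
  have [measurable]: "f \<in> borel_measurable borel"
    by (rule borel_measurable_continuous_onI[OF schwartz_continuous[OF assms]])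
  have "(\<lambda>(\<xi>, x). \<chi> i. exp (- \<i> * complex_of_real (x * \<xi>)) * f x $ i) \<in> borel_measurable (borel \<Otimes>\<^sub>M borel)"
    by (subst borel_measurable_euclidean_space)
      (auto simp: Basis_vec_def inner_axis split_beta' intro!: borel_measurable_inner borel_measurable_times)
  then have [measurable]: "(\<lambda>(\<xi>, x). exp (- \<i> * complex_of_real (x * \<xi>)) *s f x) \<in> borel_measurable (borel \<Otimes>\<^sub>M lborel)"
    by (simp add: vector_scalar_mult_def)
  show ?thesis unfolding fourier_def by measurable
qed

lemma plancherel_le_vec:
  fixes f :: "real \<Rightarrow> complex^'n" and M :: "complex^'n^'m"
  assumes int: "integrable lborel f"
  shows "(\<integral>\<^sup>+\<xi>. ennreal ((norm (M *v fourier f \<xi>))\<^sup>2) \<partial>lborel)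
    \<le> ennreal (2 * pi) * (\<integral>\<^sup>+x. ennreal ((norm (M *v f x))\<^sup>2) \<partial>lborel)"
proof -
  define g where "g i x = (M *v f x) $ i" for i x
  have blin: "bounded_linear (\<lambda>v. (M *v v) $ i)" for i
    using bounded_linear_compose[OF bounded_linear_vec_nth linear_linear[THEN iffD2, OF linear_cmatrix_mult]] .
  have g: "integrable lborel (g i)" for i
    unfolding g_def by (rule integrable_bounded_linear[OF blin int])
  have [measurable]: "g i \<in> borel_measurable borel" for i
    using borel_measurable_integrable[OF g] by simp
  have F: "(M *v fourier f \<xi>) $ i = (\<integral>x. exp (- \<i> * complex_of_real (x * \<xi>)) * g i x \<partial>lborel)" for \<xi> i
    unfolding fourier_def
    by (subst integral_bounded_linear[OF blin integrable_phase[OF int], symmetric])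
      (simp add: vector_scalar_commute g_def)
  have [measurable]: "(\<lambda>\<xi>. (M *v fourier f \<xi>) $ i) \<in> borel_measurable borel" for i
    unfolding F by measurable
  have "(\<integral>\<^sup>+\<xi>. ennreal ((norm (M *v fourier f \<xi>))\<^sup>2) \<partial>lborel)
      = (\<Sum>i\<in>UNIV. \<integral>\<^sup>+\<xi>. ennreal ((norm ((M *v fourier f \<xi>) $ i))\<^sup>2) \<partial>lborel)"
    unfolding norm_sq_vec by (simp add: sum_ennreal[symmetric] nn_integral_sum del: sum_ennreal)
  also have "\<dots> \<le> (\<Sum>i\<in>UNIV. ennreal (2 * pi) * (\<integral>\<^sup>+x. ennreal ((norm (g i x))\<^sup>2) \<partial>lborel))"
    unfolding F by (intro sum_mono plancherel_le g)
  also have "\<dots> = ennreal (2 * pi) * (\<integral>\<^sup>+x. ennreal ((norm (M *v f x))\<^sup>2) \<partial>lborel)"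
    unfolding norm_sq_vec g_def[symmetric] sum_distrib_left[symmetric]
    by (simp add: sum_ennreal[symmetric] nn_integral_sum del: sum_ennreal)
  finally show ?thesis .
qed

text \<open>Nothing is known about a solution outside \<open>[0, T]\<close>, so it has to be cut off before Tonelli's theorem
can be applied to it.\<close>

lemma borel_measurable_cutoff:
  fixes q :: "real \<Rightarrow> real \<Rightarrow> complex^'n"
  assumes "continuous_on ({0..T} \<times> UNIV) (\<lambda>(t, x). q t x)"
  shows "(\<lambda>(t, x). indicator {0..T} t *\<^sub>R q t x) \<in> borel_measurable borel"
proof -
  have "({0..T} \<times> UNIV :: (real \<times> real) set) \<in> sets borel"
    by (intro borel_closed closed_Times) auto
  from borel_measurable_continuous_on_indicator[OF this assms] show ?thesis
    by (simp add: indicator_times split_beta')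
qed

lemma L2_normsq_cong:
  assumes "\<And>t x. 0 < t \<Longrightarrow> t < T \<Longrightarrow> a (t, x) = b (t, x)"
  shows "L2_normsq T a = L2_normsq T b"
  unfolding L2_normsq_def by (intro nn_integral_cong) (auto simp: indicator_def assms)

lemma L2_normsq_triangle:
  fixes a b :: "real \<times> real \<Rightarrow> complex^'m"
  assumes [measurable]: "a \<in> borel_measurable borel" "b \<in> borel_measurable borel"
  shows "L2_normsq T a \<le> 2 * L2_normsq T (\<lambda>p. a p - b p) + 2 * L2_normsq T b"
proof -
  have [measurable]: "a \<in> borel_measurable (borel \<Otimes>\<^sub>M borel)" "b \<in> borel_measurable (borel \<Otimes>\<^sub>M borel)"
    using assms by (simp_all add: borel_prod)
  have "L2_normsq T a \<le> (\<integral>\<^sup>+t. (\<integral>\<^sup>+x. 2 * ennreal ((norm (a (t, x) - b (t, x)))\<^sup>2) + 2 * ennreal ((norm (b (t, x)))\<^sup>2) \<partial>lborel)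
      * indicator {0<..<T} t \<partial>lborel)"
    unfolding L2_normsq_def
  proof (intro nn_integral_mono mult_right_mono)
    fix t x
    have "(norm (a (t, x)))\<^sup>2 \<le> 2 * (norm (a (t, x) - b (t, x)))\<^sup>2 + 2 * (norm (b (t, x)))\<^sup>2"
      using norm_add_sq_le[of "a (t, x) - b (t, x)" "b (t, x)"] by simp
    then have "ennreal ((norm (a (t, x)))\<^sup>2) \<le> ennreal (2 * (norm (a (t, x) - b (t, x)))\<^sup>2 + 2 * (norm (b (t, x)))\<^sup>2)"
      by (rule ennreal_leI)
    then show "ennreal ((norm (a (t, x)))\<^sup>2) \<le> 2 * ennreal ((norm (a (t, x) - b (t, x)))\<^sup>2) + 2 * ennreal ((norm (b (t, x)))\<^sup>2)"
      by (simp add: ennreal_mult)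
  qed auto
  also have "\<dots> = 2 * L2_normsq T (\<lambda>p. a p - b p) + 2 * L2_normsq T b"
    unfolding L2_normsq_def
    by (simp add: nn_integral_add nn_integral_cmult distrib_right mult.assoc)
  finally show ?thesis .
qed

text \<open>By Tonelli the energy is integrated over \<open>\<xi>\<close> first.  At fixed \<open>s\<close> the integrand is the transform of
\<open>B\<^sup>\<top> q (T - s)\<close>, and Plancherel applies.\<close>

lemma observed_energy_le_observation:
  fixes A :: "real^'n^'n" and B :: "real^'m^'n"
  assumes T: "T > 0" and f: "schwartz f" and q: "adjoint_solution A T f q"
  shows "(\<integral>\<^sup>+\<xi>. ennreal (observed_energy A B T \<xi> (fourier f \<xi>)) \<partial>lborel)
    \<le> ennreal (2 * pi) * L2_normsq T (\<lambda>(t, x). cmat (transpose B) *v q t x)"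
proof -
  note [measurable] = borel_measurable_fourier[OF f]
  define o2 where "o2 s \<xi> = (norm (observed A B (\<xi> * s) (fourier f \<xi>)))\<^sup>2" for s \<xi>
  have [measurable]: "(\<lambda>(s, \<xi>). o2 s \<xi>) \<in> borel_measurable (lborel \<Otimes>\<^sub>M lborel)"
    unfolding o2_def by (rule borel_measurable_observed) measurable
  define g where "g p = cmat (transpose B) *v (indicator {0..T} (fst p) *\<^sub>R q (fst p) (snd p))" for p
  have "(\<lambda>(t, x). indicator {0..T} t *\<^sub>R q t x) \<in> borel_measurable borel"
    using q by (intro borel_measurable_cutoff) (simp add: adjoint_solution_def)
  then have "g \<in> borel_measurable borel" unfolding g_def
    by (intro borel_measurable_linear[OF linear_cmatrix_mult]) (simp add: split_beta')
  then have [measurable]: "g \<in> borel_measurable (borel \<Otimes>\<^sub>M borel)" by (simp add: borel_prod)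
  define G where "G t = (\<integral>\<^sup>+x. ennreal ((norm (g (t, x)))\<^sup>2) \<partial>lborel)" for t
  have [measurable]: "G \<in> borel_measurable borel" unfolding G_def by measurable
  have "(\<integral>\<^sup>+\<xi>. ennreal (observed_energy A B T \<xi> (fourier f \<xi>)) \<partial>lborel)
      = (\<integral>\<^sup>+\<xi>. (\<integral>\<^sup>+s. ennreal (indicator {0..T} s * o2 s \<xi>) \<partial>lborel) \<partial>lborel)"
  proof (intro nn_integral_cong)
    fix \<xi>
    have "((\<lambda>s. o2 s \<xi>) has_integral observed_energy A B T \<xi> (fourier f \<xi>)) {0..T}"
      unfolding o2_def observed_energy_def
      by (intro integrable_integral integrable_continuous_real continuous_intros continuous_on_observed)
    from nn_integral_has_integral_lebesgue[OF _ this]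
    show "ennreal (observed_energy A B T \<xi> (fourier f \<xi>)) = (\<integral>\<^sup>+s. ennreal (indicator {0..T} s * o2 s \<xi>) \<partial>lborel)"
      by (simp add: o2_def)
  qed
  also have "\<dots> = (\<integral>\<^sup>+s. (\<integral>\<^sup>+\<xi>. ennreal (indicator {0..T} s * o2 s \<xi>) \<partial>lborel) \<partial>lborel)"
    by (rule lborel_pair.Fubini') measurable
  also have "\<dots> \<le> (\<integral>\<^sup>+s. ennreal (2 * pi) * G (T - s) \<partial>lborel)"
  proof (intro nn_integral_mono)
    fix s
    show "(\<integral>\<^sup>+\<xi>. ennreal (indicator {0..T} s * o2 s \<xi>) \<partial>lborel) \<le> ennreal (2 * pi) * G (T - s)"
    proof (cases "s \<in> {0..T}")
      case True
      then have t: "T - s \<in> {0..T}" by auto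
      have four: "fourier (q (T - s)) \<xi> =
          mexp (mat (\<i> * complex_of_real (\<xi> * (T - (T - s)))) ** cmat (transpose A)) *v fourier f \<xi>" for \<xi>
        using q t unfolding adjoint_solution_def by blast
      have "(\<integral>\<^sup>+\<xi>. ennreal (indicator {0..T} s * o2 s \<xi>) \<partial>lborel)
          = (\<integral>\<^sup>+\<xi>. ennreal ((norm (cmat (transpose B) *v fourier (q (T - s)) \<xi>))\<^sup>2) \<partial>lborel)"
        using True by (intro nn_integral_cong) (simp add: o2_def observed_def four)
      also have "\<dots> \<le> ennreal (2 * pi) * (\<integral>\<^sup>+x. ennreal ((norm (cmat (transpose B) *v q (T - s) x))\<^sup>2) \<partial>lborel)"
        using q t by (intro plancherel_le_vec schwartz_integrable) (simp add: adjoint_solution_def)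
      also have "\<dots> = ennreal (2 * pi) * G (T - s)" using t by (simp add: G_def g_def)
      finally show ?thesis .
    qed simp
  qed
  also have "\<dots> = ennreal (2 * pi) * (\<integral>\<^sup>+s. G (T - s) \<partial>lborel)" by (rule nn_integral_cmult) measurable
  also have "(\<integral>\<^sup>+s. G (T - s) \<partial>lborel) = (\<integral>\<^sup>+t. G t \<partial>lborel)"
    using nn_integral_real_affine[of G "-1" T] by simp
  also have "(\<integral>\<^sup>+t. G t \<partial>lborel) = (\<integral>\<^sup>+t. G t * indicator {0<..<T} t \<partial>lborel)"
  proof (rule nn_integral_cong_AE)
    have "AE t in lborel. t \<noteq> 0 \<and> t \<noteq> T" using AE_lborel_singleton[of 0] AE_lborel_singleton[of T] by eventually_elim simp
    then show "AE t in lborel. G t = G t * indicator {0<..<T} t"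
    proof eventually_elim
      case (elim t)
      show ?case
      proof (cases "t \<in> {0..T}")
        case False
        then have "G t = 0" by (simp add: G_def g_def linear_0[OF linear_cmatrix_mult])
        then show ?thesis by simp
      qed (use elim in \<open>auto simp: indicator_def\<close>)
    qed
  qed
  also have "\<dots> = L2_normsq T g" by (simp add: L2_normsq_def G_def)
  also have "\<dots> = L2_normsq T (\<lambda>(t, x). cmat (transpose B) *v q t x)"
    by (rule L2_normsq_cong) (simp add: g_def)
  finally show ?thesis by (simp add: mult_left_mono)
qed

theorem proposition6p4:
  fixes A :: "real^'n^'n" and B :: "real^'m^'n" and K :: nat and T :: real
  assumes "CARD('m) \<le> CARD('n)"
    and "matrix_spectrum (cmat A) \<subseteq> \<real>"
    and "kalman_index A B K"
    and "T > 0"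
  shows "\<exists>\<xi>0s > 0. \<exists>\<xi>1s > 0. \<forall>S J \<xi>0 \<xi>1.
    jordan_decomposition (transpose A) S J \<longrightarrow>
    0 < \<xi>0 \<longrightarrow> \<xi>0 \<le> \<xi>0s \<longrightarrow> \<xi>1s \<le> \<xi>1 \<longrightarrow> \<xi>0 < \<xi>1 \<longrightarrow>
    (\<exists>C > 0. \<forall>h \<in> Y_space A B K S J \<xi>0 \<xi>1. \<forall>g.
       adjoint_observation A B K S J \<xi>0 \<xi>1 T h g \<longrightarrow>
       Y_normsq A B K S J \<xi>0 \<xi>1 h \<le> ennreal C * L2_normsq T g)"
proof (rule exI[of _ 1], intro conjI, simp, rule exI[of _ 1], intro conjI, simp, intro allI impI)
  fix S J :: "real^'n^'n" and \<xi>0 \<xi>1 :: real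
  assume dec: "jordan_decomposition (transpose A) S J"
    and \<xi>: "0 < \<xi>0" "\<xi>0 \<le> 1" "1 \<le> \<xi>1" "\<xi>0 < \<xi>1"
  have J: "is_jordan J" using dec by (simp add: jordan_decomposition_def)
  have "kalman_full A B K" using assms(3) by (simp add: kalman_index_def)
  then obtain C where C: "C > 0" and pt: "\<And>\<xi> z. Y_density A B K S J \<xi>0 \<xi>1 \<xi> z \<le> C * observed_energy A B T \<xi> z"
    using frequency_observability[OF _ assms(4) dec \<xi>(1,2,4)] by blast
  let ?Y = "Y_normsq A B K S J \<xi>0 \<xi>1"
  define C' where "C' = C * (2 * pi)"
  have C': "C' > 0" using C by (simp add: C'_def)
  have smooth: "?Y (fourier f) \<le> ennreal C' * L2_normsq T (\<lambda>(t, x). cmat (transpose B) *v q t x)"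
    if f: "schwartz f" and q: "adjoint_solution A T f q" for f q
  proof -
    have "?Y (fourier f) = (\<integral>\<^sup>+\<xi>. ennreal (Y_density A B K S J \<xi>0 \<xi>1 \<xi> (fourier f \<xi>)) \<partial>lborel)"
      by (rule Y_normsq_eq_integral_density[OF J borel_measurable_fourier[OF f] \<xi>(4)])
    \<comment> \<open>The constant is pulled out of the integral of the density, whose measurability is known.\<close>
    also have "\<dots> = (\<integral>\<^sup>+\<xi>. ennreal C * ennreal (Y_density A B K S J \<xi>0 \<xi>1 \<xi> (fourier f \<xi>) / C) \<partial>lborel)"
      using C by (simp add: ennreal_mult[symmetric] Y_density_nonneg)
    also have "\<dots> = ennreal C * (\<integral>\<^sup>+\<xi>. ennreal (Y_density A B K S J \<xi>0 \<xi>1 \<xi> (fourier f \<xi>) / C) \<partial>lborel)"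
      using borel_measurable_Y_density[OF J borel_measurable_fourier[OF f], of A B K S \<xi>0 \<xi>1]
      by (intro nn_integral_cmult) simp
    also have "\<dots> \<le> ennreal C * (\<integral>\<^sup>+\<xi>. ennreal (observed_energy A B T \<xi> (fourier f \<xi>)) \<partial>lborel)"
      using C pt by (intro mult_left_mono nn_integral_mono ennreal_leI) (auto simp: pos_divide_le_eq mult.commute)
    also have "\<dots> \<le> ennreal C * (ennreal (2 * pi) * L2_normsq T (\<lambda>(t, x). cmat (transpose B) *v q t x))"
      by (intro mult_left_mono observed_energy_le_observation assms(4) f q) simp
    finally show ?thesis using C by (simp add: C'_def ennreal_mult mult.assoc)
  qed
  show "\<exists>C>0. \<forall>h\<in>Y_space A B K S J \<xi>0 \<xi>1. \<forall>g. adjoint_observation A B K S J \<xi>0 \<xi>1 T h g \<longrightarrow>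
      ?Y h \<le> ennreal C * L2_normsq T g"
  proof (intro exI[of _ "4 * C'"] conjI ballI allI impI)
    show "0 < 4 * C'" using C' by simp
    fix h g assume h: "h \<in> Y_space A B K S J \<xi>0 \<xi>1" and "adjoint_observation A B K S J \<xi>0 \<xi>1 T h g"
    then obtain f q where g: "g \<in> borel_measurable borel"
      and f: "\<And>n. schwartz (f n)" and q: "\<And>n. adjoint_solution A T (f n) (q n)"
      and Y0: "(\<lambda>n. ?Y (\<lambda>\<xi>. fourier (f n) \<xi> - h \<xi>)) \<longlonglongrightarrow> 0"
      and L0: "(\<lambda>n::nat. L2_normsq T (\<lambda>(t, x). cmat (transpose B) *v q n t x - g (t, x))) \<longlonglongrightarrow> 0"
      unfolding adjoint_observation_def by blast
    have hm: "h \<in> borel_measurable borel" using h by (simp add: Y_space_def)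
    let ?e = "\<lambda>n. L2_normsq T (\<lambda>(t, x). cmat (transpose B) *v q n t x - g (t, x))"
    have bound: "?Y h \<le> 2 * (ennreal C' * (2 * ?e n + 2 * L2_normsq T g)) + 2 * ?Y (\<lambda>\<xi>. fourier (f n) \<xi> - h \<xi>)" for n
    proof -
      define a where "a p = cmat (transpose B) *v (indicator {0..T} (fst p) *\<^sub>R q n (fst p) (snd p))" for p
      have "(\<lambda>(t, x). indicator {0..T} t *\<^sub>R q n t x) \<in> borel_measurable borel"
        using q[of n] by (intro borel_measurable_cutoff) (simp add: adjoint_solution_def)
      then have a: "a \<in> borel_measurable borel" unfolding a_def
        by (intro borel_measurable_linear[OF linear_cmatrix_mult]) (simp add: split_beta')
      have "L2_normsq T (\<lambda>(t, x). cmat (transpose B) *v q n t x) = L2_normsq T a"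
        by (rule L2_normsq_cong) (simp add: a_def)
      also have "\<dots> \<le> 2 * L2_normsq T (\<lambda>p. a p - g p) + 2 * L2_normsq T g"
        by (rule L2_normsq_triangle[OF a g])
      also have "L2_normsq T (\<lambda>p. a p - g p) = ?e n"
        by (rule L2_normsq_cong) (simp add: a_def)
      finally have "?Y (fourier (f n)) \<le> ennreal C' * (2 * ?e n + 2 * L2_normsq T g)"
        using smooth[OF f q, of n] by (meson mult_left_mono order_trans zero_le)
      then show ?thesis
        using Y_normsq_triangle[OF J hm borel_measurable_fourier[OF f[of n]] \<xi>(4), of A B K S]
        by (meson add_right_mono mult_left_mono order_trans zero_le)
    qed
    have "(\<lambda>n. 2 * (ennreal C' * (2 * ?e n + 2 * L2_normsq T g)) + 2 * ?Y (\<lambda>\<xi>. fourier (f n) \<xi> - h \<xi>))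
        \<longlonglongrightarrow> 2 * (ennreal C' * (2 * 0 + 2 * L2_normsq T g)) + 2 * 0"
      by (intro tendsto_add ennreal_tendsto_cmult tendsto_const Y0 L0) auto
    then have "?Y h \<le> 2 * (ennreal C' * (2 * 0 + 2 * L2_normsq T g)) + 2 * 0"
      by (rule LIMSEQ_le_const) (use bound in blast)
    also have "\<dots> = ennreal (4 * C') * L2_normsq T g"
      using C' by (simp add: ennreal_mult mult_ac)
    finally show "?Y h \<le> ennreal (4 * C') * L2_normsq T g" .
  qed
qed

end
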